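(* Let $u$ be the solution map of the affine parametric elliptic problem described in the context. Assume that $\rho=(\rho_j)_{j\ge1}$ is a sequence of positive numbers such that, for some $\widetilde r>0$, $$\sum_{j\ge1}\rho_j|\psi_j(x)|\le\overline a(x)-\widetilde r,\qquad x\in D,$$ with $(\rho_j^{-1})_{j\ge1}\in\ell^q(\mathbb{N})$ for some $0<q<\infty$ and $\rho_j>1$ for all $j$. Let $b:=(\rho_j^{-1})_{j\ge1}$. Then there is a constant $C$ independent of $n$ such that for all $n\ge1$ $$\|u-u_{\Lambda_n}\|_{L^2(U,V)}\le Cn^{-s},\qquad s:=\frac1q,$$ where $u_{\Lambda_n}:=\sum_{\nu\in\Lambda_n}w_\nu L_\nu$ is the truncated Legendre series and $\Lambda_n$ is any downward closed set corresponding to the $n$ largest $\widehat\kappa_\nu$, where $\kappa_\nu:=b^\nu\beta(\nu)$. If $q<2$, we also have, with a constant $C$ independent of $n$, for all $n\ge1$, $$\|u-u_{\Lambda_n}\|_{L^\infty(U,V)}\le Cn^{-s},\qquad s:=\frac1q-\frac12,$$ with $\Lambda_n$ any downward closed set corresponding to the $n$ largest $\widehat\kappa_\nu$, where $\kappa_\nu:=b^\nu\beta(\nu)^2$.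
   Context: Setting: $D\subset\mathbb{R}^k$ is a bounded Lipschitz domain ($k=1,2$ or $3$), $f\in L^2(D)$, $\overline a,\psi_j\in L^\infty(D)$ for $j\ge1$, $V:=H^1_0(D)$, $U:=[-1,1]^{\mathbb{N}}$. For $y=(y_j)_{j\ge1}\in U$, let $a(y):=\overline a+\sum_{j\ge1}y_j\psi_j$ and let $u(y)\in V$ be the weak solution of $-\mathrm{div}(a(y)\nabla u(y))=f$ in $D$ with $u(y)=0$ on $\partial D$, i.e. $\int_D a(y)\nabla u(y)\cdot\nabla v=\int_D fv$ for all $v\in V$ (the displayed inequality in the claim, with $\rho_j>1$, implies $\sum_j|\psi_j|\le\overline a-\widetilde r$, so this is well-posed for all $y\in U$). Inequalities between functions on $D$ are understood almost everywhere. $\mathcal{F}$ is the set of finitely supported sequences $\nu=(\nu_j)_{j\ge1}$ of nonnegative integers, with $\widetilde\nu\le\nu$ iff $\widetilde\nu_j\le\nu_j$ for all $j$. A set $\Lambda\subset\mathcal{F}$ is downward closed if $\nu\in\Lambda$, $\widetilde\nu\le\nu$ imply $\widetilde\nu\in\Lambda$. Notation: $b^\nu:=\prod_{j\ge1}b_j^{\nu_j}$, $\beta(\nu):=\prod_{j\ge1}(1+2\nu_j)^{1/2}$; the monotone majorant of $(\kappa_\nu)_{\nu\in\mathcal{F}}$ is $\widehat\kappa_\nu:=\max_{\widetilde\nu\ge\nu}|\kappa_{\widetilde\nu}|$. A set corresponding to the $n$ largest $\widehat\kappa_\nu$ is a set $\Lambda\subset\mathcal{F}$ with $\#(\Lambda)=n$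 such that $\widehat\kappa_\nu\ge\widehat\kappa_\mu$ for all $\nu\in\Lambda$, $\mu\notin\Lambda$. $d\mu:=\bigotimes_{j\ge1}\frac{dy_j}2$ is the uniform probability measure on $U$, $L^2(U,V)=L^2(U,V,d\mu)$ and $\|v\|_{L^\infty(U,V)}:=\sup_{y\in U}\|v(y)\|_V$. $(L_k)_{k\ge0}$ are the univariate Legendre polynomials on $[-1,1]$ normalized by $\int_{-1}^1|L_k(t)|^2\frac{dt}2=1$, $L_\nu(y):=\prod_{j\ge1}L_{\nu_j}(y_j)$, and $w_\nu:=\int_Uu(y)L_\nu(y)\,d\mu\in V$. *)

theory Defs
  imports "HOL-Probability.Probability" "HOL-Computational_Algebra.Polynomial"
begin


definition square_integrable ::
  "'x measure \<Rightarrow> ('x \<Rightarrow> 'b::{real_normed_vector, second_countable_topology}) \<Rightarrow> bool" where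
  "square_integrable M f \<longleftrightarrow> f \<in> borel_measurable M \<and> integrable M (\<lambda>x. (norm (f x))\<^sup>2)"

definition L2_norm :: "'x measure \<Rightarrow> ('x \<Rightarrow> 'b::{real_normed_vector, second_countable_topology}) \<Rightarrow> real" where
  "L2_norm M f = sqrt (\<integral>x. (norm (f x))\<^sup>2 \<partial>M)"

lemma integrable_dominated:
  fixes g h :: "'x \<Rightarrow> real"
  assumes "integrable M h" "g \<in> borel_measurable M" "\<And>x. \<bar>g x\<bar> \<le> h x"
  shows "integrable M g"
proof (rule Bochner_Integration.integrable_bound[OF assms(1,2)], rule AE_I2)
  fix x show "norm (g x) \<le> norm (h x)"
    using assms(3)[of x] by simp
qed

lemma square_integrable_0: "square_integrable M (\<lambda>x. 0)"
  by (simp add: square_integrable_def)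

lemma square_integrable_scaleR:
  "square_integrable M f \<Longrightarrow> square_integrable M (\<lambda>x. c *\<^sub>R f x)"
  by (auto simp: square_integrable_def power_mult_distrib)

lemma square_integrable_add:
  assumes "square_integrable M f" "square_integrable M g"
  shows "square_integrable M (\<lambda>x. f x + g x)"
  unfolding square_integrable_def
proof
  have m: "f \<in> borel_measurable M" "g \<in> borel_measurable M"
    and i: "integrable M (\<lambda>x. (norm (f x))\<^sup>2)" "integrable M (\<lambda>x. (norm (g x))\<^sup>2)"
    using assms by (auto simp: square_integrable_def)
  show "(\<lambda>x. f x + g x) \<in> borel_measurable M" using m by simp
  have "(norm (f x + g x))\<^sup>2 \<le> 2 * (norm (f x))\<^sup>2 + 2 * (norm (g x))\<^sup>2" for x
  proof -
    have "(norm (f x + g x))\<^sup>2 \<le> (norm (f x) + norm (g x))\<^sup>2"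
      by (intro power_mono norm_triangle_ineq) simp
    also have "\<dots> \<le> 2 * (norm (f x))\<^sup>2 + 2 * (norm (g x))\<^sup>2"
      using sum_squares_bound[of "norm (f x)" "norm (g x)"] by (simp add: power2_sum)
    finally show ?thesis .
  qed
  then have "\<bar>(norm (f x + g x))\<^sup>2\<bar> \<le> 2 * (norm (f x))\<^sup>2 + 2 * (norm (g x))\<^sup>2" for x
    by (metis abs_of_nonneg zero_le_power2)
  moreover have "integrable M (\<lambda>x. 2 * (norm (f x))\<^sup>2 + 2 * (norm (g x))\<^sup>2)"
    by (intro Bochner_Integration.integrable_add integrable_mult_right i)
  moreover have "(\<lambda>x. (norm (f x + g x))\<^sup>2) \<in> borel_measurable M"
    using m by measurable
  ultimately show "integrable M (\<lambda>x. (norm (f x + g x))\<^sup>2)"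
    by (rule integrable_dominated[rotated 2])
qed

lemma square_integrable_uminus: "square_integrable M f \<Longrightarrow> square_integrable M (\<lambda>x. - f x)"
  by (auto simp: square_integrable_def)

lemma square_integrable_diff:
  "square_integrable M f \<Longrightarrow> square_integrable M g \<Longrightarrow> square_integrable M (\<lambda>x. f x - g x)"
  using square_integrable_add[of M f "\<lambda>x. - g x"] square_integrable_uminus[of M g] by simp

lemma square_integrable_inner:
  fixes f g :: "'x \<Rightarrow> 'b::euclidean_space"
  assumes "square_integrable M f" "square_integrable M g"
  shows "integrable M (\<lambda>x. f x \<bullet> g x)"
proof -
  have m: "f \<in> borel_measurable M" "g \<in> borel_measurable M"
    and i: "integrable M (\<lambda>x. (norm (f x))\<^sup>2)" "integrable M (\<lambda>x. (norm (g x))\<^sup>2)"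
    using assms by (auto simp: square_integrable_def)
  have "\<bar>f x \<bullet> g x\<bar> \<le> (norm (f x))\<^sup>2 + (norm (g x))\<^sup>2" for x
  proof -
    have "\<bar>f x \<bullet> g x\<bar> \<le> norm (f x) * norm (g x)" by (rule Cauchy_Schwarz_ineq2)
    also have "\<dots> \<le> (norm (f x))\<^sup>2 + (norm (g x))\<^sup>2"
      using sum_squares_bound[of "norm (f x)" "norm (g x)"]
        mult_nonneg_nonneg[OF norm_ge_zero[of "f x"] norm_ge_zero[of "g x"]] by linarith
    finally show ?thesis .
  qed
  moreover have "integrable M (\<lambda>x. (norm (f x))\<^sup>2 + (norm (g x))\<^sup>2)"
    by (intro Bochner_Integration.integrable_add i)
  moreover have "(\<lambda>x. f x \<bullet> g x) \<in> borel_measurable M"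
    using m by measurable
  ultimately show ?thesis
    by (rule integrable_dominated[rotated 2])
qed

text \<open>
  The Lebesgue space \<open>L\<^sup>2\<close> of square integrable functions on the whole Euclidean space, modulo equality
  almost everywhere.  It is a separable Hilbert space, as required for the Bochner integral.
\<close>

definition L2_rel :: "('a::euclidean_space \<Rightarrow> 'b::euclidean_space) \<Rightarrow> ('a \<Rightarrow> 'b) \<Rightarrow> bool" where
  "L2_rel f g \<longleftrightarrow> square_integrable lebesgue f \<and> square_integrable lebesgue g \<and>
     (AE x in lebesgue. f x = g x)"

lemma part_equivp_L2_rel: "part_equivp L2_rel"
proof (rule part_equivpI)
  show "\<exists>f. L2_rel f f"
    by (rule exI[of _ "\<lambda>x. 0"]) (simp add: L2_rel_def square_integrable_0)
  show "symp L2_rel"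
    by (auto simp: symp_def L2_rel_def elim: AE_mp)
  show "transp L2_rel"
    unfolding transp_def L2_rel_def by (auto elim!: AE_mp)
qed

quotient_type (overloaded) ('a, 'b) L2 = "'a::euclidean_space \<Rightarrow> 'b::euclidean_space" / partial: L2_rel
  morphisms rep_L2 to_L2
  by (rule part_equivp_L2_rel)

instantiation L2 :: (euclidean_space, euclidean_space) real_vector
begin

lift_definition zero_L2 :: "('a, 'b) L2" is "\<lambda>x. 0"
  by (simp add: L2_rel_def square_integrable_0)

lift_definition plus_L2 :: "('a, 'b) L2 \<Rightarrow> ('a, 'b) L2 \<Rightarrow> ('a, 'b) L2" is "\<lambda>f g x. f x + g x"
  by (auto simp: L2_rel_def square_integrable_add elim!: AE_mp)

lift_definition minus_L2 :: "('a, 'b) L2 \<Rightarrow> ('a, 'b) L2 \<Rightarrow> ('a, 'b) L2" is "\<lambda>f g x. f x - g x"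
  by (auto simp: L2_rel_def square_integrable_diff elim!: AE_mp)

lift_definition uminus_L2 :: "('a, 'b) L2 \<Rightarrow> ('a, 'b) L2" is "\<lambda>f x. - f x"
  by (auto simp: L2_rel_def square_integrable_uminus elim!: AE_mp)

lift_definition scaleR_L2 :: "real \<Rightarrow> ('a, 'b) L2 \<Rightarrow> ('a, 'b) L2" is "\<lambda>c f x. c *\<^sub>R f x"
  by (auto simp: L2_rel_def square_integrable_scaleR elim!: AE_mp)

instance
  by standard (transfer; auto simp: L2_rel_def algebra_simps square_integrable_add
      square_integrable_scaleR square_integrable_uminus square_integrable_diff square_integrable_0)+

end

instantiation L2 :: (euclidean_space, euclidean_space) real_inner
begin

lift_definition inner_L2 :: "('a, 'b) L2 \<Rightarrow> ('a, 'b) L2 \<Rightarrow> real" is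
  "\<lambda>f g. \<integral>x. f x \<bullet> g x \<partial>lebesgue"
  by (rule integral_cong_AE)
    (auto simp: L2_rel_def square_integrable_def elim!: AE_mp)

definition norm_L2 :: "('a, 'b) L2 \<Rightarrow> real" where "norm_L2 f = sqrt (f \<bullet> f)"

definition sgn_L2 :: "('a, 'b) L2 \<Rightarrow> ('a, 'b) L2" where "sgn_L2 f = inverse (norm f) *\<^sub>R f"

definition dist_L2 :: "('a, 'b) L2 \<Rightarrow> ('a, 'b) L2 \<Rightarrow> real" where "dist_L2 f g = norm (f - g)"

definition uniformity_L2 :: "(('a, 'b) L2 \<times> ('a, 'b) L2) filter" where
  "uniformity_L2 = (INF e\<in>{0 <..}. principal {(x, y). dist x y < e})"

definition open_L2 :: "('a, 'b) L2 set \<Rightarrow> bool" where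
  "open_L2 S \<longleftrightarrow> (\<forall>x\<in>S. \<forall>\<^sub>F (x', y) in uniformity. x' = x \<longrightarrow> y \<in> S)"

instance
proof
  fix f g h :: "('a, 'b) L2" and c :: real and S :: "('a, 'b) L2 set"
  show "f \<bullet> g = g \<bullet> f"
    by transfer (simp add: inner_commute)
  show "(f + g) \<bullet> h = f \<bullet> h + g \<bullet> h"
    by transfer (simp add: inner_add_left L2_rel_def square_integrable_inner)
  show "(c *\<^sub>R f) \<bullet> g = c * (f \<bullet> g)"
    by transfer simp
  show "0 \<le> f \<bullet> f"
    by transfer simp
  show "f \<bullet> f = 0 \<longleftrightarrow> f = 0"
  proof transfer
    fix f :: "'a \<Rightarrow> 'b" assume "L2_rel f f"
    then have f: "square_integrable lebesgue f" by (simp add: L2_rel_def)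
    show "(\<integral>x. f x \<bullet> f x \<partial>lebesgue) = 0 \<longleftrightarrow> L2_rel f (\<lambda>x. 0)"
      using integral_nonneg_eq_0_iff_AE[OF square_integrable_inner[OF f f]] f
      by (simp add: L2_rel_def square_integrable_0)
  qed
  show "norm f = sqrt (f \<bullet> f)" by (simp add: norm_L2_def)
  show "sgn f = f /\<^sub>R norm f" by (simp add: sgn_L2_def)
  show "dist f g = norm (f - g)" by (simp add: dist_L2_def)
  show "(uniformity :: (('a, 'b) L2 \<times> ('a, 'b) L2) filter) = (INF e\<in>{0 <..}. principal {(x, y). dist x y < e})"
    by (simp add: uniformity_L2_def)
  show "open S = (\<forall>x\<in>S. \<forall>\<^sub>F (x', y) in uniformity. x' = x \<longrightarrow> y \<in> S)"
    by (simp add: open_L2_def)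
qed

end

lemma square_integrable_rep_L2: "square_integrable lebesgue (rep_L2 v)"
  using Quotient_rep_reflp[OF Quotient_L2] by (simp add: L2_rel_def)

lemma to_L2_rep_L2: "to_L2 (rep_L2 v) = v"
  by (rule Quotient_abs_rep[OF Quotient_L2])

lemma to_L2_eq_iff:
  assumes "square_integrable lebesgue f" "square_integrable lebesgue g"
  shows "to_L2 f = to_L2 g \<longleftrightarrow> (AE x in lebesgue. f x = g x)"
  using assms Quotient_rel[OF Quotient_L2, of f g] by (simp add: L2_rel_def)

lemma rep_L2_to_L2:
  assumes "square_integrable lebesgue f"
  shows "AE x in lebesgue. rep_L2 (to_L2 f) x = f x"
  using assms to_L2_eq_iff square_integrable_rep_L2 to_L2_rep_L2 by blast

lemma to_L2_zero: "to_L2 (\<lambda>x. 0) = 0"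
  by (simp add: zero_L2_def)

lemma to_L2_add:
  "square_integrable lebesgue f \<Longrightarrow> square_integrable lebesgue g \<Longrightarrow>
    to_L2 f + to_L2 g = to_L2 (\<lambda>x. f x + g x)"
  by (rule plus_L2.abs_eq) (auto simp: L2_rel_def)

lemma to_L2_diff:
  "square_integrable lebesgue f \<Longrightarrow> square_integrable lebesgue g \<Longrightarrow>
    to_L2 f - to_L2 g = to_L2 (\<lambda>x. f x - g x)"
  by (rule minus_L2.abs_eq) (auto simp: L2_rel_def)

lemma to_L2_scaleR:
  "square_integrable lebesgue f \<Longrightarrow> c *\<^sub>R to_L2 f = to_L2 (\<lambda>x. c *\<^sub>R f x)"
  by (rule scaleR_L2.abs_eq) (auto simp: L2_rel_def)

lemma norm_to_L2:
  assumes "square_integrable lebesgue f"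
  shows "norm (to_L2 f) = L2_norm lebesgue f"
  using assms inner_L2.abs_eq[of f f]
  by (simp add: norm_L2_def L2_norm_def L2_rel_def power2_norm_eq_inner)


lemma to_L2_tendsto:
  fixes f :: "'a::euclidean_space \<Rightarrow> 'b::euclidean_space"
  assumes f: "square_integrable lebesgue f" and s: "\<And>i. square_integrable lebesgue (s i)"
    and lim: "AE x in lebesgue. (\<lambda>i. s i x) \<longlonglongrightarrow> f x"
    and w: "integrable lebesgue w" and bound: "\<And>i. AE x in lebesgue. (norm (s i x - f x))\<^sup>2 \<le> w x"
  shows "(\<lambda>i. to_L2 (s i)) \<longlonglongrightarrow> to_L2 f"
proof -
  have d: "square_integrable lebesgue (\<lambda>x. s i x - f x)" for i
    using f s by (intro square_integrable_diff)
  have "(\<lambda>i. \<integral>x. (norm (s i x - f x))\<^sup>2 \<partial>lebesgue) \<longlonglongrightarrow> (\<integral>x. 0 \<partial>(lebesgue :: 'a measure))"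
  proof (rule integral_dominated_convergence[where w=w])
    show "AE x in lebesgue. (\<lambda>i. (norm (s i x - f x))\<^sup>2) \<longlonglongrightarrow> 0"
      using lim
    proof eventually_elim
      case (elim x)
      have "(\<lambda>i. (norm (s i x - f x))\<^sup>2) \<longlonglongrightarrow> (norm (f x - f x))\<^sup>2"
        by (intro tendsto_intros elim)
      then show ?case by simp
    qed
    show "AE x in lebesgue. norm ((norm (s i x - f x))\<^sup>2) \<le> w x" for i
      using bound[of i] by simp
    show "(\<lambda>x. (norm (s i x - f x))\<^sup>2) \<in> borel_measurable lebesgue" for i
      using borel_measurable_integrable[OF d[of i, unfolded square_integrable_def, THEN conjunct2]] .
  qed (use w in auto)
  then have "(\<lambda>i. sqrt (\<integral>x. (norm (s i x - f x))\<^sup>2 \<partial>lebesgue)) \<longlonglongrightarrow> sqrt 0"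
    by (intro tendsto_real_sqrt) simp
  then have "(\<lambda>i. norm (to_L2 (s i) - to_L2 f)) \<longlonglongrightarrow> 0"
    using f s d by (simp add: to_L2_diff norm_to_L2 L2_norm_def)
  then show ?thesis
    by (simp add: LIM_zero_iff tendsto_norm_zero_iff)
qed

lemma square_integrable_indicator:
  assumes "A \<in> sets lebesgue" "B \<in> sets lebesgue" "bounded B"
  shows "square_integrable lebesgue (\<lambda>x. indicator (A \<inter> B) x *\<^sub>R (e::'b::euclidean_space))"
  unfolding square_integrable_def
proof
  show "(\<lambda>x. indicator (A \<inter> B) x *\<^sub>R e) \<in> borel_measurable lebesgue"
    using assms by simp
  have "A \<inter> B \<in> lmeasurable"
    using assms by (intro bounded_set_imp_lmeasurable) (auto intro: bounded_subset)
  then have "integrable lebesgue (\<lambda>x. (norm e)\<^sup>2 * indicator (A \<inter> B) x)"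
    by (intro integrable_mult_right) (simp add: lmeasurable_iff_integrable)
  moreover have "(norm (indicator (A \<inter> B) x *\<^sub>R e))\<^sup>2 = (norm e)\<^sup>2 * indicator (A \<inter> B) x" for x
    by (auto simp: indicator_def)
  ultimately show "integrable lebesgue (\<lambda>x. (norm (indicator (A \<inter> B) x *\<^sub>R e))\<^sup>2)"
    by simp
qed

lemma closed_subspace_rational_span:
  fixes K :: "'v::real_normed_vector set"
  assumes "countable K"
  obtains S where "countable S" "subspace (closure S)" "K \<subseteq> S"
proof -
  define c where "c = (\<lambda>xs. sum_list (map (\<lambda>(q, k). q *\<^sub>R k) xs :: 'v list))"
  define S where "S = c ` lists (\<rat> \<times> K)"
  have cnt: "countable S"
    unfolding S_def using assms by (intro countable_image countable_lists countable_SIGMA countable_rat) 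
  have add: "x + y \<in> S" if xS: "x \<in> S" and yS: "y \<in> S" for x y
  proof -
    obtain xs where "x = c xs" "xs \<in> lists (\<rat> \<times> K)"
      using xS unfolding S_def by (elim imageE)
    moreover obtain ys where "y = c ys" "ys \<in> lists (\<rat> \<times> K)"
      using yS unfolding S_def by (elim imageE)
    ultimately have "x + y = c (xs @ ys)" "xs @ ys \<in> lists (\<rat> \<times> K)"
      by (auto simp: c_def)
    then show ?thesis unfolding S_def by blast
  qed
  have scale: "r *\<^sub>R x \<in> S" if xS: "x \<in> S" and "r \<in> \<rat>" for x r
  proof -
    obtain xs where xs: "x = c xs" "xs \<in> lists (\<rat> \<times> K)"
      using xS unfolding S_def by (elim imageE)
    have "r *\<^sub>R c xs = c (map (\<lambda>(q, k). (r * q, k)) xs)"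
      by (induction xs) (auto simp: c_def scaleR_add_right)
    moreover have "map (\<lambda>(q, k). (r * q, k)) xs \<in> lists (\<rat> \<times> K)"
      using xs(2) \<open>r \<in> \<rat>\<close> by (fastforce simp: lists_eq_set)
    ultimately show ?thesis using xs(1) unfolding S_def by (metis image_eqI)
  qed
  have zero: "0 \<in> S"
    unfolding S_def by (rule image_eqI[of _ _ "[]"]) (auto simp: c_def)
  have sub: "subspace (closure S)"
  proof (unfold subspace_def, intro conjI ballI allI)
    show "0 \<in> closure S" using zero closure_subset by blast
  next
    fix x y assume "x \<in> closure S" "y \<in> closure S"
    then obtain X Y where "\<And>n. X n \<in> S" "X \<longlonglongrightarrow> x" "\<And>n. Y n \<in> S" "Y \<longlonglongrightarrow> y"
      unfolding closure_sequential by blast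
    then have "\<And>n. X n + Y n \<in> S" "(\<lambda>n. X n + Y n) \<longlonglongrightarrow> x + y"
      by (auto intro: add tendsto_add)
    then show "x + y \<in> closure S"
      unfolding closure_sequential by (intro exI[of _ "\<lambda>n. X n + Y n"]) blast
  next
    fix r :: real and x assume "x \<in> closure S"
    then obtain X where X: "\<And>n. X n \<in> S" "X \<longlonglongrightarrow> x"
      unfolding closure_sequential by blast
    have "r \<in> closure \<rat>" by (simp add: Rats_closure_real)
    then obtain R where R: "\<And>n. R n \<in> \<rat>" "R \<longlonglongrightarrow> r"
      unfolding closure_sequential by blast
    have "\<And>n. R n *\<^sub>R X n \<in> S" "(\<lambda>n. R n *\<^sub>R X n) \<longlonglongrightarrow> r *\<^sub>R x"
      using X R by (auto intro: scale tendsto_scaleR)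
    then show "r *\<^sub>R x \<in> closure S"
      unfolding closure_sequential by (intro exI[of _ "\<lambda>n. R n *\<^sub>R X n"]) blast
  qed
  have "K \<subseteq> S"
  proof
    fix k assume "k \<in> K"
    then show "k \<in> S"
      unfolding S_def by (intro image_eqI[of _ _ "[(1, k)]"]) (auto simp: c_def)
  qed
  with cnt sub that show ?thesis by blast
qed

lemma second_countable_if_separable:
  fixes S :: "'v::metric_space set"
  assumes "countable S" "closure S = UNIV"
  shows "\<exists>B::'v set set. countable B \<and> open = generate_topology B"
proof -
  define B where "B = (\<lambda>(s, n). ball s (1 / Suc n)) ` (S \<times> (UNIV :: nat set))"
  have "topological_basis B"
  proof (rule topological_basisI)
    show "open b" if "b \<in> B" for b using that by (auto simp: B_def)
  next
    fix O' :: "'v set" and x assume "open O'" "x \<in> O'"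
    then obtain e where e: "e > 0" "ball x e \<subseteq> O'"
      by (meson open_contains_ball)
    obtain n where n: "1 / Suc n < e / 2"
      using e by (metis half_gt_zero nat_approx_posE)
    obtain s where s: "s \<in> S" "dist s x < 1 / Suc n"
      using assms(2) by (metis UNIV_I closure_approachable divide_pos_pos of_nat_0_less_iff zero_less_Suc zero_less_one)
    have "ball s (1 / Suc n) \<subseteq> ball x e"
    proof
      fix z assume "z \<in> ball s (1 / Suc n)"
      then have "dist s z < 1 / Suc n" by simp
      then have "dist x z < e"
        using s n dist_triangle3[of x z s] by linarith
      then show "z \<in> ball x e" by simp
    qed
    moreover have "ball s (1 / Suc n) \<in> B" "x \<in> ball s (1 / Suc n)"
      using s by (auto simp: B_def)
    ultimately show "\<exists>B'\<in>B. x \<in> B' \<and> B' \<subseteq> O'" using e by blast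
  qed
  then have "open = generate_topology B"
    by (rule topological_basis_imp_subbasis)
  moreover have "countable B"
    unfolding B_def using assms by auto
  ultimately show ?thesis by blast
qed

lemma L2_separable:
  "\<exists>S :: ('a::euclidean_space, 'b::euclidean_space) L2 set. countable S \<and> closure S = UNIV"
proof -
  obtain B :: "'a set set" where B: "countable B" "topological_basis B"
    using ex_countable_basis by blast
  define G where "G = {\<Inter>F |F. F \<subseteq> B \<and> finite F}"
  define ind :: "'a set \<Rightarrow> nat \<Rightarrow> 'b \<Rightarrow> ('a, 'b) L2" where
    "ind = (\<lambda>A n e. to_L2 (\<lambda>x. indicator (A \<inter> ball 0 (real n)) x *\<^sub>R e))"
  have cG: "countable G"
  proof -
    have "G = Inter ` {F. F \<subseteq> B \<and> finite F}" by (auto simp: G_def)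
    then show ?thesis
      using countable_Collect_finite_subset[OF B(1)] by (metis (no_types, lifting) Collect_cong countable_image)
  qed
  have openG: "open A" if "A \<in> G" for A
    using that topological_basis_open[OF B(2)] unfolding G_def by (auto intro!: open_Inter)
  have UNIVG: "UNIV \<in> G"
    unfolding G_def by (rule CollectI, rule exI[of _ "{}"]) auto
  have stable: "Int_stable G"
  proof (rule Int_stableI)
    fix a b assume "a \<in> G" "b \<in> G"
    then obtain E F where "a = \<Inter>E" "b = \<Inter>F" "E \<subseteq> B" "F \<subseteq> B" "finite E" "finite F"
      by (auto simp: G_def)
    then have "a \<inter> b = \<Inter>(E \<union> F)" "E \<union> F \<subseteq> B" "finite (E \<union> F)" by auto
    then show "a \<inter> b \<in> G" unfolding G_def by blast
  qed
  have gen: "sets borel = sigma_sets UNIV G"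
  proof -
    have "B \<subseteq> G"
    proof
      fix b assume "b \<in> B"
      then show "b \<in> G" unfolding G_def by (intro CollectI exI[of _ "{b}"]) auto
    qed
    then have "sigma_sets UNIV B \<subseteq> sigma_sets UNIV G" by (rule sigma_sets_mono')
    moreover have "sets borel = sigma_sets UNIV B"
      unfolding borel_eq_countable_basis[OF B] by (rule sets_measure_of) simp
    moreover have "sigma_sets UNIV G \<subseteq> sets (borel :: 'a measure)"
      using openG by (intro sets.sigma_sets_subset[of _ borel, simplified]) auto
    ultimately show ?thesis by blast
  qed
  define K where "K = (\<lambda>(A, n, e). ind A n e) ` (G \<times> UNIV \<times> Basis)"
  have "countable K"
    unfolding K_def using cG by (intro countable_image countable_SIGMA) (auto intro: countable_finite)
  then obtain S where S: "countable S" "subspace (closure S)" "K \<subseteq> S"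
    by (rule closed_subspace_rational_span)
  define T where "T = closure S"
  have T: "subspace T" "closed T" "K \<subseteq> T"
    using S closure_subset by (auto simp: T_def)
  have KT: "ind A n e \<in> T" if "A \<in> G" "e \<in> Basis" for A n e
  proof -
    have "ind A n e = (\<lambda>(A, n, e). ind A n e) (A, n, e)" by simp
    then have "ind A n e \<in> K" unfolding K_def using that by (intro image_eqI) auto
    then show ?thesis using T(3) by blast
  qed
  have sqi: "square_integrable lebesgue (\<lambda>x. indicator (A \<inter> ball 0 (real n)) x *\<^sub>R e)"
    if "A \<in> sets lebesgue" for A :: "'a set" and n and e :: 'b
    using that by (intro square_integrable_indicator) auto
  have Gsub: "G \<subseteq> Pow UNIV" by simp
  have borelT: "ind A n e \<in> T" if "A \<in> sets borel" "e \<in> Basis" for A n e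
    using that(1) unfolding gen
  proof (induction rule: sigma_sets_induct_disjoint[OF stable Gsub, consumes 1, case_names basic empty compl union])
    case (basic A)
    then show ?case using KT that(2) by blast
  next
    case empty
    show ?case using T(1) by (simp add: ind_def to_L2_zero subspace_0)
  next
    case (compl A)
    have A: "A \<in> sets lebesgue" using compl(1) gen by (metis sets_completionI_sets sets_lborel)
    have "(\<lambda>x. indicator ((UNIV - A) \<inter> ball 0 (real n)) x *\<^sub>R e) =
      (\<lambda>x. indicator (UNIV \<inter> ball 0 (real n)) x *\<^sub>R e - indicator (A \<inter> ball 0 (real n)) x *\<^sub>R e)"
      by (rule ext) (auto simp: indicator_def)
    then have "ind (UNIV - A) n e = ind UNIV n e - ind A n e"
      unfolding ind_def using A sqi[of UNIV n e] sqi[of A n e] by (simp add: to_L2_diff)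
    moreover have "ind UNIV n e \<in> T" using KT that(2) UNIVG by blast
    ultimately show ?case using T(1) compl(2) by (simp add: subspace_diff)
  next
    case (union A)
    have A: "A i \<in> sets lebesgue" for i
      using union(2) gen by (metis range_subsetD sets_completionI_sets sets_lborel)
    define s where "s = (\<lambda>i x. indicator ((\<Union>j<i. A j) \<inter> ball 0 (real n)) x *\<^sub>R e)"
    have sT: "to_L2 (s i) \<in> T" for i
    proof (induction i)
      case 0 then show ?case using T(1) by (simp add: s_def to_L2_zero subspace_0)
    next
      case (Suc i)
      have "A i \<inter> A j = {}" if "j < i" for j
        using disjoint_family_onD[OF union(1), of i j] that by simp
      then have "x \<notin> A i" if "x \<in> (\<Union>j<i. A j)" for x
        using that by blast
      then have "s (Suc i) = (\<lambda>x. s i x + indicator (A i \<inter> ball 0 (real n)) x *\<^sub>R e)"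
        by (intro ext) (auto simp: s_def indicator_def lessThan_Suc)
      moreover have "square_integrable lebesgue (s i)"
        unfolding s_def using A by (intro sqi) auto
      ultimately have "to_L2 (s (Suc i)) = to_L2 (s i) + ind (A i) n e"
        using sqi[OF A, of i n e] by (simp add: to_L2_add ind_def)
      then show ?case using Suc union(3) T(1) by (simp add: subspace_add)
    qed
    have "(\<lambda>i. to_L2 (s i)) \<longlonglongrightarrow> ind (\<Union>i. A i) n e"
      unfolding ind_def
    proof (rule to_L2_tendsto[where w="\<lambda>x. (norm (indicator (UNIV \<inter> ball 0 (real n)) x *\<^sub>R e))\<^sup>2"])
      show "square_integrable lebesgue (\<lambda>x. indicator (\<Union> (range A) \<inter> ball 0 (real n)) x *\<^sub>R e)"
        using A by (intro sqi) auto
      show "square_integrable lebesgue (s i)" for i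
        unfolding s_def using A by (intro sqi) auto
      show "integrable lebesgue (\<lambda>x::'a. (norm (indicator (UNIV \<inter> ball 0 (real n)) x *\<^sub>R e))\<^sup>2)"
        using sqi[of UNIV n e] by (simp add: square_integrable_def)
      show "AE x in lebesgue. (norm (s i x - indicator (\<Union> (range A) \<inter> ball 0 (real n)) x *\<^sub>R e))\<^sup>2
          \<le> (norm (indicator (UNIV \<inter> ball 0 (real n)) x *\<^sub>R e))\<^sup>2" for i
      proof (rule AE_I2)
        fix x
        show "(norm (s i x - indicator (\<Union> (range A) \<inter> ball 0 (real n)) x *\<^sub>R e))\<^sup>2
          \<le> (norm (indicator (UNIV \<inter> ball 0 (real n)) x *\<^sub>R e))\<^sup>2"
          unfolding s_def indicator_inter_arith
          by (cases "x \<in> ball 0 (real n)"; cases "x \<in> (\<Union>j<i. A j)"; cases "x \<in> \<Union> (range A)")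
            (simp_all only: indicator_simps, simp_all)
      qed
      show "AE x in lebesgue. (\<lambda>i. s i x) \<longlonglongrightarrow> indicator (\<Union> (range A) \<inter> ball 0 (real n)) x *\<^sub>R e"
      proof (rule AE_I2)
        fix x
        have "\<forall>\<^sub>F i in sequentially. s i x = indicator (\<Union> (range A) \<inter> ball 0 (real n)) x *\<^sub>R e"
        proof (cases "x \<in> \<Union> (range A)")
          case True
          then obtain j where "x \<in> A j" by blast
          then show ?thesis
            by (intro eventually_sequentiallyI[of "Suc j"]) (auto simp: s_def indicator_def)
        next
          case False
          then show ?thesis by (intro always_eventually) (auto simp: s_def indicator_def)
        qed
        then show "(\<lambda>i. s i x) \<longlonglongrightarrow> indicator (\<Union> (range A) \<inter> ball 0 (real n)) x *\<^sub>R e"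
          by (rule tendsto_eventually)
      qed
    qed
    with T(2) sT show ?case by (rule closed_sequentially)
  qed
  have lebT: "ind A n e \<in> T" if A: "A \<in> sets lebesgue" and e: "e \<in> Basis" for A n e
  proof -
    have "AE x in lborel. x \<in> main_part lborel A \<longleftrightarrow> x \<in> A"
      by (rule AE_in_main_part) (rule A)
    then have ae: "AE x in lebesgue. x \<in> main_part lborel A \<longleftrightarrow> x \<in> A"
      by (rule AE_completion)
    have m: "main_part lborel A \<in> sets lborel" using A by (rule main_part_sets)
    then have "main_part lborel A \<in> sets lebesgue" by (rule sets_completionI_sets)
    then have "ind (main_part lborel A) n e = ind A n e"
      unfolding ind_def
    proof (subst to_L2_eq_iff)
      show "AE x in lebesgue. indicator (main_part lborel A \<inter> ball 0 (real n)) x *\<^sub>R e =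
          indicator (A \<inter> ball 0 (real n)) x *\<^sub>R e"
        using ae by eventually_elim (simp add: indicator_inter_arith indicator_eq_1_iff split: split_indicator)
    qed (use A in \<open>auto intro!: sqi\<close>)
    then show ?thesis using borelT[of "main_part lborel A" e n] m e by simp
  qed
  have lebT': "ind A n v \<in> T" if A: "A \<in> sets lebesgue" for A n v
  proof -
    have ind_add: "ind A n (v + w) = ind A n v + ind A n w" for v w
      unfolding ind_def to_L2_add[OF sqi[OF A] sqi[OF A]] scaleR_add_right ..
    have ind_scale: "ind A n (c *\<^sub>R v) = c *\<^sub>R ind A n v" for c v
      unfolding ind_def to_L2_scaleR[OF sqi[OF A]] by (simp add: mult.commute)
    have "ind A n (\<Sum>e\<in>E. (v \<bullet> e) *\<^sub>R e) \<in> T" if "finite E" "E \<subseteq> Basis" for E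
      using that
    proof (induction E)
      case empty
      then show ?case using T(1) by (simp add: ind_def to_L2_zero subspace_0)
    next
      case (insert e E)
      have "ind A n (\<Sum>e\<in>insert e E. (v \<bullet> e) *\<^sub>R e) = (v \<bullet> e) *\<^sub>R ind A n e + ind A n (\<Sum>e\<in>E. (v \<bullet> e) *\<^sub>R e)"
        unfolding sum.insert[OF insert(1,2)] ind_add ind_scale ..
      moreover have "e \<in> Basis" "ind A n (\<Sum>e\<in>E. (v \<bullet> e) *\<^sub>R e) \<in> T"
        using insert by simp_all
      ultimately show ?case
        by (simp only: subspace_add[OF T(1) subspace_scale[OF T(1) lebT[OF A]]])
    qed
    from this[OF finite_Basis subset_refl] show ?thesis
      by (simp add: euclidean_representation)
  qed
  have "v \<in> T" for v
  proof -
    define f where "f = rep_L2 v"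
    have f: "square_integrable lebesgue f" unfolding f_def by (rule square_integrable_rep_L2)
    then have "f \<in> borel_measurable lebesgue" by (simp add: square_integrable_def)
    from borel_measurable_implies_sequence_metric[OF this, of 0]
    obtain F where F': "\<forall>i. simple_function lebesgue (F i)"
      "\<forall>x\<in>space lebesgue. (\<lambda>i. F i x) \<longlonglongrightarrow> f x"
      "\<forall>i. \<forall>x\<in>space lebesgue. dist (F i x) 0 \<le> 2 * dist (f x) 0"
      by (elim exE conjE)
    have F: "simple_function lebesgue (F i)" "(\<lambda>i. F i x) \<longlonglongrightarrow> f x"
      "norm (F i x) \<le> 2 * norm (f x)" for i x
      using F' by simp_all
    define s where "s = (\<lambda>i x. indicator (ball 0 (real i)) x *\<^sub>R F i x)"
    have s: "square_integrable lebesgue (s i) \<and> to_L2 (s i) \<in> T" for i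
    proof -
      have fin: "finite (range (F i))" and m: "F i -` {y} \<in> sets lebesgue" for y
        using simple_functionD(1)[OF F(1)[of i]] simple_functionD(2)[OF F(1)[of i], of "{y}"] by simp_all
      define g where "g = (\<lambda>y x. indicator ((F i -` {y}) \<inter> ball 0 (real i)) x *\<^sub>R y)"
      have g: "square_integrable lebesgue (g y)" "to_L2 (g y) \<in> T" for y
        using sqi[OF m, of y i y] lebT'[OF m, of y i y] by (simp_all only: g_def ind_def)
      have g_eq: "g y x = (if F i x = y then indicator (ball 0 (real i)) x *\<^sub>R y else 0)" for y x
        by (simp add: g_def indicator_def)
      have s_eq: "s i = (\<lambda>x. \<Sum>y\<in>range (F i). g y x)"
        unfolding g_eq using fin by (simp add: s_def)
      have "square_integrable lebesgue (\<lambda>x. \<Sum>y\<in>Y. g y x) \<and> to_L2 (\<lambda>x. \<Sum>y\<in>Y. g y x) \<in> T"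
        if "finite Y" for Y
        using that
      proof (induction Y)
        case empty
        then show ?case using T(1) by (simp add: to_L2_zero subspace_0 square_integrable_0)
      next
        case (insert y Y)
        then have sq: "square_integrable lebesgue (\<lambda>x. \<Sum>y\<in>Y. g y x)"
          and mem: "to_L2 (\<lambda>x. \<Sum>y\<in>Y. g y x) \<in> T" by simp_all
        have eq: "(\<lambda>x. \<Sum>y\<in>insert y Y. g y x) = (\<lambda>x. g y x + (\<Sum>y\<in>Y. g y x))"
          unfolding sum.insert[OF insert(1,2)] ..
        show ?case
          unfolding eq to_L2_add[OF g(1) sq, symmetric]
          by (intro conjI square_integrable_add g(1) sq subspace_add[OF T(1)] g(2) mem)
      qed
      from this[OF fin] show ?thesis unfolding s_eq .
    qed
    have "(\<lambda>i. to_L2 (s i)) \<longlonglongrightarrow> to_L2 f"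
    proof (rule to_L2_tendsto[where w="\<lambda>x. 9 * (norm (f x))\<^sup>2"])
      show "integrable lebesgue (\<lambda>x. 9 * (norm (f x))\<^sup>2)"
        using f by (simp add: square_integrable_def)
      show "AE x in lebesgue. (norm (s i x - f x))\<^sup>2 \<le> 9 * (norm (f x))\<^sup>2" for i
      proof (rule AE_I2)
        fix x
        have "norm (s i x) \<le> 2 * norm (f x)"
          using F(3)[of i x] by (simp add: s_def indicator_def)
        then have "norm (s i x - f x) \<le> 3 * norm (f x)"
          using norm_triangle_ineq4[of "s i x" "f x"] by linarith
        then have "(norm (s i x - f x))\<^sup>2 \<le> (3 * norm (f x))\<^sup>2"
          by (intro power_mono) auto
        then show "(norm (s i x - f x))\<^sup>2 \<le> 9 * (norm (f x))\<^sup>2"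
          by (simp add: power_mult_distrib)
      qed
      show "AE x in lebesgue. (\<lambda>i. s i x) \<longlonglongrightarrow> f x"
      proof (rule AE_I2)
        fix x :: 'a
        obtain k :: nat where "norm x < real k" using reals_Archimedean2 by blast
        then have "\<forall>\<^sub>F i in sequentially. F i x = s i x"
          by (intro eventually_sequentiallyI[of k]) (auto simp: s_def indicator_def)
        from tendsto_cong[OF this] F(2)[of x] show "(\<lambda>i. s i x) \<longlonglongrightarrow> f x"
          by simp
      qed
    qed (simp_all add: f s)
    moreover have "to_L2 (s i) \<in> T" for i using s by blast
    ultimately have "to_L2 f \<in> T" by (rule closed_sequentially[OF T(2), rotated])
    then show ?thesis by (simp add: f_def to_L2_rep_L2)
  qed
  then have "closure S = UNIV" unfolding T_def by blast
  with S(1) show ?thesis by blast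
qed

instance L2 :: (euclidean_space, euclidean_space) second_countable_topology
proof
  obtain S :: "('a, 'b) L2 set" where "countable S" "closure S = UNIV"
    using L2_separable by blast
  then show "\<exists>B::('a, 'b) L2 set set. countable B \<and> open = generate_topology B"
    by (rule second_countable_if_separable)
qed


lemma nn_integral_L2_norm:
  fixes f :: "'a::euclidean_space \<Rightarrow> 'b::euclidean_space"
  assumes "square_integrable lebesgue f"
  shows "(\<integral>\<^sup>+x. ennreal ((norm (f x))\<^sup>2) \<partial>lebesgue) = ennreal ((norm (to_L2 f))\<^sup>2)"
proof -
  have "(norm (to_L2 f))\<^sup>2 = (\<integral>x. (norm (f x))\<^sup>2 \<partial>lebesgue)"
    by (simp add: norm_to_L2[OF assms] L2_norm_def)
  moreover have "integrable lebesgue (\<lambda>x. (norm (f x))\<^sup>2)"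
    using assms unfolding square_integrable_def by (rule conjunct2)
  ultimately show ?thesis
    using nn_integral_eq_integral[of lebesgue "\<lambda>x. (norm (f x))\<^sup>2"] by simp
qed

lemma L2_Cauchy_convergent:
  fixes X :: "nat \<Rightarrow> ('a::euclidean_space, 'b::euclidean_space) L2"
  assumes "Cauchy X"
  shows "convergent X"
proof -
  have "\<forall>n. \<exists>N. \<forall>m\<ge>N. \<forall>k\<ge>N. dist (X m) (X k) < (1 / 2) ^ n"
    using assms unfolding Cauchy_def by simp
  then obtain N where N: "\<And>n m k. m \<ge> N n \<Longrightarrow> k \<ge> N n \<Longrightarrow> dist (X m) (X k) < (1 / 2) ^ n"
    by metis
  define r where "r n = n + (\<Sum>i\<le>n. N i)" for n
  have r: "strict_mono r" by (rule strict_monoI_Suc) (simp add: r_def)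
  have rN: "r m \<ge> N n" if "m \<ge> n" for m n
  proof -
    have "N n \<le> (\<Sum>i\<le>m. N i)" using that by (intro member_le_sum) auto
    then show ?thesis by (simp add: r_def)
  qed
  define f where "f n = rep_L2 (X (r n))" for n
  have f: "square_integrable lebesgue (f n)" and Xf: "X (r n) = to_L2 (f n)" for n
    by (simp_all add: f_def square_integrable_rep_L2 to_L2_rep_L2)
  have fm[measurable]: "f n \<in> borel_measurable lebesgue" for n
    using f[of n] unfolding square_integrable_def by (rule conjunct1)
  have fd: "(\<integral>\<^sup>+x. ennreal ((norm (f m x - f n x))\<^sup>2) \<partial>lebesgue) \<le> ennreal ((1 / 4) ^ n)" if "m \<ge> n" for m n
  proof -
    have "norm (to_L2 (\<lambda>x. f m x - f n x)) \<le> (1 / 2) ^ n"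
      using N[OF rN[OF that] rN[OF order_refl]]
      by (simp add: Xf dist_norm to_L2_diff[OF f f])
    then have "(norm (to_L2 (\<lambda>x. f m x - f n x)))\<^sup>2 \<le> ((1 / 2) ^ n)\<^sup>2"
      by (rule power_mono) simp
    also have "((1 / 2) ^ n)\<^sup>2 = (1 / 4 :: real) ^ n"
      by (simp add: power_divide power2_eq_square flip: power_mult_distrib)
    finally show ?thesis
      unfolding nn_integral_L2_norm[OF square_integrable_diff[OF f f]] by (rule ennreal_leI)
  qed
  have "AE x in lebesgue. convergent (\<lambda>n. f n x)"
  proof -
    let ?h = "\<lambda>n x. 2 ^ n * (norm (f (Suc n) x - f n x))\<^sup>2"
    have "(\<integral>\<^sup>+x. (\<Sum>n. ennreal (?h n x)) \<partial>lebesgue) = (\<Sum>n. \<integral>\<^sup>+x. ennreal (?h n x) \<partial>lebesgue)"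
      by (rule nn_integral_suminf) measurable
    also have "\<dots> \<le> (\<Sum>n. ennreal ((1 / 2) ^ n))"
    proof (rule suminf_le)
      fix n
      have "(\<integral>\<^sup>+x. ennreal (?h n x) \<partial>lebesgue) =
          ennreal (2 ^ n) * (\<integral>\<^sup>+x. ennreal ((norm (f (Suc n) x - f n x))\<^sup>2) \<partial>lebesgue)"
        by (subst nn_integral_cmult[symmetric]) (simp_all add: ennreal_mult)
      also have "\<dots> \<le> ennreal (2 ^ n) * ennreal ((1 / 4) ^ n)"
        by (intro mult_left_mono fd) simp_all
      also have "\<dots> = ennreal ((1 / 2) ^ n)"
        by (simp add: power_divide flip: ennreal_mult) (simp add: field_simps flip: power_mult_distrib)
      finally show "(\<integral>\<^sup>+x. ennreal (?h n x) \<partial>lebesgue) \<le> ennreal ((1 / 2) ^ n)" .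
    qed simp_all
    also have "\<dots> < \<infinity>"
      by (simp add: suminf_ennreal2 summable_geometric)
    finally have "(\<integral>\<^sup>+x. (\<Sum>n. ennreal (?h n x)) \<partial>lebesgue) \<noteq> \<infinity>" by simp
    then have "AE x in lebesgue. (\<Sum>n. ennreal (?h n x)) \<noteq> \<infinity>"
      by (intro nn_integral_PInf_AE) measurable
    then show ?thesis
    proof eventually_elim
      case (elim x)
      then have "summable (\<lambda>n. ?h n x)"
        by (intro summable_suminf_not_top) auto
      then have sum: "summable (\<lambda>n. ?h n x + (1 / 2) ^ n)"
        by (intro summable_add summable_geometric) simp_all
      have "summable (\<lambda>n. f (Suc n) x - f n x)"
      proof (rule summable_comparison_test'[OF sum, of 0])
        fix n :: nat
        let ?t = "norm (f (Suc n) x - f n x)"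
        have "?t * 2 \<le> 2 ^ n * ?t\<^sup>2 + (1 / 2) ^ n"
        proof -
          have "0 \<le> 2 ^ n * (?t - (1 / 2) ^ n)\<^sup>2" by simp
          also have "\<dots> = 2 ^ n * ?t\<^sup>2 - 2 * ?t * (2 ^ n * (1 / 2) ^ n) + (2 ^ n * (1 / 2) ^ n) * (1 / 2) ^ n"
            by (simp only: power2_diff power2_eq_square) (simp only: algebra_simps)
          also have "(2::real) ^ n * (1 / 2) ^ n = 1"
            by (simp flip: power_mult_distrib)
          finally show ?thesis by simp
        qed
        then show "norm (f (Suc n) x - f n x) \<le> 2 ^ n * ?t\<^sup>2 + (1 / 2) ^ n"
          using norm_ge_zero[of "f (Suc n) x - f n x"] by linarith
      qed
      then have "convergent (\<lambda>n. \<Sum>i<n. f (Suc i) x - f i x)"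
        by (simp add: summable_iff_convergent)
      then have "convergent (\<lambda>n. f n x - f 0 x)"
        by (simp only: sum_lessThan_telescope[where f="\<lambda>n. f n x"])
      then show ?case
        using convergent_add[OF _ convergent_const[of "f 0 x"], of "\<lambda>n. f n x - f 0 x"] by simp
    qed
  qed
  define g where "g x = lim (\<lambda>n. f n x)" for x
  have gm[measurable]: "g \<in> borel_measurable lebesgue"
    unfolding g_def by (rule borel_measurable_lim_metric) measurable
  have lim: "AE x in lebesgue. (\<lambda>n. f n x) \<longlonglongrightarrow> g x"
    using \<open>AE x in lebesgue. convergent (\<lambda>n. f n x)\<close>
    by eventually_elim (simp add: g_def convergent_LIMSEQ_iff)
  have gf: "(\<integral>\<^sup>+x. ennreal ((norm (g x - f n x))\<^sup>2) \<partial>lebesgue) \<le> ennreal ((1 / 4) ^ n)" for n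
  proof -
    have "(\<integral>\<^sup>+x. ennreal ((norm (g x - f n x))\<^sup>2) \<partial>lebesgue) =
        (\<integral>\<^sup>+x. liminf (\<lambda>m. ennreal ((norm (f m x - f n x))\<^sup>2)) \<partial>lebesgue)"
    proof (rule nn_integral_cong_AE, use lim in eventually_elim)
      case (elim x)
      then have "(\<lambda>m. ennreal ((norm (f m x - f n x))\<^sup>2)) \<longlonglongrightarrow> ennreal ((norm (g x - f n x))\<^sup>2)"
        by (intro tendsto_ennrealI tendsto_intros)
      then show ?case
        by (rule lim_imp_Liminf[OF sequentially_bot, symmetric])
    qed
    also have "\<dots> \<le> liminf (\<lambda>m. \<integral>\<^sup>+x. ennreal ((norm (f m x - f n x))\<^sup>2) \<partial>lebesgue)"
      by (rule nn_integral_liminf) measurable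
    also have "\<dots> \<le> ennreal ((1 / 4) ^ n)"
    proof (rule order_trans[OF Liminf_le_Limsup Limsup_bounded])
      show "\<forall>\<^sub>F m in sequentially. (\<integral>\<^sup>+x. ennreal ((norm (f m x - f n x))\<^sup>2) \<partial>lebesgue) \<le> ennreal ((1 / 4) ^ n)"
        using fd by (intro eventually_sequentiallyI)
    qed simp
    finally show ?thesis .
  qed
  have gfs: "square_integrable lebesgue (\<lambda>x. g x - f n x)" for n
    unfolding square_integrable_def
  proof
    show "(\<lambda>x. g x - f n x) \<in> borel_measurable lebesgue" by measurable
    show "integrable lebesgue (\<lambda>x. (norm (g x - f n x))\<^sup>2)"
    proof (rule integrableI_bounded)
      show "(\<lambda>x. (norm (g x - f n x))\<^sup>2) \<in> borel_measurable lebesgue" by measurable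
      show "(\<integral>\<^sup>+x. ennreal (norm ((norm (g x - f n x))\<^sup>2)) \<partial>lebesgue) < \<infinity>"
        using gf[of n] by (simp add: order_le_less_trans)
    qed
  qed
  have gs: "square_integrable lebesgue g"
    using square_integrable_add[OF gfs[of 0] f[of 0]] by simp
  have "norm (to_L2 g - X (r n)) \<le> (1 / 2) ^ n" for n
  proof -
    have "(norm (to_L2 (\<lambda>x. g x - f n x)))\<^sup>2 \<le> (1 / 4) ^ n"
      using gf[of n] unfolding nn_integral_L2_norm[OF gfs] by simp
    also have "(1 / 4 :: real) ^ n = ((1 / 2) ^ n)\<^sup>2"
      by (simp add: power_divide power2_eq_square flip: power_mult_distrib)
    finally show ?thesis
      unfolding Xf to_L2_diff[OF gs f] by (rule power2_le_imp_le) simp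
  qed
  then have "(X \<circ> r) \<longlonglongrightarrow> to_L2 g"
    unfolding LIM_zero_iff[symmetric, of _ "to_L2 g"] o_def
    by (intro Lim_null_comparison[OF _ LIMSEQ_power_zero[of "1 / 2 :: real"]] always_eventually allI)
      (simp_all add: norm_minus_commute)
  then have "X \<longlonglongrightarrow> to_L2 g"
    using Cauchy_converges_subseq[OF assms r] by (simp add: o_def)
  then show ?thesis by (rule convergentI)
qed

instance L2 :: (euclidean_space, euclidean_space) banach
  by standard (rule L2_Cauchy_convergent)

primrec Ck :: "nat \<Rightarrow> ('a::euclidean_space \<Rightarrow> real) \<Rightarrow> bool" where
  "Ck 0 \<phi> \<longleftrightarrow> continuous_on UNIV \<phi>"
| "Ck (Suc m) \<phi> \<longleftrightarrow> (\<forall>x. \<phi> differentiable at x) \<and>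
     (\<forall>e\<in>Basis. Ck m (\<lambda>x. frechet_derivative \<phi> (at x) e))"

definition test_functions :: "'a::euclidean_space set \<Rightarrow> ('a \<Rightarrow> real) set" where
  "test_functions D = {\<phi>. (\<forall>m. Ck m \<phi>) \<and>
     compact (closure {x. \<phi> x \<noteq> 0}) \<and> closure {x. \<phi> x \<noteq> 0} \<subseteq> D}"

definition gradient :: "('a::euclidean_space \<Rightarrow> real) \<Rightarrow> 'a \<Rightarrow> 'a" where
  "gradient \<phi> x = (\<Sum>e\<in>Basis. frechet_derivative \<phi> (at x) e *\<^sub>R e)"

text \<open>
  A function \<open>v\<close> in \<open>H\<^sup>1\<close> is represented by the pair of \<open>v\<close> and its weak gradient.  The norm of the
  product type is then the norm of \<open>H\<^sup>1\<close>, the square root of \<open>\<parallel>v\<parallel>\<^sup>2 + \<parallel>\<nabla>v\<parallel>\<^sup>2\<close> (norms in \<open>L\<^sup>2\<close>).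
\<close>

type_synonym 'a H1_pair = "('a, real) L2 \<times> ('a, 'a) L2"

text \<open>
  The closure of the smooth functions with compact support in \<open>D\<close>, in the norm of \<open>H\<^sup>1\<close>.  Functions
  on \<open>D\<close> are extended by zero to the whole space.  The graph of the weak gradient is closed in
  \<open>L\<^sup>2 \<times> L\<^sup>2\<close>, so the second component of a limit is the weak gradient of the first one.
\<close>

definition H1_0 :: "'a::euclidean_space set \<Rightarrow> 'a H1_pair set" where
  "H1_0 D = closure ((\<lambda>\<phi>. (to_L2 \<phi>, to_L2 (gradient \<phi>))) ` test_functions D)"

definition weak_solution ::
  "'a::euclidean_space set \<Rightarrow> ('a \<Rightarrow> real) \<Rightarrow> ('a \<Rightarrow> real) \<Rightarrow> 'a H1_pair \<Rightarrow> bool" where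
  "weak_solution D a f u \<longleftrightarrow> u \<in> H1_0 D \<and>
     (\<forall>v\<in>H1_0 D. (\<integral>x. a x * (rep_L2 (snd u) x \<bullet> rep_L2 (snd v) x) \<partial>lebesgue_on D) =
                 (\<integral>x. f x * rep_L2 (fst v) x \<partial>lebesgue_on D))"

text \<open>
  Near each boundary point, \<open>D\<close> is the part lying strictly above the graph of a Lipschitz function
  \<open>g\<close>, where the vertical direction is the unit vector \<open>e\<close> and \<open>g\<close> is a function on the hyperplane
  orthogonal to \<open>e\<close>.
\<close>

definition bounded_Lipschitz_domain :: "'a::euclidean_space set \<Rightarrow> bool" where
  "bounded_Lipschitz_domain D \<longleftrightarrow> open D \<and> connected D \<and> D \<noteq> {} \<and> bounded D \<and>
     (\<forall>p\<in>frontier D. \<exists>e r L (g :: 'a \<Rightarrow> real).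
        norm e = 1 \<and> r > 0 \<and> L-lipschitz_on {z. z \<bullet> e = 0} g \<and>
        D \<inter> ball p r = {x \<in> ball p r. g (x - (x \<bullet> e) *\<^sub>R e) < x \<bullet> e})"

definition essentially_bounded :: "'x measure \<Rightarrow> ('x \<Rightarrow> real) \<Rightarrow> bool" where
  "essentially_bounded M f \<longleftrightarrow> f \<in> borel_measurable M \<and> (\<exists>B. AE x in M. \<bar>f x\<bar> \<le> B)"

definition affine_coefficient ::
  "('a \<Rightarrow> real) \<Rightarrow> (nat \<Rightarrow> 'a \<Rightarrow> real) \<Rightarrow> (nat \<Rightarrow> real) \<Rightarrow> 'a \<Rightarrow> real" where
  "affine_coefficient abar \<psi> y x = abar x + (\<Sum>j. y j * \<psi> j x)"

text \<open>
  The indices \<open>j \<ge> 1\<close> of the coordinates are shifted to start from \<open>0\<close>.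
\<close>

definition param_domain :: "(nat \<Rightarrow> real) set" where
  "param_domain = {y. \<forall>j. y j \<in> {-1..1}}"

definition param_measure :: "(nat \<Rightarrow> real) measure" where
  "param_measure = Pi\<^sub>M UNIV (\<lambda>_. scale_measure (1/2) (restrict_space lborel {-1..1}))"

lemma space_param_measure: "space param_measure = param_domain"
  by (auto simp: param_measure_def param_domain_def space_PiM space_scale_measure space_restrict_space PiE_def)

lemma prob_space_param_measure: "prob_space param_measure"
proof -
  have "prob_space (scale_measure (1/2) (restrict_space lborel {-1..1::real}))"
  proof
    have "emeasure (restrict_space lborel {-1..1::real}) {-1..1} = 2"
      by (subst emeasure_restrict_space) simp_all
    then show "emeasure (scale_measure (1/2) (restrict_space lborel {-1..1::real}))
        (space (scale_measure (1/2) (restrict_space lborel {-1..1::real}))) = 1"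
      by (simp add: space_scale_measure space_restrict_space ennreal_divide_times)
  qed
  then show ?thesis
    unfolding param_measure_def by (intro prob_space_PiM)
qed

text \<open>
  The supremum over all parameters, as opposed to an essential supremum.
\<close>

definition param_sup_norm :: "((nat \<Rightarrow> real) \<Rightarrow> 'v::real_normed_vector) \<Rightarrow> ereal" where
  "param_sup_norm F = (SUP y\<in>param_domain. ereal (norm (F y)))"

text \<open>
  Rodrigues' formula for the Legendre polynomial \<open>P\<^sub>k\<close> with \<open>P\<^sub>k(1) = 1\<close>.  The mean of its square over
  \<open>[-1, 1]\<close> is \<open>1 / (2 k + 1)\<close>, which gives the normalising factor of \<open>legendre\<close>.
\<close>

definition legendre_poly :: "nat \<Rightarrow> real poly" where
  "legendre_poly k = smult (1 / (2 ^ k * fact k)) ((pderiv ^^ k) ([:-1, 0, 1:] ^ k))"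

definition legendre :: "nat \<Rightarrow> real \<Rightarrow> real" where
  "legendre k t = sqrt (2 * real k + 1) * poly (legendre_poly k) t"

text \<open>
  All factors outside the support of a multi-index are equal to \<open>1\<close> in the three products below.
  On functions, \<open>\<le>\<close> is the componentwise order.
\<close>

definition multi_indices :: "(nat \<Rightarrow> nat) set" where
  "multi_indices = {\<nu>. finite {j. \<nu> j \<noteq> 0}}"

definition legendre_multi :: "(nat \<Rightarrow> nat) \<Rightarrow> (nat \<Rightarrow> real) \<Rightarrow> real" where
  "legendre_multi \<nu> y = (\<Prod>j | \<nu> j \<noteq> 0. legendre (\<nu> j) (y j))"

definition multi_power :: "(nat \<Rightarrow> real) \<Rightarrow> (nat \<Rightarrow> nat) \<Rightarrow> real" where
  "multi_power b \<nu> = (\<Prod>j | \<nu> j \<noteq> 0. b j ^ \<nu> j)"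

definition beta_weight :: "(nat \<Rightarrow> nat) \<Rightarrow> real" where
  "beta_weight \<nu> = (\<Prod>j | \<nu> j \<noteq> 0. sqrt (1 + 2 * real (\<nu> j)))"

definition downward_closed :: "(nat \<Rightarrow> nat) set \<Rightarrow> bool" where
  "downward_closed \<Lambda> \<longleftrightarrow> \<Lambda> \<subseteq> multi_indices \<and>
     (\<forall>\<nu>\<in>\<Lambda>. \<forall>\<nu>'\<in>multi_indices. \<nu>' \<le> \<nu> \<longrightarrow> \<nu>' \<in> \<Lambda>)"

text \<open>
  For sequences that tend to zero along the multi-indices, the supremum is a maximum.
\<close>

definition monotone_majorant :: "((nat \<Rightarrow> nat) \<Rightarrow> real) \<Rightarrow> (nat \<Rightarrow> nat) \<Rightarrow> real" where
  "monotone_majorant \<kappa> \<nu> = (SUP \<nu>'\<in>{\<nu>'\<in>multi_indices. \<nu> \<le> \<nu>'}. \<bar>\<kappa> \<nu>'\<bar>)"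

definition n_largest :: "((nat \<Rightarrow> nat) \<Rightarrow> real) \<Rightarrow> nat \<Rightarrow> (nat \<Rightarrow> nat) set \<Rightarrow> bool" where
  "n_largest c n \<Lambda> \<longleftrightarrow> \<Lambda> \<subseteq> multi_indices \<and> finite \<Lambda> \<and> card \<Lambda> = n \<and>
     (\<forall>\<nu>\<in>\<Lambda>. \<forall>\<mu>\<in>multi_indices - \<Lambda>. c \<mu> \<le> c \<nu>)"

text \<open>
  The Bochner integral of a function with values in the closed subspace \<open>H1_0 D\<close> of the ambient
  Hilbert space; it lies again in \<open>H1_0 D\<close>.
\<close>

definition legendre_coeff :: "((nat \<Rightarrow> real) \<Rightarrow> 'a::euclidean_space H1_pair) \<Rightarrow> (nat \<Rightarrow> nat) \<Rightarrow> 'a H1_pair" where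
  "legendre_coeff u \<nu> = (\<integral>y. legendre_multi \<nu> y *\<^sub>R u y \<partial>param_measure)"

definition truncated_legendre ::
  "((nat \<Rightarrow> real) \<Rightarrow> 'a::euclidean_space H1_pair) \<Rightarrow> (nat \<Rightarrow> nat) set \<Rightarrow> (nat \<Rightarrow> real) \<Rightarrow> 'a H1_pair" where
  "truncated_legendre u \<Lambda> y = (\<Sum>\<nu>\<in>\<Lambda>. legendre_multi \<nu> y *\<^sub>R legendre_coeff u \<nu>)"

end

theory Submission
  imports Defs
begin

text \<open>
  The heart of the proof is that the Legendre coefficients \<open>w\<^sub>\<nu>\<close> of the solution satisfy
  \<open>\<Sum>\<^sub>\<nu> (\<rho>\<^sup>\<nu> \<parallel>w\<^sub>\<nu>\<parallel>)\<^sup>2 < \<infinity>\<close> (\<open>weighted_sum_fourier_legendre_le\<close>).  It is obtained from the equations for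
  the coefficients, without derivatives of the solution with respect to the parameters.  Taking the
  mean of the weak formulation against \<open>L\<^sub>\<nu>\<close> and using the three-term recurrence
  \<open>t L\<^sub>n = j\<^bsub>n+1\<^esub> L\<^bsub>n+1\<^esub> + j\<^sub>n L\<^bsub>n-1\<^esub>\<close> gives
  \<open>- div (a \<nabla>w\<^sub>\<nu>) - \<Sum>\<^sub>j div (\<psi>\<^sub>j (j\<^bsub>\<nu>\<^sub>j+1\<^esub> \<nabla>w\<^bsub>\<nu>+e\<^sub>j\<^esub> + j\<^bsub>\<nu>\<^sub>j\<^esub> \<nabla>w\<^bsub>\<nu>-e\<^sub>j\<^esub>)) = \<delta>\<^bsub>\<nu>,0\<^esub> f\<close>, where \<open>a\<close> is the mean
  coefficient (\<open>w_trunc_equation\<close>).  This system is tested with \<open>\<rho>\<^bsup>2\<nu>\<^esup> w\<^sub>\<nu>\<close>.  In the variables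
  \<open>\<rho>\<^sup>\<nu> w\<^sub>\<nu>\<close>, the coupling in direction \<open>j\<close> is a Jacobi matrix whose entries are multiplied by
  \<open>(\<rho>\<^sub>j + 1/\<rho>\<^sub>j) / 2 \<le> \<rho>\<^sub>j\<close> after symmetrisation.  The Jacobi matrix itself has norm at most \<open>1\<close>; the Schur
  test with the vector \<open>L\<^sub>n(1) = sqrt (2 n + 1)\<close> shows this
  (\<open>jacobi_edge_bound\<close>, \<open>jacobi_segment_bound\<close>).  So the coupling is bounded by the sum of the
  \<open>\<rho>\<^sub>j \<bar>\<psi>\<^sub>j\<bar> \<le> a - r\<close>, and the energy \<open>r \<Sum>\<^sub>\<nu> \<rho>\<^bsup>2\<nu>\<^esup> \<parallel>\<nabla>w\<^sub>\<nu>\<parallel>\<^sup>2\<close> remains on the left (\<open>weighted_energy\<close>).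
  The \<open>H\<^sup>1\<close> norm is then controlled by the inequality of Poincare.  To make all sums finite, the
  weights are cut off, the indices are confined to boxes, and only finitely many parameters are
  active; Bessel's inequality and the Lipschitz dependence of the solution on the parameters
  (\<open>solution_lipschitz\<close>) remove these restrictions.

  The rest is best \<open>n\<close>-term approximation.  The solution is continuous on the compact parameter
  domain, so Legendre sums approximate it uniformly, by the theorem of Stone and Weierstrass.
  Hence the mean square error is the square sum of the discarded coefficients
  (\<open>legendre_truncation_mean_square\<close>), and the uniform error is at most the sum of the discarded
  \<open>\<parallel>w\<^sub>\<nu>\<parallel> \<beta>(\<nu>)\<close> because \<open>\<bar>L\<^sub>\<nu>\<bar> \<le> \<beta>(\<nu>)\<close> (\<open>legendre_truncation_uniform\<close>).  With \<open>b = 1/\<rho>\<close>, the discarded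
  weights \<open>b\<^sup>\<nu>\<close> and \<open>b\<^sup>\<nu> \<beta>(\<nu>)\<close> are bounded by the monotone majorants of the sequences \<open>\<kappa>\<close>.  These
  belong to \<open>\<ell>\<^sup>q\<close> (\<open>monotone_majorant_summable\<close>), and Stechkin's inequality gives the rates
  (\<open>n_largest_tail_max\<close>, \<open>n_largest_tail_square_sum\<close>).
\<close>

section \<open>Legendre polynomials\<close>

lemma real_poly_ext:
  fixes p q :: "real poly"
  assumes "\<And>t. poly p t = poly q t"
  shows "p = q"
  using assms poly_eq_poly_eq_iff[of p q] by (simp add: fun_eq_iff)

lemma higher_pderiv_diff: "(pderiv ^^ n) (p - q) = (pderiv ^^ n) p - (pderiv ^^ n) q"
  for p q :: "real poly"
  by (induction n) (simp_all add: pderiv_diff)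

lemma higher_pderiv_X_mult:
  "(pderiv ^^ n) ([:0, 1:] * p) = [:0, 1:] * (pderiv ^^ n) p + smult (real n) ((pderiv ^^ (n - 1)) p)"
  for p :: "real poly"
proof (induction n)
  case (Suc n)
  show ?case
    unfolding funpow.simps comp_apply Suc
    by (rule real_poly_ext, cases n)
      (simp_all add: pderiv_add pderiv_mult pderiv_smult pderiv_pCons algebra_simps)
qed simp

text \<open>
  Differentiating one factor \<open>t\<^sup>2 - 1\<close> in Rodrigues' formula, or splitting it off by the Leibniz
  rule, expresses \<open>P\<^bsub>n+1\<^esub>\<close> in two ways through \<open>P\<^sub>n\<close>, its derivative and the same lower order term.
  Eliminating the latter gives the two identities from which all properties below follow.
\<close>

lemma legendre_poly_Suc_aux:
  fixes n :: nat
  defines "R \<equiv> smult (real n / (2 ^ n * fact n)) ((pderiv ^^ (n - 1)) ([:-1, 0, 1:] ^ n))"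
  shows "legendre_poly (Suc n) = [:0, 1:] * legendre_poly n + R"
    and "legendre_poly (Suc n) =
      smult (1 / (2 * real (Suc n))) ([:-1, 0, 1:] * pderiv (legendre_poly n)) +
      [:0, 1:] * legendre_poly n + smult (1 / 2) R"
    and "pderiv R = smult (real n) (legendre_poly n)"
proof -
  define W where "W = [:-1, 0, 1 :: real:]"
  define X where "X = [:0, 1 :: real:]"
  define N :: real where "N = 2 ^ n * fact n"
  have N: "N \<noteq> 0" "2 ^ Suc n * fact (Suc n) = 2 * real (Suc n) * N"
    by (simp_all add: N_def algebra_simps)
  have "pderiv (W ^ Suc n) = smult (2 * real (Suc n)) (X * W ^ n)"
    unfolding pderiv_power_Suc by (simp add: W_def X_def pderiv_pCons smult_add_left algebra_simps)
  then have D: "(pderiv ^^ Suc n) (W ^ Suc n) =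
      smult (2 * real (Suc n)) (X * (pderiv ^^ n) (W ^ n) + smult (real n) ((pderiv ^^ (n - 1)) (W ^ n)))"
    unfolding funpow_Suc_right comp_apply
    by (simp only: higher_pderiv_smult higher_pderiv_X_mult X_def)
  show "legendre_poly (Suc n) = X * legendre_poly n + R"
    unfolding legendre_poly_def W_def[symmetric] D N(2) R_def
    using N(1) by (simp add: smult_add_right N_def)
  have W_mult: "W * p = X * (X * p) - p" for p
    by (simp add: W_def X_def algebra_simps)
  have D2: "(pderiv ^^ Suc n) (W ^ Suc n) = W * (pderiv ^^ Suc n) (W ^ n)
      + smult (2 * real (Suc n)) (X * (pderiv ^^ n) (W ^ n))
      + smult (real (Suc n) * real n) ((pderiv ^^ (n - 1)) (W ^ n))"
    unfolding power_Suc W_mult[of "W ^ n"] higher_pderiv_diff higher_pderiv_X_mult[folded X_def] W_mult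
    by (rule real_poly_ext) (simp add: algebra_simps)
  show "legendre_poly (Suc n) =
      smult (1 / (2 * real (Suc n))) (W * pderiv (legendre_poly n)) + X * legendre_poly n + smult (1 / 2) R"
    unfolding legendre_poly_def W_def[symmetric] D2 N(2) R_def
    unfolding N_def[symmetric] using N(1)
    by (intro real_poly_ext) (simp add: pderiv_smult divide_simps; simp add: algebra_simps)
  show "pderiv R = smult (real n) (legendre_poly n)"
    unfolding R_def legendre_poly_def by (cases n) (simp_all add: pderiv_smult)
qed

lemma pderiv_legendre_poly_Suc:
  "pderiv (legendre_poly (Suc n)) = [:0, 1:] * pderiv (legendre_poly n) + smult (real (Suc n)) (legendre_poly n)"
  unfolding legendre_poly_Suc_aux(1) pderiv_add legendre_poly_Suc_aux(3)
  by (simp add: pderiv_mult pderiv_pCons smult_add_left)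

lemma legendre_poly_pderiv:
  "[:-1, 0, 1:] * pderiv (legendre_poly n) =
    smult (real (Suc n)) (legendre_poly (Suc n) - [:0, 1:] * legendre_poly n)"
proof (rule real_poly_ext)
  fix t
  let ?P = "legendre_poly (Suc n)" and ?Q = "[:0, 1:] * legendre_poly n"
  have "?P = smult (1 / (2 * real (Suc n))) ([:-1, 0, 1:] * pderiv (legendre_poly n)) + ?Q + smult (1 / 2) (?P - ?Q)"
    using legendre_poly_Suc_aux(1,2)[of n] by simp
  from arg_cong[OF this, of "\<lambda>p. poly p t"]
  have "poly ?P t = poly ([:-1, 0, 1:] * pderiv (legendre_poly n)) t / (2 * real (Suc n))
      + poly ?Q t + (poly ?P t - poly ?Q t) / 2"
    by simp
  then show "poly ([:-1, 0, 1:] * pderiv (legendre_poly n)) t = poly (smult (real (Suc n)) (?P - ?Q)) t"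
    unfolding poly_smult poly_diff by (simp add: field_simps del: of_nat_Suc)
qed

lemma legendre_poly_0: "legendre_poly 0 = 1"
  by (simp add: legendre_poly_def)

lemma poly_legendre_poly_1: "poly (legendre_poly n) 1 = 1"
proof (induction n)
  case (Suc n)
  then show ?case
    using arg_cong[OF legendre_poly_pderiv[of n], of "\<lambda>p. poly p 1"] by simp
qed (simp add: legendre_poly_0)

lemma poly_legendre_poly_minus_1: "poly (legendre_poly n) (-1) = (-1) ^ n"
proof (induction n)
  case (Suc n)
  then show ?case
    using arg_cong[OF legendre_poly_pderiv[of n], of "\<lambda>p. poly p (-1)"] by simp
qed (simp add: legendre_poly_0)

lemma legendre_poly_ode:
  "pderiv ([:-1, 0, 1:] * pderiv (legendre_poly n)) = smult (real n * real (Suc n)) (legendre_poly n)"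
proof -
  have "pderiv ([:-1, 0, 1:] * pderiv (legendre_poly n)) = smult (real (Suc n)) (smult (real n) (legendre_poly n))"
    unfolding legendre_poly_pderiv pderiv_smult pderiv_diff pderiv_legendre_poly_Suc
    by (intro real_poly_ext) (simp add: pderiv_mult pderiv_pCons algebra_simps)
  then show ?thesis by (simp add: mult.commute)
qed

lemma legendre_poly_recurrence:
  "(real n + 1) * poly (legendre_poly (Suc n)) t =
    (2 * real n + 1) * t * poly (legendre_poly n) t - real n * poly (legendre_poly (n - 1)) t"
proof -
  define p where "p k = poly (legendre_poly k) t" for k
  define d where "d k = poly (pderiv (legendre_poly k)) t" for k
  have B: "(t\<^sup>2 - 1) * d k = (real k + 1) * (p (Suc k) - t * p k)" for k
    using arg_cong[OF legendre_poly_pderiv[of k], of "\<lambda>p. poly p t"]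
    by (simp add: p_def d_def power2_eq_square algebra_simps)
  have "(real n + 1) * p (Suc n) = (2 * real n + 1) * t * p n - real n * p (n - 1)"
  proof (cases n)
    case 0
    then show ?thesis using B[of 0] by (simp add: p_def d_def legendre_poly_0)
  next
    case (Suc m)
    have A: "d n = t * d m + (real m + 1) * p m"
      using arg_cong[OF pderiv_legendre_poly_Suc[of m], of "\<lambda>p. poly p t"]
      by (simp add: p_def d_def Suc)
    have "(real n + 1) * p (Suc n) = (real n + 1) * t * p n + (t\<^sup>2 - 1) * d n"
      using B[of n] by (simp add: algebra_simps)
    also have "(t\<^sup>2 - 1) * d n = t * ((t\<^sup>2 - 1) * d m) + (t\<^sup>2 - 1) * (real m + 1) * p m"
      by (simp add: A algebra_simps)
    also have "(t\<^sup>2 - 1) * d m = (real m + 1) * (p n - t * p m)"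
      unfolding Suc by (rule B)
    finally show ?thesis
      by (simp add: Suc power2_eq_square algebra_simps)
  qed
  then show ?thesis by (simp add: p_def)
qed

text \<open>
  By the differential equation, \<open>P\<^sub>n\<^sup>2 + (1 - t\<^sup>2) (P\<^sub>n')\<^sup>2 / (n (n + 1))\<close> has the derivative
  \<open>2 t (P\<^sub>n')\<^sup>2 / (n (n + 1))\<close>.  It thus increases away from \<open>0\<close>, and it equals \<open>1\<close> at both end points.
\<close>

lemma abs_legendre_poly_le_1:
  assumes "\<bar>t\<bar> \<le> 1"
  shows "\<bar>poly (legendre_poly n) t\<bar> \<le> 1"
proof (cases "n = 0")
  case False
  define c where "c = real n * real (Suc n)"
  have c: "c > 0" using False by (simp add: c_def)
  define P where "P = legendre_poly n"
  \<comment> \<open>The factor \<open>t\<^sup>2 - 1\<close> makes the derivative term vanish at \<open>\<plusminus>1\<close>, where \<open>P\<^sup>2 = 1\<close>.\<close>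
  define g where "g = P\<^sup>2 - smult (1 / c) ([:-1, 0, 1:] * (pderiv P)\<^sup>2)"
  have g': "poly (pderiv g) s = 2 * s * (poly (pderiv P) s)\<^sup>2 / c" for s
  proof -
    have "(s\<^sup>2 - 1) * poly (pderiv (pderiv P)) s + 2 * s * poly (pderiv P) s = c * poly P s"
      using arg_cong[OF legendre_poly_ode[of n], of "\<lambda>p. poly p s"]
      by (simp add: P_def c_def pderiv_mult pderiv_pCons pderiv_diff power2_eq_square algebra_simps)
    then have *: "(s\<^sup>2 - 1) * poly (pderiv (pderiv P)) s = c * poly P s - 2 * s * poly (pderiv P) s"
      by simp
    have "poly (pderiv g) s = 2 * poly P s * poly (pderiv P) s
        - (2 * s * (poly (pderiv P) s)\<^sup>2 + 2 * poly (pderiv P) s * ((s\<^sup>2 - 1) * poly (pderiv (pderiv P)) s)) / c"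
      by (simp add: g_def pderiv_diff pderiv_smult pderiv_mult pderiv_pCons power2_eq_square algebra_simps
          diff_divide_distrib add_divide_distrib)
    then show ?thesis
      unfolding * using c by (simp add: field_simps power2_eq_square)
  qed
  have "poly g t \<le> 1"
  proof (cases "t \<ge> 0")
    case True
    have "poly g t \<le> poly g 1"
      by (rule DERIV_nonneg_imp_nondecreasing[of t 1]) (use assms True c g' in \<open>auto intro!: exI poly_DERIV\<close>)
    then show ?thesis by (simp add: g_def P_def poly_legendre_poly_1)
  next
    case False
    have "poly g t \<le> poly g (-1)"
      by (rule DERIV_nonpos_imp_nonincreasing[of "-1" t])
        (use assms False c g' in \<open>auto intro!: exI poly_DERIV simp: divide_nonpos_pos mult_nonpos_nonneg\<close>)
    then show ?thesis by (simp add: g_def P_def poly_legendre_poly_minus_1 flip: power_mult)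
  qed
  moreover have "poly g t = (poly P t)\<^sup>2 + (1 - t\<^sup>2) * (poly (pderiv P) t)\<^sup>2 / c"
    by (simp add: g_def power2_eq_square algebra_simps diff_divide_distrib)
  moreover have "0 \<le> (1 - t\<^sup>2) * (poly (pderiv P) t)\<^sup>2 / c"
    using c assms by (simp add: abs_square_le_1)
  ultimately have "(poly P t)\<^sup>2 \<le> 1" by linarith
  then show ?thesis by (simp add: abs_square_le_1 P_def)
qed (simp add: legendre_poly_0)

text \<open>
  The off-diagonal entries of the Jacobi matrix of the normalised Legendre polynomials.
\<close>

definition jacobi :: "nat \<Rightarrow> real" where
  "jacobi n = real n / (sqrt (2 * real n - 1) * sqrt (2 * real n + 1))"

lemma jacobi_0 [simp]: "jacobi 0 = 0"
  by (simp add: jacobi_def)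

lemma jacobi_nonneg: "0 \<le> jacobi n"
  by (cases "n = 0") (simp_all add: jacobi_def)

lemma legendre_recurrence:
  "t * legendre n t = jacobi (Suc n) * legendre (Suc n) t + jacobi n * legendre (n - 1) t"
proof -
  define s1 s3 where "s1 = sqrt (2 * real n + 1)" and "s3 = sqrt (2 * real n + 3)"
  define p where "p i = poly (legendre_poly i) t" for i
  have s: "s1 \<noteq> 0" "s3 \<noteq> 0" "s1 * s1 = 2 * real n + 1"
    by (simp_all add: s1_def s3_def add_nonneg_eq_0_iff)
  have L: "legendre n t = s1 * p n"
    by (simp add: legendre_def s1_def p_def)
  have "jacobi (Suc n) = (real n + 1) / (s1 * s3)" "legendre (Suc n) t = s3 * p (Suc n)"
    by (simp_all add: jacobi_def legendre_def s1_def s3_def p_def algebra_simps)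
  then have u: "jacobi (Suc n) * legendre (Suc n) t = (real n + 1) * p (Suc n) / s1"
    using s(2) by simp
  have l: "jacobi n * legendre (n - 1) t = real n * p (n - 1) / s1"
    using s(1) by (cases n) (simp_all add: jacobi_def legendre_def s1_def p_def add_nonneg_eq_0_iff field_simps)
  have "jacobi (Suc n) * legendre (Suc n) t + jacobi n * legendre (n - 1) t = (2 * real n + 1) * t * p n / s1"
    unfolding u l using legendre_poly_recurrence[of n t] by (simp add: p_def flip: add_divide_distrib)
  also have "\<dots> = t * legendre n t"
    unfolding L s(3)[symmetric] using s(1) by simp
  finally show ?thesis by simp
qed

definition uniform_interval :: "real measure" where
  "uniform_interval = scale_measure (1/2) (restrict_space lborel {-1..1})"

lemma space_uniform_interval [simp]: "space uniform_interval = {-1..1}"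
  by (simp add: uniform_interval_def space_scale_measure space_restrict_space)

lemma sets_uniform_interval [measurable_cong]:
  "sets uniform_interval = sets (restrict_space borel {-1..1})"
  unfolding uniform_interval_def sets_scale_measure by (rule sets_restrict_space_cong) simp

lemma prob_space_uniform_interval: "prob_space uniform_interval"
proof
  have "emeasure (restrict_space lborel {-1..1::real}) {-1..1} = 2"
    by (subst emeasure_restrict_space) simp_all
  then show "emeasure uniform_interval (space uniform_interval) = 1"
    by (simp add: uniform_interval_def space_scale_measure space_restrict_space ennreal_divide_times)
qed

interpretation uniform_interval: prob_space uniform_interval
  by (rule prob_space_uniform_interval)

lemma borel_measurable_uniform_interval:
  "f \<in> borel_measurable borel \<Longrightarrow> f \<in> borel_measurable uniform_interval"
  unfolding measurable_cong_sets[OF sets_uniform_interval refl] by (rule measurable_restrict_space1)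

lemma poly_bounded_uniform_interval:
  fixes p :: "real poly"
  obtains B where "\<And>t. t \<in> {-1..1} \<Longrightarrow> \<bar>poly p t\<bar> \<le> B"
proof -
  have "compact (poly p ` {-1..1})"
    by (intro compact_continuous_image continuous_intros) simp
  then obtain B where "\<forall>x\<in>poly p ` {-1..1}. norm x \<le> B"
    using compact_imp_bounded bounded_iff by metis
  then show ?thesis by (intro that[of B]) (simp add: image_iff)
qed

lemma borel_measurable_poly: "poly p \<in> borel_measurable borel" for p :: "real poly"
  by (intro borel_measurable_continuous_onI continuous_intros)

lemma integrable_poly_uniform_interval: "integrable uniform_interval (poly p)" for p :: "real poly"
proof -
  obtain B where "\<And>t. t \<in> {-1..1} \<Longrightarrow> \<bar>poly p t\<bar> \<le> B"
    using poly_bounded_uniform_interval[of p] by blast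
  then show ?thesis
    by (intro uniform_interval.integrable_const_bound[of _ B] AE_I2 borel_measurable_uniform_interval)
      (auto simp: borel_measurable_poly)
qed

lemma integral_pderiv_uniform_interval:
  fixes p :: "real poly"
  shows "(\<integral>t. poly (pderiv p) t \<partial>uniform_interval) = (poly p 1 - poly p (-1)) / 2"
proof -
  have half: "ennreal (1 / 2) = 1 / 2"
    using ennreal_divide_numeral[of 1 "num.Bit0 num.One"] by simp
  have d: "uniform_interval = density (restrict_space lborel {-1..1}) (\<lambda>_. ennreal (1 / 2))"
    unfolding half uniform_interval_def
  proof (rule measure_eqI)
    fix A :: "real set" assume "A \<in> sets (scale_measure (1 / 2) (restrict_space lborel {-1..1}))"
    then have "A \<in> sets (restrict_space lborel {-1..1})"
      by (simp only: sets_scale_measure)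
    then show "emeasure (scale_measure (1 / 2) (restrict_space lborel {-1..1})) A =
        emeasure (density (restrict_space lborel {-1..1}) (\<lambda>_. 1 / 2)) A"
      unfolding emeasure_scale_measure by (rule emeasure_density_const[symmetric])
  qed (simp only: sets_scale_measure sets_density)
  have m: "poly (pderiv p) \<in> borel_measurable (restrict_space lborel {-1..1})"
    by (rule measurable_restrict_space1) (simp add: borel_measurable_poly)
  have "(\<integral>t. poly (pderiv p) t \<partial>uniform_interval) =
      (\<integral>t. (1/2) *\<^sub>R poly (pderiv p) t \<partial>restrict_space lborel {-1..1})"
    unfolding d using integral_density[OF m, of "\<lambda>_. 1 / 2"] by simp
  also have "\<dots> = (1/2) * (\<integral>t\<in>{-1..1}. poly (pderiv p) t \<partial>lborel)"
    by (subst integral_restrict_space) (simp_all add: set_lebesgue_integral_def)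
  also have "(\<integral>t\<in>{-1..1}. poly (pderiv p) t \<partial>lborel) = poly p 1 - poly p (-1)"
    unfolding set_lebesgue_integral_def
  proof (rule integral_FTC_Icc)
    show "(poly p has_vector_derivative poly (pderiv p) t) (at t within {-1..1})" for t
      by (rule has_vector_derivative_at_within)
        (use poly_DERIV[of p t] in \<open>simp only: has_real_derivative_iff_has_vector_derivative\<close>)
    show "continuous_on {-1..1} (poly (pderiv p))"
      by (intro continuous_intros)
  qed simp
  finally show ?thesis by simp
qed

text \<open>
  The differential equation says that the \<open>P\<^sub>n\<close> are eigenfunctions, for distinct eigenvalues, of the
  symmetric operator \<open>P \<mapsto> ((t\<^sup>2 - 1) P')'\<close>.
\<close>

lemma integral_legendre_poly_neq:
  assumes "m \<noteq> n"
  shows "(\<integral>t. poly (legendre_poly m * legendre_poly n) t \<partial>uniform_interval) = 0"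
proof -
  define P where "P = legendre_poly"
  define W where "W = [:-1, 0, 1 :: real:]"
  have e: "pderiv (W * pderiv (P k)) = smult (real k * real (Suc k)) (P k)" for k
    unfolding P_def W_def by (rule legendre_poly_ode)
  have "pderiv (P n * (W * pderiv (P m)) - P m * (W * pderiv (P n))) =
      smult (real m * real (Suc m) - real n * real (Suc n)) (P m * P n)"
    unfolding pderiv_diff pderiv_mult[of "P _"] e
    by (rule real_poly_ext) (simp add: algebra_simps)
  then have "(real m * real (Suc m) - real n * real (Suc n)) * (\<integral>t. poly (P m * P n) t \<partial>uniform_interval) = 0"
    using integral_pderiv_uniform_interval[of "P n * (W * pderiv (P m)) - P m * (W * pderiv (P n))"]
    by (simp add: W_def)
  moreover have "real m * real (Suc m) \<noteq> real n * real (Suc n)"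
  proof -
    have less: "i * Suc i < j * Suc j" if "i < j" for i j :: nat
      using that by (intro mult_less_le_imp_less) auto
    have "m * Suc m \<noteq> n * Suc n"
      using assms less[of m n] less[of n m] by (cases m n rule: linorder_cases) auto
    then show ?thesis by (metis of_nat_eq_iff of_nat_mult)
  qed
  ultimately show ?thesis by (simp add: P_def)
qed

text \<open>
  Multiplying two consecutive instances of the recurrence by \<open>P\<^bsub>n+1\<^esub>\<close> and by \<open>P\<^sub>n\<close> shows that the
  squared norm times \<open>2 n + 1\<close> is independent of \<open>n\<close>.
\<close>

lemma integral_legendre_poly_square:
  "(2 * real n + 1) * (\<integral>t. poly (legendre_poly n * legendre_poly n) t \<partial>uniform_interval) = 1"
proof -
  define h where "h m n = (\<integral>t. poly (legendre_poly m * legendre_poly n) t \<partial>uniform_interval)" for m n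
  define k where "k m n = (\<integral>t. poly (pCons 0 (legendre_poly m * legendre_poly n)) t \<partial>uniform_interval)" for m n
  have rec: "(real n + 1) * h (Suc n) m = (2 * real n + 1) * k n m - real n * h (n - 1) m" for n m
  proof -
    have "(\<integral>t. (real n + 1) * poly (legendre_poly (Suc n) * legendre_poly m) t \<partial>uniform_interval) =
        (\<integral>t. (2 * real n + 1) * poly (pCons 0 (legendre_poly n * legendre_poly m)) t
          - real n * poly (legendre_poly (n - 1) * legendre_poly m) t \<partial>uniform_interval)"
    proof (rule Bochner_Integration.integral_cong[OF refl])
      fix t
      show "(real n + 1) * poly (legendre_poly (Suc n) * legendre_poly m) t =
        (2 * real n + 1) * poly (pCons 0 (legendre_poly n * legendre_poly m)) t
          - real n * poly (legendre_poly (n - 1) * legendre_poly m) t"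
        using arg_cong[OF legendre_poly_recurrence[of n t], of "\<lambda>x. x * poly (legendre_poly m) t"]
        by (simp add: algebra_simps)
    qed
    also have "\<dots> = (\<integral>t. (2 * real n + 1) * poly (pCons 0 (legendre_poly n * legendre_poly m)) t \<partial>uniform_interval)
          - (\<integral>t. real n * poly (legendre_poly (n - 1) * legendre_poly m) t \<partial>uniform_interval)"
      by (intro Bochner_Integration.integral_diff integrable_mult_right integrable_poly_uniform_interval)
    finally show ?thesis
      unfolding h_def k_def integral_mult_right_zero .
  qed
  have k_sym: "k m n = k n m" for m n
    by (simp only: k_def mult.commute)
  have h0: "h m n = 0" if "m \<noteq> n" for m n
    unfolding h_def by (rule integral_legendre_poly_neq[OF that])
  have "(2 * real n + 1) * h n n = 1"
  proof (induction n)
    case 0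
    then show ?case by (simp add: h_def legendre_poly_0 uniform_interval.prob_space[simplified])
  next
    case (Suc n)
    have "(real n + 1) * h (Suc n) (Suc n) = (2 * real n + 1) * k n (Suc n)"
      using rec[of n "Suc n"] h0[of "n - 1" "Suc n"] by simp
    moreover have "(2 * real n + 3) * k n (Suc n) = (real n + 1) * h n n"
      using rec[of "Suc n" n] h0[of "Suc (Suc n)" n] k_sym[of n "Suc n"] by (simp add: algebra_simps)
    ultimately have "(real n + 1) * ((2 * real n + 3) * h (Suc n) (Suc n)) =
        (real n + 1) * ((2 * real n + 1) * h n n)"
      unfolding mult.left_commute[of "real n + 1"] by (simp only: mult.left_commute[of "2 * real n + 3"])
    then have "(2 * real n + 3) * h (Suc n) (Suc n) = 1"
      using Suc by (subst (asm) mult_cancel_left) linarith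
    then show ?case by (simp add: algebra_simps)
  qed
  then show ?thesis by (simp only: h_def)
qed

lemma continuous_on_legendre: "continuous_on S (legendre n)"
  unfolding legendre_def[abs_def] by (intro continuous_intros)

lemma legendre_measurable [measurable]: "legendre n \<in> borel_measurable borel"
  by (intro borel_measurable_continuous_onI continuous_on_legendre)

lemma legendre_0 [simp]: "legendre 0 t = 1"
  by (simp add: legendre_def legendre_poly_0)

lemma integral_legendre_mult:
  "integrable uniform_interval (\<lambda>t. legendre m t * legendre n t)"
  "(\<integral>t. legendre m t * legendre n t \<partial>uniform_interval) = (if m = n then 1 else 0)"
proof -
  have *: "(\<lambda>t. legendre m t * legendre n t) =
      (\<lambda>t. (sqrt (2 * real m + 1) * sqrt (2 * real n + 1)) * poly (legendre_poly m * legendre_poly n) t)"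
    by (rule ext) (simp add: legendre_def)
  show "integrable uniform_interval (\<lambda>t. legendre m t * legendre n t)"
    unfolding * by (intro integrable_mult_right integrable_poly_uniform_interval)
  show "(\<integral>t. legendre m t * legendre n t \<partial>uniform_interval) = (if m = n then 1 else 0)"
    unfolding * using integral_legendre_poly_neq[of m n] integral_legendre_poly_square[of n]
    by (simp del: poly_mult)
qed

lemma abs_legendre_le:
  assumes "t \<in> {-1..1}"
  shows "\<bar>legendre n t\<bar> \<le> sqrt (1 + 2 * real n)"
  using mult_left_mono[OF abs_legendre_poly_le_1[of t n], of "sqrt (1 + 2 * real n)"] assms
  by (simp add: legendre_def abs_mult algebra_simps abs_le_iff)

section \<open>Tensorised Legendre polynomials\<close>

lemma param_measure_eq: "param_measure = Pi\<^sub>M UNIV (\<lambda>_. uniform_interval)"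
  by (simp add: param_measure_def uniform_interval_def)

interpretation param_measure: prob_space param_measure
  by (rule prob_space_param_measure)

interpretation uniform_product: product_prob_space "\<lambda>_::nat. uniform_interval" UNIV
  by unfold_locales

lemma distr_coordinate: "distr param_measure uniform_interval (\<lambda>y. y j) = uniform_interval"
  unfolding param_measure_eq by (rule uniform_product.PiM_component) simp

lemma measurable_coordinate: "(\<lambda>y. y j) \<in> measurable param_measure uniform_interval"
  unfolding param_measure_eq by (rule measurable_component_singleton) simp

lemma coordinate_borel_measurable [measurable]: "(\<lambda>y. y j) \<in> borel_measurable param_measure"
  using measurable_compose[OF measurable_coordinate borel_measurable_uniform_interval[of "\<lambda>x. x"]] by simp

lemma indep_vars_coordinates:
  "param_measure.indep_vars (\<lambda>_. uniform_interval) (\<lambda>j y. y j) UNIV"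
proof -
  have *: "(\<lambda>x::nat \<Rightarrow> real. \<lambda>i\<in>UNIV. x i) = (\<lambda>x. x)"
    unfolding restrict_def by simp
  have "distr param_measure (\<Pi>\<^sub>M i\<in>UNIV. uniform_interval) (\<lambda>x. \<lambda>i\<in>UNIV. x i) = param_measure"
    unfolding * param_measure_eq by (rule distr_id)
  also have "\<dots> = (\<Pi>\<^sub>M i\<in>UNIV. distr param_measure uniform_interval (\<lambda>y. y i))"
    unfolding distr_coordinate by (rule param_measure_eq)
  finally show ?thesis
    by (rule param_measure.indep_vars_iff_distr_eq_PiM'[OF UNIV_not_empty measurable_coordinate, THEN iffD2])
qed

lemma integral_prod_coordinates:
  fixes f :: "nat \<Rightarrow> real \<Rightarrow> real"
  assumes "finite J" "\<And>j. j \<in> J \<Longrightarrow> integrable uniform_interval (f j)"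
  shows "integrable param_measure (\<lambda>y. \<Prod>j\<in>J. f j (y j))"
    and "(\<integral>y. (\<Prod>j\<in>J. f j (y j)) \<partial>param_measure) = (\<Prod>j\<in>J. \<integral>t. f j t \<partial>uniform_interval)"
proof -
  have m: "f j \<in> borel_measurable uniform_interval" if "j \<in> J" for j
    using assms(2)[OF that] by (rule borel_measurable_integrable)
  have i: "param_measure.indep_vars (\<lambda>_. borel) (\<lambda>j y. f j (y j)) J"
    by (rule param_measure.indep_vars_compose2[OF
          param_measure.indep_vars_subset[OF indep_vars_coordinates subset_UNIV] m])
  have int: "integrable param_measure (\<lambda>y. f j (y j))" if "j \<in> J" for j
    using integrable_distr[OF measurable_coordinate[of j], of "f j"] assms(2)[OF that] by (simp add: distr_coordinate)
  show "integrable param_measure (\<lambda>y. \<Prod>j\<in>J. f j (y j))"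
    by (rule param_measure.indep_vars_integrable[OF assms(1) i int])
  have "(\<integral>y. f j (y j) \<partial>param_measure) = (\<integral>t. f j t \<partial>uniform_interval)" if "j \<in> J" for j
    using integral_distr[OF measurable_coordinate[of j] m[OF that]] by (simp add: distr_coordinate)
  then show "(\<integral>y. (\<Prod>j\<in>J. f j (y j)) \<partial>param_measure) = (\<Prod>j\<in>J. \<integral>t. f j t \<partial>uniform_interval)"
    using param_measure.indep_vars_lebesgue_integral[OF assms(1) i int] by simp
qed

lemma legendre_multi_superset:
  assumes "finite J" "{j. \<nu> j \<noteq> 0} \<subseteq> J"
  shows "legendre_multi \<nu> y = (\<Prod>j\<in>J. legendre (\<nu> j) (y j))"
  unfolding legendre_multi_def by (rule prod.mono_neutral_left) (use assms in auto)

lemma legendre_multi_borel_measurable [measurable]: "legendre_multi \<nu> \<in> borel_measurable param_measure"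
  unfolding legendre_multi_def[abs_def] by measurable

lemma continuous_on_legendre_multi: "continuous_on S (legendre_multi \<nu>)"
proof -
  have "continuous_on S (\<lambda>y. legendre (\<nu> j) (y j))" for j
    by (rule continuous_on_compose2[OF continuous_on_legendre[of UNIV]])
      (auto intro: continuous_on_subset[OF continuous_on_product_coordinates])
  then show ?thesis
    unfolding legendre_multi_def[abs_def] by (intro continuous_on_prod)
qed

lemma abs_legendre_multi_le:
  assumes "y \<in> param_domain"
  shows "\<bar>legendre_multi \<nu> y\<bar> \<le> beta_weight \<nu>"
  unfolding legendre_multi_def beta_weight_def abs_prod
  using assms by (intro prod_mono) (auto simp: param_domain_def intro!: abs_legendre_le)

lemma beta_weight_ge_1: "1 \<le> beta_weight \<nu>"
  unfolding beta_weight_def by (rule prod_ge_1) simp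

lemma legendre_multi_orthonormal:
  assumes "\<mu> \<in> multi_indices" "\<nu> \<in> multi_indices"
  shows "integrable param_measure (\<lambda>y. legendre_multi \<mu> y * legendre_multi \<nu> y)"
    and "(\<integral>y. legendre_multi \<mu> y * legendre_multi \<nu> y \<partial>param_measure) = (if \<mu> = \<nu> then 1 else 0)"
proof -
  define J where "J = {j. \<mu> j \<noteq> 0} \<union> {j. \<nu> j \<noteq> 0}"
  have J: "finite J" using assms by (simp add: J_def multi_indices_def)
  have eq: "(\<lambda>y. legendre_multi \<mu> y * legendre_multi \<nu> y) =
      (\<lambda>y. \<Prod>j\<in>J. legendre (\<mu> j) (y j) * legendre (\<nu> j) (y j))"
    using legendre_multi_superset[OF J] by (simp add: J_def prod.distrib)
  show "integrable param_measure (\<lambda>y. legendre_multi \<mu> y * legendre_multi \<nu> y)"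
    unfolding eq by (rule integral_prod_coordinates(1)[OF J integral_legendre_mult(1)])
  have "(\<integral>y. legendre_multi \<mu> y * legendre_multi \<nu> y \<partial>param_measure) =
      (\<Prod>j\<in>J. if \<mu> j = \<nu> j then 1 else 0)"
    unfolding eq using integral_prod_coordinates(2)[OF J integral_legendre_mult(1)]
    by (simp add: integral_legendre_mult(2))
  also have "\<dots> = (if \<mu> = \<nu> then 1 else 0)"
  proof (cases "\<mu> = \<nu>")
    case False
    then obtain j where j: "\<mu> j \<noteq> \<nu> j" by (auto simp: fun_eq_iff)
    then have "j \<in> J" by (auto simp: J_def)
    with j J show ?thesis using False by (auto simp: prod_zero_iff)
  qed simp
  finally show "(\<integral>y. legendre_multi \<mu> y * legendre_multi \<nu> y \<partial>param_measure) = (if \<mu> = \<nu> then 1 else 0)" .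
qed

lemma multi_indices_0: "(\<lambda>_. 0) \<in> multi_indices"
  by (simp add: multi_indices_def)

lemma multi_indices_upd [intro]:
  assumes "\<nu> \<in> multi_indices"
  shows "\<nu>(j := n) \<in> multi_indices"
proof -
  have "{i. (\<nu>(j := n)) i \<noteq> 0} \<subseteq> insert j {i. \<nu> i \<noteq> 0}" by auto
  moreover have "finite (insert j {i. \<nu> i \<noteq> 0})" using assms by (simp add: multi_indices_def)
  ultimately show ?thesis unfolding multi_indices_def by (blast intro: finite_subset)
qed

lemma legendre_multi_0 [simp]: "legendre_multi (\<lambda>_. 0) y = 1"
  by (simp add: legendre_multi_def)

lemma legendre_multi_upd:
  assumes "\<nu> \<in> multi_indices"
  shows "legendre_multi (\<nu>(j := n)) y = legendre n (y j) * legendre_multi (\<nu>(j := 0)) y"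
proof -
  define J where "J = {i. \<nu> i \<noteq> 0} - {j}"
  have J: "finite J" "j \<notin> J" using assms by (auto simp: J_def multi_indices_def)
  have "legendre_multi (\<nu>(j := n)) y = (\<Prod>i\<in>insert j J. legendre ((\<nu>(j := n)) i) (y i))"
    by (rule legendre_multi_superset) (use J in \<open>auto simp: J_def\<close>)
  also have "\<dots> = legendre n (y j) * (\<Prod>i\<in>J. legendre ((\<nu>(j := n)) i) (y i))"
    using J by simp
  also have "(\<Prod>i\<in>J. legendre ((\<nu>(j := n)) i) (y i)) = (\<Prod>i\<in>J. legendre ((\<nu>(j := 0)) i) (y i))"
    using J by (intro prod.cong) auto
  also have "\<dots> = legendre_multi (\<nu>(j := 0)) y"
    by (rule legendre_multi_superset[symmetric]) (use J in \<open>auto simp: J_def\<close>)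
  finally show ?thesis .
qed

text \<open>
  Multiplication by a coordinate acts as a Jacobi matrix on the corresponding index.  This is the
  only property of Legendre polynomials, besides orthonormality and the bound by \<open>\<beta>\<close>, that enters
  the estimates.
\<close>

lemma legendre_multi_recurrence:
  assumes "\<nu> \<in> multi_indices"
  shows "y j * legendre_multi \<nu> y =
    jacobi (Suc (\<nu> j)) * legendre_multi (\<nu>(j := Suc (\<nu> j))) y +
    jacobi (\<nu> j) * legendre_multi (\<nu>(j := \<nu> j - 1)) y"
proof -
  have "legendre_multi \<nu> y = legendre (\<nu> j) (y j) * legendre_multi (\<nu>(j := 0)) y"
    using legendre_multi_upd[OF assms, of j "\<nu> j" y] by simp
  then have "y j * legendre_multi \<nu> y = (y j * legendre (\<nu> j) (y j)) * legendre_multi (\<nu>(j := 0)) y"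
    by simp
  then show ?thesis
    unfolding legendre_recurrence[of "y j"] legendre_multi_upd[OF assms, of j "Suc (\<nu> j)"]
      legendre_multi_upd[OF assms, of j "\<nu> j - 1"]
    by (simp add: distrib_right)
qed

lemma compact_param_domain: "compact param_domain"
proof -
  have "compactin (product_topology (\<lambda>_. euclidean) UNIV) (Pi\<^sub>E UNIV (\<lambda>_::nat. {-1..1::real}))"
    unfolding compactin_PiE by (simp add: compactin_euclidean_iff)
  moreover have "Pi\<^sub>E UNIV (\<lambda>_::nat. {-1..1::real}) = param_domain"
    by (auto simp: param_domain_def PiE_iff)
  ultimately show ?thesis
    by (simp add: euclidean_product_topology compactin_euclidean_iff)
qed

text \<open>
  Every neighbourhood of a parameter contains a box that restricts only finitely many coordinates,
  and the measure of such a box is a finite product of positive lengths.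
\<close>

lemma measure_open_pos:
  assumes "open S" "y \<in> S" "y \<in> param_domain"
    and N: "N \<in> sets param_measure" "S \<inter> param_domain \<subseteq> N"
  shows "measure param_measure N > 0"
proof -
  have "openin (product_topology (\<lambda>_. euclidean) UNIV) S"
    using assms(1) by (simp add: euclidean_product_topology)
  from this[unfolded openin_product_topology_alt, THEN bspec, OF assms(2)]
  obtain X where X: "finite {i. X i \<noteq> UNIV}" "\<And>i. open (X i)" "y \<in> Pi\<^sub>E UNIV X" "Pi\<^sub>E UNIV X \<subseteq> S"
    by auto
  define J where "J = {i. X i \<noteq> UNIV}"
  define A where "A i = X i \<inter> {-1..1::real}" for i
  define Y where "Y = {z \<in> space param_measure. \<forall>i\<in>J. z i \<in> A i}"
  have A: "A i \<in> sets uniform_interval" for i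
    using X(2)[of i] unfolding sets_uniform_interval A_def
    by (auto simp: sets_restrict_space)
  have "measure uniform_interval (A i) > 0" for i
  proof -
    have yi: "y i \<in> X i" "y i \<in> {-1..1}"
      using X(3) assms(3) by (auto simp: param_domain_def)
    obtain e where e: "e > 0" "ball (y i) e \<subseteq> X i"
      using X(2)[of i] yi(1) open_contains_ball by blast
    define a b where "a = max (-1) (y i - e / 2)" and "b = min 1 (y i + e / 2)"
    have ab: "a < b" using yi(2) e(1) by (auto simp: a_def b_def)
    have sub: "{a..b} \<subseteq> A i"
      using e yi by (auto simp: A_def a_def b_def subset_eq dist_real_def)
    have "{a..b} \<subseteq> {-1..1}" by (simp add: a_def b_def)
    then have "emeasure uniform_interval {a..b} = (1/2) * ennreal (b - a)"
      unfolding uniform_interval_def emeasure_scale_measure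
      using ab by (subst emeasure_restrict_space) auto
    moreover have "(1/2) * ennreal (b - a) > 0"
    proof -
      have "0 < ennreal (1 / 2)" by (subst ennreal_less_zero_iff) simp
      also have "ennreal (1 / 2) = 1 / 2"
        using ennreal_divide_numeral[of 1 "num.Bit0 num.One"] by simp
      finally show ?thesis using ab by (simp only: ennreal_zero_less_mult_iff) simp
    qed
    moreover have "emeasure uniform_interval {a..b} \<le> emeasure uniform_interval (A i)"
      by (rule emeasure_mono[OF sub A])
    ultimately have "emeasure uniform_interval (A i) > 0" by simp
    then show ?thesis by (simp add: uniform_interval.emeasure_eq_measure)
  qed
  then have "(\<Prod>i\<in>J. measure uniform_interval (A i)) > 0"
    by (intro prod_pos) simp
  moreover have "emeasure param_measure Y = (\<Prod>i\<in>J. emeasure uniform_interval (A i))"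
    unfolding Y_def param_measure_eq
    by (rule uniform_product.emeasure_PiM_Collect) (use X(1) A in \<open>auto simp: J_def\<close>)
  ultimately have "emeasure param_measure Y > 0"
    by (simp add: uniform_interval.emeasure_eq_measure prod_ennreal)
  moreover have "Y \<subseteq> S \<inter> param_domain"
  proof
    fix z assume z: "z \<in> Y"
    then have "z i \<in> X i" for i by (cases "i \<in> J") (auto simp: Y_def A_def J_def)
    then have "z \<in> Pi\<^sub>E UNIV X" by (simp add: PiE_iff)
    with X(4) z show "z \<in> S \<inter> param_domain"
      by (auto simp: Y_def space_param_measure)
  qed
  ultimately have "emeasure param_measure N > 0"
    using emeasure_mono[of Y N param_measure] N by (metis order_less_le_trans order_trans)
  then show ?thesis by (simp add: param_measure.emeasure_eq_measure)
qed

section \<open>Uniform approximation by tensorised Legendre polynomials\<close>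

inductive_set legendre_span :: "((nat \<Rightarrow> real) \<Rightarrow> real) set" where
  legendre_span_0: "(\<lambda>_. 0) \<in> legendre_span"
| legendre_span_step: "p \<in> legendre_span \<Longrightarrow> \<nu> \<in> multi_indices \<Longrightarrow>
    (\<lambda>y. p y + c * legendre_multi \<nu> y) \<in> legendre_span"

lemma legendre_span_add:
  assumes "p \<in> legendre_span" "q \<in> legendre_span"
  shows "(\<lambda>y. p y + q y) \<in> legendre_span"
  using assms(2)
proof induction
  case (legendre_span_step q \<nu> c)
  from legendre_span.legendre_span_step[OF this(3,2), of c] show ?case
    by (simp add: add.assoc)
qed (use assms(1) in simp)

lemma legendre_span_scale:
  assumes "p \<in> legendre_span"
  shows "(\<lambda>y. a * p y) \<in> legendre_span"
  using assms
proof induction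
  case (legendre_span_step q \<nu> c)
  from legendre_span.legendre_span_step[OF this(3,2), of "a * c"] show ?case
    by (simp add: algebra_simps)
qed (use legendre_span_0 in simp)

text \<open>
  By the recurrence, the span is stable under multiplication by coordinates; hence it contains all
  polynomials in the coordinates.
\<close>

lemma legendre_span_coordinate:
  assumes "p \<in> legendre_span"
  shows "(\<lambda>y. y j * p y) \<in> legendre_span"
  using assms
proof induction
  case (legendre_span_step p \<nu> c)
  have "(\<lambda>y. (y j * p y + (c * jacobi (Suc (\<nu> j))) * legendre_multi (\<nu>(j := Suc (\<nu> j))) y)
      + (c * jacobi (\<nu> j)) * legendre_multi (\<nu>(j := \<nu> j - 1)) y) \<in> legendre_span"
    by (intro legendre_span.legendre_span_step multi_indices_upd legendre_span_step.hyps legendre_span_step.IH)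
  also have "(\<lambda>y. (y j * p y + (c * jacobi (Suc (\<nu> j))) * legendre_multi (\<nu>(j := Suc (\<nu> j))) y)
      + (c * jacobi (\<nu> j)) * legendre_multi (\<nu>(j := \<nu> j - 1)) y) = (\<lambda>y. y j * (p y + c * legendre_multi \<nu> y))"
  proof (rule ext)
    fix y
    show "(y j * p y + (c * jacobi (Suc (\<nu> j))) * legendre_multi (\<nu>(j := Suc (\<nu> j))) y)
      + (c * jacobi (\<nu> j)) * legendre_multi (\<nu>(j := \<nu> j - 1)) y = y j * (p y + c * legendre_multi \<nu> y)"
      using arg_cong[OF legendre_multi_recurrence[OF legendre_span_step.hyps(2), of y j], of "\<lambda>t. c * t"]
      by (simp add: algebra_simps)
  qed
  finally show ?case .
qed (use legendre_span_0 in simp)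

lemma legendre_span_expansion:
  assumes "p \<in> legendre_span"
  shows "\<exists>N c. finite N \<and> N \<subseteq> multi_indices \<and> (\<forall>\<nu>. \<nu> \<notin> N \<longrightarrow> c \<nu> = 0) \<and>
    (\<forall>y. p y = (\<Sum>\<nu>\<in>N. c \<nu> * legendre_multi \<nu> y))"
  using assms
proof induction
  case legendre_span_0
  show ?case by (rule exI[of _ "{}"], rule exI[of _ "\<lambda>_. 0"]) simp
next
  case (legendre_span_step p \<mu> a)
  then obtain N c where N: "finite N" "N \<subseteq> multi_indices" "\<And>\<nu>. \<nu> \<notin> N \<Longrightarrow> c \<nu> = 0"
    "\<And>y. p y = (\<Sum>\<nu>\<in>N. c \<nu> * legendre_multi \<nu> y)" by blast
  have "p y + a * legendre_multi \<mu> y =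
      (\<Sum>\<nu>\<in>insert \<mu> N. (c \<nu> + (if \<nu> = \<mu> then a else 0)) * legendre_multi \<nu> y)" for y
  proof -
    have "(\<Sum>\<nu>\<in>insert \<mu> N. (c \<nu> + (if \<nu> = \<mu> then a else 0)) * legendre_multi \<nu> y) =
        (\<Sum>\<nu>\<in>insert \<mu> N. c \<nu> * legendre_multi \<nu> y) + (\<Sum>\<nu>\<in>insert \<mu> N. if \<nu> = \<mu> then a * legendre_multi \<nu> y else 0)"
      unfolding sum.distrib[symmetric] by (rule sum.cong) (auto simp: algebra_simps)
    also have "(\<Sum>\<nu>\<in>insert \<mu> N. c \<nu> * legendre_multi \<nu> y) = p y"
      unfolding N(4) by (rule sum.mono_neutral_right) (use N in auto)
    also have "(\<Sum>\<nu>\<in>insert \<mu> N. if \<nu> = \<mu> then a * legendre_multi \<nu> y else 0) = a * legendre_multi \<mu> y"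
      using N(1) by (subst sum.delta) auto
    finally show ?thesis by simp
  qed
  then show ?case
    using N legendre_span_step.hyps(2)
    by (intro exI[of _ "insert \<mu> N"] exI[of _ "\<lambda>\<nu>. c \<nu> + (if \<nu> = \<mu> then a else 0)"]) auto
qed

inductive_set coordinate_polynomials :: "((nat \<Rightarrow> real) \<Rightarrow> real) set" where
  const: "(\<lambda>_. c) \<in> coordinate_polynomials"
| coordinate: "(\<lambda>y. y j) \<in> coordinate_polynomials"
| add: "p \<in> coordinate_polynomials \<Longrightarrow> q \<in> coordinate_polynomials \<Longrightarrow> (\<lambda>y. p y + q y) \<in> coordinate_polynomials"
| mult: "p \<in> coordinate_polynomials \<Longrightarrow> q \<in> coordinate_polynomials \<Longrightarrow> (\<lambda>y. p y * q y) \<in> coordinate_polynomials"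

lemma coordinate_polynomials_mult_legendre_span:
  assumes "p \<in> coordinate_polynomials" "q \<in> legendre_span"
  shows "(\<lambda>y. p y * q y) \<in> legendre_span"
  using assms
proof (induction arbitrary: q)
  case (add p1 p2)
  then show ?case by (simp add: distrib_right legendre_span_add)
next
  case (mult p1 p2)
  from mult.IH(1)[OF mult.IH(2)[OF mult.prems]] show ?case by (simp add: mult.assoc)
qed (simp_all add: legendre_span_scale legendre_span_coordinate)

lemma coordinate_polynomials_subset_legendre_span:
  assumes "p \<in> coordinate_polynomials"
  shows "p \<in> legendre_span"
proof -
  have "(\<lambda>y. 0 + 1 * legendre_multi (\<lambda>_. 0) y) \<in> legendre_span"
    by (intro legendre_span.intros multi_indices_0)
  from coordinate_polynomials_mult_legendre_span[OF assms this] show ?thesis by simp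
qed

lemma legendre_span_dense:
  fixes f :: "(nat \<Rightarrow> real) \<Rightarrow> real"
  assumes "continuous_on param_domain f" "\<epsilon> > 0"
  obtains p where "p \<in> legendre_span" "\<And>y. y \<in> param_domain \<Longrightarrow> \<bar>f y - p y\<bar> < \<epsilon>"
proof -
  have cont: "continuous_on param_domain p" if "p \<in> coordinate_polynomials" for p
    using that
  proof induction
    case (coordinate j)
    show ?case by (rule continuous_on_subset[OF continuous_on_product_coordinates]) simp
  qed (auto intro!: continuous_intros)
  interpret function_ring_on coordinate_polynomials param_domain
  proof
    fix x y :: "nat \<Rightarrow> real" assume "x \<noteq> y"
    then obtain j where "x j \<noteq> y j" by (auto simp: fun_eq_iff)
    then show "\<exists>p\<in>coordinate_polynomials. p x \<noteq> p y"
      using coordinate_polynomials.coordinate by (intro bexI[of _ "\<lambda>y. y j"]) auto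
  qed (use compact_param_domain cont in \<open>auto intro: coordinate_polynomials.intros\<close>)
  from Stone_Weierstrass_basic[OF assms] that show ?thesis
    using coordinate_polynomials_subset_legendre_span by blast
qed

text \<open>
  Functions with values in a normed space are reduced to scalar ones by a partition of unity: the
  range is covered by finitely many small balls, and the value at \<open>y\<close> is close to any convex
  combination of the centres of those balls that contain it.
\<close>

lemma legendre_approximation:
  fixes u :: "(nat \<Rightarrow> real) \<Rightarrow> 'v::real_normed_vector"
  assumes u: "continuous_on param_domain u" and "\<epsilon> > 0"
  shows "\<exists>N c. finite N \<and> N \<subseteq> multi_indices \<and> (\<forall>\<nu>. c \<nu> \<in> span (u ` param_domain)) \<and>
    (\<forall>\<nu>. \<nu> \<notin> N \<longrightarrow> c \<nu> = 0) \<and>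
    (\<forall>y\<in>param_domain. norm (u y - (\<Sum>\<nu>\<in>N. legendre_multi \<nu> y *\<^sub>R c \<nu>)) < \<epsilon>)"
proof -
  define K where "K = u ` param_domain"
  have "compact K" unfolding K_def by (intro compact_continuous_image u compact_param_domain)
  moreover have "K \<subseteq> (\<Union>v\<in>K. ball v (\<epsilon> / 2))"
    using \<open>\<epsilon> > 0\<close> by auto
  ultimately obtain C where C: "C \<subseteq> K" "finite C" "K \<subseteq> (\<Union>v\<in>C. ball v (\<epsilon> / 2))"
    using compactE_image[of K K "\<lambda>v. ball v (\<epsilon> / 2)"] by (metis open_ball)
  define \<phi> where "\<phi> v y = max 0 (\<epsilon> / 2 - norm (u y - v))" for v y
  define s where "s y = (\<Sum>v\<in>C. \<phi> v y)" for y
  have \<phi>0: "\<phi> v y \<ge> 0" for v y by (simp add: \<phi>_def)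
  have s: "s y > 0" if y: "y \<in> param_domain" for y
  proof -
    obtain v where v: "v \<in> C" "u y \<in> ball v (\<epsilon> / 2)"
      using C(3) y unfolding K_def by blast
    then have "\<phi> v y > 0" by (simp add: \<phi>_def dist_norm norm_minus_commute)
    moreover have "\<phi> v y \<le> s y"
      unfolding s_def using v(1) C(2) \<phi>0 by (intro member_le_sum) auto
    ultimately show ?thesis by simp
  qed
  have cont: "continuous_on param_domain (\<lambda>y. \<phi> v y / s y)" for v
  proof -
    have "continuous_on param_domain (\<phi> v)" for v
      unfolding \<phi>_def[abs_def] by (intro continuous_intros u)
    then show ?thesis
      using s unfolding s_def[abs_def]
      by (intro continuous_on_divide continuous_on_sum) (metis less_irrefl)+
  qed
  \<comment> \<open>Errors of size \<open>\<delta>\<close> in the partition functions perturb the combination of the centres by less than \<open>\<epsilon> / 2\<close>.\<close>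
  define \<delta> where "\<delta> = \<epsilon> / (2 * (1 + (\<Sum>v\<in>C. norm v)))"
  have sumC: "(\<Sum>v\<in>C. norm v) \<ge> 0" by (simp add: sum_nonneg)
  have \<delta>: "\<delta> > 0" using \<open>\<epsilon> > 0\<close> sumC by (simp add: \<delta>_def)
  have "\<exists>p\<in>legendre_span. \<forall>y\<in>param_domain. \<bar>\<phi> v y / s y - p y\<bar> < \<delta>" for v
    by (rule legendre_span_dense[OF cont[of v] \<delta>]) (intro bexI ballI)
  then have "\<forall>v. \<exists>p. p \<in> legendre_span \<and> (\<forall>y\<in>param_domain. \<bar>\<phi> v y / s y - p y\<bar> < \<delta>)"
    by (auto simp: Bex_def)
  from choice[OF this] obtain p where
    p: "\<And>v. p v \<in> legendre_span" "\<And>v y. y \<in> param_domain \<Longrightarrow> \<bar>\<phi> v y / s y - p v y\<bar> < \<delta>"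
    by auto
  have "\<forall>v. \<exists>N a. finite N \<and> N \<subseteq> multi_indices \<and> (\<forall>\<nu>. \<nu> \<notin> N \<longrightarrow> a \<nu> = 0) \<and>
      (\<forall>y. p v y = (\<Sum>\<nu>\<in>N. a \<nu> * legendre_multi \<nu> y))"
    by (rule allI) (rule legendre_span_expansion[OF p(1)])
  from choice[OF this] obtain N where
    "\<forall>v. \<exists>a. finite (N v) \<and> N v \<subseteq> multi_indices \<and> (\<forall>\<nu>. \<nu> \<notin> N v \<longrightarrow> a \<nu> = 0) \<and>
      (\<forall>y. p v y = (\<Sum>\<nu>\<in>N v. a \<nu> * legendre_multi \<nu> y))" ..
  from choice[OF this] obtain a where
    "\<forall>v. finite (N v) \<and> N v \<subseteq> multi_indices \<and> (\<forall>\<nu>. \<nu> \<notin> N v \<longrightarrow> a v \<nu> = 0) \<and>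
      (\<forall>y. p v y = (\<Sum>\<nu>\<in>N v. a v \<nu> * legendre_multi \<nu> y))" ..
  then have N: "\<And>v. finite (N v)" "\<And>v. N v \<subseteq> multi_indices" "\<And>v \<nu>. \<nu> \<notin> N v \<Longrightarrow> a v \<nu> = 0"
    and a: "\<And>v y. p v y = (\<Sum>\<nu>\<in>N v. a v \<nu> * legendre_multi \<nu> y)"
    by simp_all
  define M where "M = (\<Union>v\<in>C. N v)"
  define c where "c \<nu> = (\<Sum>v\<in>C. a v \<nu> *\<^sub>R v)" for \<nu>
  have p_sum: "(\<Sum>\<nu>\<in>M. legendre_multi \<nu> y *\<^sub>R c \<nu>) = (\<Sum>v\<in>C. p v y *\<^sub>R v)" for y
  proof -
    have "(\<Sum>\<nu>\<in>M. legendre_multi \<nu> y *\<^sub>R c \<nu>) = (\<Sum>v\<in>C. \<Sum>\<nu>\<in>M. (a v \<nu> * legendre_multi \<nu> y) *\<^sub>R v)"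
      unfolding c_def scaleR_sum_right by (subst sum.swap) (simp add: mult.commute)
    also have "\<dots> = (\<Sum>v\<in>C. (\<Sum>\<nu>\<in>M. a v \<nu> * legendre_multi \<nu> y) *\<^sub>R v)"
      by (simp add: scaleR_sum_left)
    also have "\<dots> = (\<Sum>v\<in>C. p v y *\<^sub>R v)"
    proof (rule sum.cong[OF refl])
      fix v assume v: "v \<in> C"
      have "(\<Sum>\<nu>\<in>M. a v \<nu> * legendre_multi \<nu> y) = p v y"
        unfolding a by (rule sum.mono_neutral_right) (use N v C(2) in \<open>auto simp: M_def\<close>)
      then show "(\<Sum>\<nu>\<in>M. a v \<nu> * legendre_multi \<nu> y) *\<^sub>R v = p v y *\<^sub>R v" by simp
    qed
    finally show ?thesis .
  qed
  have "norm (u y - (\<Sum>\<nu>\<in>M. legendre_multi \<nu> y *\<^sub>R c \<nu>)) < \<epsilon>" if y: "y \<in> param_domain" for y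
  proof -
    have one: "(\<Sum>v\<in>C. \<phi> v y / s y) = 1"
      unfolding sum_divide_distrib[symmetric] s_def[symmetric] using s[OF y] by simp
    have "u y - (\<Sum>v\<in>C. (\<phi> v y / s y) *\<^sub>R v) = (\<Sum>v\<in>C. (\<phi> v y / s y) *\<^sub>R (u y - v))"
      unfolding scaleR_diff_right sum_subtractf scaleR_sum_left[symmetric] one by simp
    then have "norm (u y - (\<Sum>v\<in>C. (\<phi> v y / s y) *\<^sub>R v)) \<le> (\<Sum>v\<in>C. norm ((\<phi> v y / s y) *\<^sub>R (u y - v)))"
      by (simp only: norm_sum)
    also have "\<dots> \<le> (\<Sum>v\<in>C. (\<phi> v y / s y) * (\<epsilon> / 2))"
    proof (rule sum_mono)
      fix v
      have *: "\<phi> v y * norm (u y - v) \<le> \<phi> v y * (\<epsilon> / 2)"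
      proof (cases "norm (u y - v) \<le> \<epsilon> / 2")
        case True
        then show ?thesis using \<phi>0[of v y] by (rule mult_left_mono)
      next
        case False
        then show ?thesis by (simp add: \<phi>_def)
      qed
      then show "norm ((\<phi> v y / s y) *\<^sub>R (u y - v)) \<le> (\<phi> v y / s y) * (\<epsilon> / 2)"
        using s[OF y] \<phi>0[of v y] divide_right_mono[OF *, of "s y"] by simp
    qed
    also have "\<dots> = \<epsilon> / 2" unfolding sum_distrib_right[symmetric] one by simp
    finally have 1: "norm (u y - (\<Sum>v\<in>C. (\<phi> v y / s y) *\<^sub>R v)) \<le> \<epsilon> / 2" .
    have "norm ((\<Sum>v\<in>C. (\<phi> v y / s y) *\<^sub>R v) - (\<Sum>v\<in>C. p v y *\<^sub>R v)) =
        norm (\<Sum>v\<in>C. (\<phi> v y / s y - p v y) *\<^sub>R v)"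
      by (simp only: scaleR_diff_left sum_subtractf)
    also have "\<dots> \<le> (\<Sum>v\<in>C. norm ((\<phi> v y / s y - p v y) *\<^sub>R v))"
      by (rule norm_sum)
    also have "\<dots> \<le> (\<Sum>v\<in>C. \<delta> * norm v)"
    proof (rule sum_mono)
      fix v
      show "norm ((\<phi> v y / s y - p v y) *\<^sub>R v) \<le> \<delta> * norm v"
        unfolding norm_scaleR using less_imp_le[OF p(2)[OF y, of v]] by (rule mult_right_mono) simp
    qed
    also have "\<dots> = \<delta> * (\<Sum>v\<in>C. norm v)" by (simp add: sum_distrib_left)
    also have "\<dots> < \<epsilon> / 2"
      using \<open>\<epsilon> > 0\<close> sumC by (simp add: \<delta>_def field_simps)
    finally have 2: "norm ((\<Sum>v\<in>C. (\<phi> v y / s y) *\<^sub>R v) - (\<Sum>v\<in>C. p v y *\<^sub>R v)) < \<epsilon> / 2" .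
    show ?thesis
      unfolding p_sum using norm_triangle_ineq[of "u y - (\<Sum>v\<in>C. (\<phi> v y / s y) *\<^sub>R v)"
          "(\<Sum>v\<in>C. (\<phi> v y / s y) *\<^sub>R v) - (\<Sum>v\<in>C. p v y *\<^sub>R v)"] 1 2 by simp
  qed
  moreover have "c \<nu> \<in> span (u ` param_domain)" for \<nu>
    unfolding c_def using C(1) by (intro span_sum span_scale span_base) (auto simp: K_def)
  moreover have "finite M" "M \<subseteq> multi_indices" using N C(2) by (auto simp: M_def)
  moreover have "c \<nu> = 0" if "\<nu> \<notin> M" for \<nu>
    unfolding c_def using N(3) that by (intro sum.neutral) (auto simp: M_def)
  ultimately show ?thesis by (intro exI[of _ M] exI[of _ c]) simp
qed

section \<open>Legendre expansions of continuous functions with values in a Hilbert space\<close>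

definition fourier_legendre ::
  "((nat \<Rightarrow> real) \<Rightarrow> 'v::{banach, second_countable_topology}) \<Rightarrow> (nat \<Rightarrow> nat) \<Rightarrow> 'v" where
  "fourier_legendre u \<nu> = (\<integral>y. legendre_multi \<nu> y *\<^sub>R u y \<partial>param_measure)"

lemma measurable_legendre_sum:
  fixes c :: "(nat \<Rightarrow> nat) \<Rightarrow> 'v::{real_normed_vector, second_countable_topology}"
  shows "(\<lambda>y. \<Sum>\<nu>\<in>N. legendre_multi \<nu> y *\<^sub>R c \<nu>) \<in> borel_measurable param_measure"
  by (intro borel_measurable_sum borel_measurable_scaleR legendre_multi_borel_measurable borel_measurable_const)

lemma continuous_imp_measurable_param:
  fixes u :: "(nat \<Rightarrow> real) \<Rightarrow> 'v::{real_normed_vector, second_countable_topology}"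
  assumes "continuous_on param_domain u"
  shows "u \<in> borel_measurable param_measure"
proof -
  have "\<forall>n. \<exists>s. s \<in> borel_measurable param_measure \<and> (\<forall>y\<in>param_domain. norm (u y - s y) < inverse (real (Suc n)))"
  proof
    fix n
    have "inverse (real (Suc n)) > 0" by simp
    from legendre_approximation[OF assms this] obtain N c where
      *: "\<forall>y\<in>param_domain. norm (u y - (\<Sum>\<nu>\<in>N. legendre_multi \<nu> y *\<^sub>R c \<nu>)) < inverse (real (Suc n))"
      by (elim exE conjE)
    show "\<exists>s. s \<in> borel_measurable param_measure \<and> (\<forall>y\<in>param_domain. norm (u y - s y) < inverse (real (Suc n)))"
      by (rule exI, rule conjI[OF measurable_legendre_sum *])
  qed
  from choice[OF this] obtain s where
    s: "\<And>n. s n \<in> borel_measurable param_measure"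
      "\<And>n y. y \<in> param_domain \<Longrightarrow> norm (u y - s n y) < inverse (real (Suc n))"
    by auto
  show ?thesis
  proof (rule borel_measurable_LIMSEQ_metric[OF s(1)])
    fix y assume "y \<in> space param_measure"
    then have "norm (s n y - u y) \<le> inverse (real (Suc n))" for n
      using s(2)[of y n] by (simp add: space_param_measure norm_minus_commute)
    then have "(\<lambda>n. s n y - u y) \<longlonglongrightarrow> 0"
      by (intro Lim_null_comparison[OF _ LIMSEQ_inverse_real_of_nat] always_eventually allI)
    then show "(\<lambda>n. s n y) \<longlonglongrightarrow> u y" by (simp add: LIM_zero_iff)
  qed
qed

lemma continuous_imp_bounded_param:
  fixes u :: "(nat \<Rightarrow> real) \<Rightarrow> 'v::real_normed_vector"
  assumes "continuous_on param_domain u"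
  obtains B where "B > 0" "\<And>y. y \<in> param_domain \<Longrightarrow> norm (u y) \<le> B"
proof -
  have "bounded (u ` param_domain)"
    by (intro compact_imp_bounded compact_continuous_image assms compact_param_domain)
  then show ?thesis using that unfolding bounded_pos by auto
qed

lemma continuous_imp_integrable_param:
  fixes u :: "(nat \<Rightarrow> real) \<Rightarrow> 'v::{banach, second_countable_topology}"
  assumes "continuous_on param_domain u"
  shows "integrable param_measure u"
proof -
  obtain B where "\<And>y. y \<in> param_domain \<Longrightarrow> norm (u y) \<le> B"
    using continuous_imp_bounded_param[OF assms] by blast
  then show ?thesis
    by (intro param_measure.integrable_const_bound[of _ B] AE_I2 continuous_imp_measurable_param assms)
      (simp add: space_param_measure)
qed

lemma continuous_on_legendre_sum:
  fixes c :: "(nat \<Rightarrow> nat) \<Rightarrow> 'v::real_normed_vector"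
  shows "continuous_on S (\<lambda>y. \<Sum>\<nu>\<in>N. legendre_multi \<nu> y *\<^sub>R c \<nu>)"
  by (intro continuous_intros continuous_on_legendre_multi)

lemma integrable_legendre_scaleR:
  fixes u :: "(nat \<Rightarrow> real) \<Rightarrow> 'v::{banach, second_countable_topology}"
  assumes "continuous_on param_domain u"
  shows "integrable param_measure (\<lambda>y. legendre_multi \<nu> y *\<^sub>R u y)"
  by (intro continuous_imp_integrable_param continuous_intros continuous_on_legendre_multi assms)

text \<open>
  By orthonormality, the mean square distance from \<open>u\<close> to a Legendre sum is a sum of squares that
  is minimal when the coefficients are those of \<open>u\<close>.
\<close>

lemma mean_square_distance_legendre_sum:
  fixes u :: "(nat \<Rightarrow> real) \<Rightarrow> 'v::{real_inner, banach, second_countable_topology}"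
  assumes u: "continuous_on param_domain u" and N: "finite N" "N \<subseteq> multi_indices"
  shows "(\<integral>y. (norm (u y - (\<Sum>\<nu>\<in>N. legendre_multi \<nu> y *\<^sub>R c \<nu>)))\<^sup>2 \<partial>param_measure) =
    (\<integral>y. (norm (u y))\<^sup>2 \<partial>param_measure) - (\<Sum>\<nu>\<in>N. (norm (fourier_legendre u \<nu>))\<^sup>2)
      + (\<Sum>\<nu>\<in>N. (norm (fourier_legendre u \<nu> - c \<nu>))\<^sup>2)"
proof -
  let ?w = "fourier_legendre u"
  have int_u: "integrable param_measure (\<lambda>y. (norm (u y))\<^sup>2)"
    by (intro continuous_imp_integrable_param continuous_intros u)
  have int_w: "integrable param_measure (\<lambda>y. (legendre_multi \<nu> y *\<^sub>R u y) \<bullet> c \<nu>)" for \<nu>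
    by (intro integrable_inner_left integrable_legendre_scaleR u)
  have w: "(\<integral>y. (legendre_multi \<nu> y *\<^sub>R u y) \<bullet> c \<nu> \<partial>param_measure) = ?w \<nu> \<bullet> c \<nu>" for \<nu>
    unfolding fourier_legendre_def by (rule integral_inner_left) (intro integrable_legendre_scaleR u)
  have int_L: "integrable param_measure (\<lambda>y. legendre_multi \<nu> y * legendre_multi \<mu> y * (c \<nu> \<bullet> c \<mu>))"
    if "\<nu> \<in> N" "\<mu> \<in> N" for \<nu> \<mu>
    by (intro integrable_mult_left legendre_multi_orthonormal(1)) (use N that in auto)
  have L: "(\<integral>y. legendre_multi \<nu> y * legendre_multi \<mu> y * (c \<nu> \<bullet> c \<mu>) \<partial>param_measure) =
      (if \<nu> = \<mu> then c \<nu> \<bullet> c \<nu> else 0)" if "\<nu> \<in> N" "\<mu> \<in> N" for \<nu> \<mu>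
    using legendre_multi_orthonormal(2)[of \<nu> \<mu>] N that by (auto simp: subset_eq)
  have expand: "(norm (u y - (\<Sum>\<nu>\<in>N. legendre_multi \<nu> y *\<^sub>R c \<nu>)))\<^sup>2 =
      (norm (u y))\<^sup>2 - 2 * (\<Sum>\<nu>\<in>N. (legendre_multi \<nu> y *\<^sub>R u y) \<bullet> c \<nu>)
        + (\<Sum>\<nu>\<in>N. \<Sum>\<mu>\<in>N. legendre_multi \<nu> y * legendre_multi \<mu> y * (c \<nu> \<bullet> c \<mu>))" for y
  proof -
    let ?S = "\<Sum>\<nu>\<in>N. legendre_multi \<nu> y *\<^sub>R c \<nu>"
    have "(norm (u y - ?S))\<^sup>2 = (norm (u y))\<^sup>2 - 2 * (u y \<bullet> ?S) + ?S \<bullet> ?S"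
      by (simp add: power2_norm_eq_inner inner_diff_left inner_diff_right inner_commute)
    moreover have "u y \<bullet> ?S = (\<Sum>\<nu>\<in>N. (legendre_multi \<nu> y *\<^sub>R u y) \<bullet> c \<nu>)"
      by (simp add: inner_sum_right)
    moreover have "?S \<bullet> ?S = (\<Sum>\<nu>\<in>N. \<Sum>\<mu>\<in>N. legendre_multi \<nu> y * legendre_multi \<mu> y * (c \<nu> \<bullet> c \<mu>))"
      unfolding inner_sum_left unfolding inner_sum_right by (simp add: ac_simps)
    ultimately show ?thesis by simp
  qed
  have "(\<integral>y. (norm (u y - (\<Sum>\<nu>\<in>N. legendre_multi \<nu> y *\<^sub>R c \<nu>)))\<^sup>2 \<partial>param_measure) =
      (\<integral>y. (norm (u y))\<^sup>2 \<partial>param_measure) - 2 * (\<Sum>\<nu>\<in>N. ?w \<nu> \<bullet> c \<nu>)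
        + (\<Sum>\<nu>\<in>N. \<Sum>\<mu>\<in>N. (if \<nu> = \<mu> then c \<nu> \<bullet> c \<nu> else 0))"
  proof -
    have i1: "integrable param_measure (\<lambda>y. \<Sum>\<nu>\<in>N. (legendre_multi \<nu> y *\<^sub>R u y) \<bullet> c \<nu>)"
      by (intro Bochner_Integration.integrable_sum int_w)
    have i2: "integrable param_measure (\<lambda>y. \<Sum>\<nu>\<in>N. \<Sum>\<mu>\<in>N. legendre_multi \<nu> y * legendre_multi \<mu> y * (c \<nu> \<bullet> c \<mu>))"
      by (intro Bochner_Integration.integrable_sum int_L)
    have "(\<integral>y. (\<Sum>\<nu>\<in>N. (legendre_multi \<nu> y *\<^sub>R u y) \<bullet> c \<nu>) \<partial>param_measure) = (\<Sum>\<nu>\<in>N. ?w \<nu> \<bullet> c \<nu>)"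
      unfolding w[symmetric] by (intro Bochner_Integration.integral_sum int_w)
    moreover have "(\<integral>y. (\<Sum>\<nu>\<in>N. \<Sum>\<mu>\<in>N. legendre_multi \<nu> y * legendre_multi \<mu> y * (c \<nu> \<bullet> c \<mu>)) \<partial>param_measure) =
        (\<Sum>\<nu>\<in>N. \<integral>y. (\<Sum>\<mu>\<in>N. legendre_multi \<nu> y * legendre_multi \<mu> y * (c \<nu> \<bullet> c \<mu>)) \<partial>param_measure)"
      by (intro Bochner_Integration.integral_sum Bochner_Integration.integrable_sum int_L)
    moreover have "(\<integral>y. (\<Sum>\<mu>\<in>N. legendre_multi \<nu> y * legendre_multi \<mu> y * (c \<nu> \<bullet> c \<mu>)) \<partial>param_measure) =
        (\<Sum>\<mu>\<in>N. if \<nu> = \<mu> then c \<nu> \<bullet> c \<nu> else 0)" if "\<nu> \<in> N" for \<nu>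
    proof -
      have "(\<integral>y. (\<Sum>\<mu>\<in>N. legendre_multi \<nu> y * legendre_multi \<mu> y * (c \<nu> \<bullet> c \<mu>)) \<partial>param_measure) =
          (\<Sum>\<mu>\<in>N. \<integral>y. legendre_multi \<nu> y * legendre_multi \<mu> y * (c \<nu> \<bullet> c \<mu>) \<partial>param_measure)"
        by (intro Bochner_Integration.integral_sum int_L that)
      also have "\<dots> = (\<Sum>\<mu>\<in>N. if \<nu> = \<mu> then c \<nu> \<bullet> c \<nu> else 0)"
        by (intro sum.cong refl L that)
      finally show ?thesis .
    qed
    ultimately show ?thesis
      unfolding expand Bochner_Integration.integral_add[OF Bochner_Integration.integrable_diff[OF int_u
            integrable_mult_right[OF i1]] i2]
        Bochner_Integration.integral_diff[OF int_u integrable_mult_right[OF i1]] integral_mult_right_zero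
      by (simp cong: sum.cong)
  qed
  also have "(\<Sum>\<nu>\<in>N. \<Sum>\<mu>\<in>N. (if \<nu> = \<mu> then c \<nu> \<bullet> c \<nu> else 0)) = (\<Sum>\<nu>\<in>N. c \<nu> \<bullet> c \<nu>)"
    using N(1) by (intro sum.cong) (simp_all add: sum.delta)
  also have "(\<Sum>\<nu>\<in>N. c \<nu> \<bullet> c \<nu>) =
      2 * (\<Sum>\<nu>\<in>N. ?w \<nu> \<bullet> c \<nu>) - (\<Sum>\<nu>\<in>N. (norm (?w \<nu>))\<^sup>2) + (\<Sum>\<nu>\<in>N. (norm (?w \<nu> - c \<nu>))\<^sup>2)"
    unfolding power2_norm_eq_inner sum_distrib_left sum_subtractf[symmetric] sum.distrib[symmetric]
    by (intro sum.cong refl) (simp add: inner_diff_left inner_diff_right inner_commute)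
  finally show ?thesis by simp
qed

lemma bessel_fourier_legendre:
  fixes u :: "(nat \<Rightarrow> real) \<Rightarrow> 'v::{real_inner, banach, second_countable_topology}"
  assumes u: "continuous_on param_domain u" and N: "finite N" "N \<subseteq> multi_indices"
  shows "(\<Sum>\<nu>\<in>N. (norm (fourier_legendre u \<nu>))\<^sup>2) \<le> (\<integral>y. (norm (u y))\<^sup>2 \<partial>param_measure)"
proof -
  have "0 \<le> (\<integral>y. (norm (u y - (\<Sum>\<nu>\<in>N. legendre_multi \<nu> y *\<^sub>R fourier_legendre u \<nu>)))\<^sup>2 \<partial>param_measure)"
    by (rule integral_nonneg_AE) simp
  then show ?thesis
    unfolding mean_square_distance_legendre_sum[OF assms] by simp
qed

lemma mean_square_le:
  fixes g :: "(nat \<Rightarrow> real) \<Rightarrow> 'v::{banach, second_countable_topology}"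
  assumes g: "continuous_on param_domain g" and B: "\<And>y. y \<in> param_domain \<Longrightarrow> norm (g y) \<le> B"
  shows "(\<integral>y. (norm (g y))\<^sup>2 \<partial>param_measure) \<le> B\<^sup>2"
proof -
  have "(\<integral>y. (norm (g y))\<^sup>2 \<partial>param_measure) \<le> (\<integral>y. B\<^sup>2 \<partial>param_measure)"
    using B by (intro integral_mono continuous_imp_integrable_param continuous_intros g power_mono)
      (auto simp: space_param_measure)
  then show ?thesis by (simp add: param_measure.prob_space)
qed

text \<open>
  The mean square distance is at most the uniform distance, and the Legendre sum with the
  coefficients of \<open>u\<close> is at least as close to \<open>u\<close> as any other one with the same indices.
\<close>

lemma parseval_fourier_legendre:
  fixes u :: "(nat \<Rightarrow> real) \<Rightarrow> 'v::{real_inner, banach, second_countable_topology}"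
  assumes u: "continuous_on param_domain u" and "\<epsilon> > 0"
  obtains N where "finite N" "N \<subseteq> multi_indices"
    "(\<integral>y. (norm (u y))\<^sup>2 \<partial>param_measure) \<le> (\<Sum>\<nu>\<in>N. (norm (fourier_legendre u \<nu>))\<^sup>2) + \<epsilon>"
proof -
  have "sqrt \<epsilon> > 0" using \<open>\<epsilon> > 0\<close> by simp
  from legendre_approximation[OF u this] obtain N c where
    "finite N \<and> N \<subseteq> multi_indices \<and> (\<forall>\<nu>. c \<nu> \<in> span (u ` param_domain)) \<and>
      (\<forall>\<nu>. \<nu> \<notin> N \<longrightarrow> c \<nu> = 0) \<and>
      (\<forall>y\<in>param_domain. norm (u y - (\<Sum>\<nu>\<in>N. legendre_multi \<nu> y *\<^sub>R c \<nu>)) < sqrt \<epsilon>)"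
    by (elim exE)
  then have N: "finite N" "N \<subseteq> multi_indices"
    and c: "\<And>y. y \<in> param_domain \<Longrightarrow> norm (u y - (\<Sum>\<nu>\<in>N. legendre_multi \<nu> y *\<^sub>R c \<nu>)) < sqrt \<epsilon>"
    by simp_all
  have "(\<integral>y. (norm (u y - (\<Sum>\<nu>\<in>N. legendre_multi \<nu> y *\<^sub>R c \<nu>)))\<^sup>2 \<partial>param_measure) \<le> (sqrt \<epsilon>)\<^sup>2"
    using c by (intro mean_square_le continuous_intros u continuous_on_legendre_sum) (auto intro: less_imp_le)
  moreover have "(\<Sum>\<nu>\<in>N. (norm (fourier_legendre u \<nu> - c \<nu>))\<^sup>2) \<ge> 0"
    by (intro sum_nonneg) simp
  ultimately have "(\<integral>y. (norm (u y))\<^sup>2 \<partial>param_measure) \<le> (\<Sum>\<nu>\<in>N. (norm (fourier_legendre u \<nu>))\<^sup>2) + \<epsilon>"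
    using \<open>\<epsilon> > 0\<close> unfolding mean_square_distance_legendre_sum[OF u N] by simp
  with N that show ?thesis by blast
qed

text \<open>
  For a function with values in a closed subspace, this places the coefficients in the same subspace.
\<close>

lemma fourier_legendre_in_closure_span:
  fixes u :: "(nat \<Rightarrow> real) \<Rightarrow> 'v::{real_inner, banach, second_countable_topology}"
  assumes u: "continuous_on param_domain u" and \<nu>: "\<nu> \<in> multi_indices"
  shows "fourier_legendre u \<nu> \<in> closure (span (u ` param_domain))"
  unfolding closure_approachable
proof (intro allI impI)
  fix \<epsilon> :: real assume \<epsilon>: "\<epsilon> > 0"
  then have "\<epsilon> / 2 > 0" by simp
  from legendre_approximation[OF u this] obtain N c where
    "finite N \<and> N \<subseteq> multi_indices \<and> (\<forall>\<nu>. c \<nu> \<in> span (u ` param_domain)) \<and>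
      (\<forall>\<nu>. \<nu> \<notin> N \<longrightarrow> c \<nu> = 0) \<and>
      (\<forall>y\<in>param_domain. norm (u y - (\<Sum>\<nu>\<in>N. legendre_multi \<nu> y *\<^sub>R c \<nu>)) < \<epsilon> / 2)"
    by (elim exE)
  then have N: "finite N" "N \<subseteq> multi_indices" "\<And>\<nu>. c \<nu> \<in> span (u ` param_domain)" "\<And>\<nu>. \<nu> \<notin> N \<Longrightarrow> c \<nu> = 0"
    and c: "\<And>y. y \<in> param_domain \<Longrightarrow> norm (u y - (\<Sum>\<nu>\<in>N. legendre_multi \<nu> y *\<^sub>R c \<nu>)) < \<epsilon> / 2"
    by simp_all
  define M where "M = insert \<nu> N"
  have M: "finite M" "M \<subseteq> multi_indices" using N \<nu> by (auto simp: M_def)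
  have "(\<Sum>\<nu>\<in>M. legendre_multi \<nu> y *\<^sub>R c \<nu>) = (\<Sum>\<nu>\<in>N. legendre_multi \<nu> y *\<^sub>R c \<nu>)" for y
    using N by (intro sum.mono_neutral_right) (auto simp: M_def)
  then have "(\<integral>y. (norm (u y - (\<Sum>\<nu>\<in>M. legendre_multi \<nu> y *\<^sub>R c \<nu>)))\<^sup>2 \<partial>param_measure) \<le> (\<epsilon> / 2)\<^sup>2"
    using c by (intro mean_square_le continuous_intros u continuous_on_legendre_sum) (auto intro: less_imp_le)
  moreover have "(\<Sum>\<nu>\<in>M. (norm (fourier_legendre u \<nu>))\<^sup>2) \<le> (\<integral>y. (norm (u y))\<^sup>2 \<partial>param_measure)"
    by (rule bessel_fourier_legendre[OF u M])
  ultimately have "(\<Sum>\<nu>\<in>M. (norm (fourier_legendre u \<nu> - c \<nu>))\<^sup>2) \<le> (\<epsilon> / 2)\<^sup>2"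
    unfolding mean_square_distance_legendre_sum[OF u M] by simp
  moreover have "(norm (fourier_legendre u \<nu> - c \<nu>))\<^sup>2 \<le> (\<Sum>\<nu>\<in>M. (norm (fourier_legendre u \<nu> - c \<nu>))\<^sup>2)"
    using M(1) by (intro member_le_sum) (auto simp: M_def)
  ultimately have "(norm (fourier_legendre u \<nu> - c \<nu>))\<^sup>2 \<le> (\<epsilon> / 2)\<^sup>2"
    by (rule order_trans[rotated])
  then have "norm (fourier_legendre u \<nu> - c \<nu>) \<le> \<epsilon> / 2"
    by (rule power2_le_imp_le) (use \<epsilon> in simp)
  then show "\<exists>v\<in>span (u ` param_domain). dist v (fourier_legendre u \<nu>) < \<epsilon>"
    using N(3)[of \<nu>] \<epsilon> by (intro bexI[of _ "c \<nu>"]) (auto simp: dist_norm norm_minus_commute)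
qed

text \<open>
  Parseval's identity turns the error of a truncation into the square sum of the discarded coefficients.
\<close>

lemma legendre_truncation_mean_square:
  fixes u :: "(nat \<Rightarrow> real) \<Rightarrow> 'v::{real_inner, banach, second_countable_topology}"
  assumes u: "continuous_on param_domain u" and \<Lambda>: "finite \<Lambda>" "\<Lambda> \<subseteq> multi_indices"
    and tail: "\<And>X. finite X \<Longrightarrow> X \<subseteq> multi_indices - \<Lambda> \<Longrightarrow> (\<Sum>\<nu>\<in>X. (norm (fourier_legendre u \<nu>))\<^sup>2) \<le> B"
  shows "(\<integral>y. (norm (u y - (\<Sum>\<nu>\<in>\<Lambda>. legendre_multi \<nu> y *\<^sub>R fourier_legendre u \<nu>)))\<^sup>2 \<partial>param_measure) \<le> B"
proof (rule field_le_epsilon)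
  fix \<epsilon> :: real assume "\<epsilon> > 0"
  from parseval_fourier_legendre[OF u this] obtain N where N: "finite N" "N \<subseteq> multi_indices"
    "(\<integral>y. (norm (u y))\<^sup>2 \<partial>param_measure) \<le> (\<Sum>\<nu>\<in>N. (norm (fourier_legendre u \<nu>))\<^sup>2) + \<epsilon>" .
  have "(\<Sum>\<nu>\<in>N. (norm (fourier_legendre u \<nu>))\<^sup>2) \<le> (\<Sum>\<nu>\<in>\<Lambda> \<union> (N - \<Lambda>). (norm (fourier_legendre u \<nu>))\<^sup>2)"
    using N(1) \<Lambda>(1) by (intro sum_mono2) auto
  also have "\<dots> = (\<Sum>\<nu>\<in>\<Lambda>. (norm (fourier_legendre u \<nu>))\<^sup>2) + (\<Sum>\<nu>\<in>N - \<Lambda>. (norm (fourier_legendre u \<nu>))\<^sup>2)"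
    using N(1) \<Lambda>(1) by (intro sum.union_disjoint) auto
  also have "(\<Sum>\<nu>\<in>N - \<Lambda>. (norm (fourier_legendre u \<nu>))\<^sup>2) \<le> B"
    using N by (intro tail) auto
  finally have "(\<Sum>\<nu>\<in>N. (norm (fourier_legendre u \<nu>))\<^sup>2) \<le> (\<Sum>\<nu>\<in>\<Lambda>. (norm (fourier_legendre u \<nu>))\<^sup>2) + B"
    by simp
  then show "(\<integral>y. (norm (u y - (\<Sum>\<nu>\<in>\<Lambda>. legendre_multi \<nu> y *\<^sub>R fourier_legendre u \<nu>)))\<^sup>2 \<partial>param_measure) \<le> B + \<epsilon>"
    using mean_square_distance_legendre_sum[OF u \<Lambda>, of "fourier_legendre u"] N(3) by simp
qed

text \<open>
  If the error exceeded the bound at one point, it would do so on a set of positive measure, by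
  continuity.  A longer Legendre sum then stays away from \<open>u\<close> on this set, whereas its mean square
  distance to \<open>u\<close> is arbitrarily small.
\<close>

lemma legendre_truncation_uniform:
  fixes u :: "(nat \<Rightarrow> real) \<Rightarrow> 'v::{real_inner, banach, second_countable_topology}"
  assumes u: "continuous_on param_domain u" and \<Lambda>: "finite \<Lambda>" "\<Lambda> \<subseteq> multi_indices"
    and tail: "\<And>X. finite X \<Longrightarrow> X \<subseteq> multi_indices - \<Lambda> \<Longrightarrow>
      (\<Sum>\<nu>\<in>X. norm (fourier_legendre u \<nu>) * beta_weight \<nu>) \<le> B"
    and y: "y \<in> param_domain"
  shows "norm (u y - (\<Sum>\<nu>\<in>\<Lambda>. legendre_multi \<nu> y *\<^sub>R fourier_legendre u \<nu>)) \<le> B"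
proof (rule ccontr)
  define e where "e M y = u y - (\<Sum>\<nu>\<in>M. legendre_multi \<nu> y *\<^sub>R fourier_legendre u \<nu>)" for M y
  have e: "continuous_on param_domain (e M)" for M
    unfolding e_def[abs_def] by (intro continuous_intros u continuous_on_legendre_sum)
  assume "\<not> ?thesis"
  then have *: "norm (e \<Lambda> y) > B" by (simp add: e_def)
  define \<delta> where "\<delta> = (norm (e \<Lambda> y) - B) / 2"
  have \<delta>: "\<delta> > 0" "B + \<delta> < norm (e \<Lambda> y)" using * by (auto simp: \<delta>_def field_simps)
  define N where "N = {z \<in> space param_measure. B + \<delta> < norm (e \<Lambda> z)}"
  have N: "N \<in> sets param_measure"
    unfolding N_def using continuous_imp_measurable_param[OF e] by measurable
  have "openin (top_of_set param_domain) (param_domain \<inter> (\<lambda>z. norm (e \<Lambda> z)) -` {B + \<delta> <..})"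
    by (intro continuous_openin_preimage_gen continuous_intros e)
  then obtain S where S: "open S" "param_domain \<inter> (\<lambda>z. norm (e \<Lambda> z)) -` {B + \<delta> <..} = param_domain \<inter> S"
    by (auto simp: openin_open)
  have "y \<in> S" using S(2) \<delta>(2) y by blast
  moreover have "S \<inter> param_domain \<subseteq> N" using S(2) by (auto simp: N_def space_param_measure)
  ultimately have pos: "measure param_measure N > 0"
    by (rule measure_open_pos[OF S(1) _ y N])
  then have "\<delta>\<^sup>2 * measure param_measure N / 2 > 0" using \<delta> by simp
  from parseval_fourier_legendre[OF u this] obtain M where M: "finite M" "M \<subseteq> multi_indices"
    "(\<integral>y. (norm (u y))\<^sup>2 \<partial>param_measure) \<le>
      (\<Sum>\<nu>\<in>M. (norm (fourier_legendre u \<nu>))\<^sup>2) + \<delta>\<^sup>2 * measure param_measure N / 2" .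
  define M' where "M' = \<Lambda> \<union> (M - \<Lambda>)"
  have M': "finite M'" "M' \<subseteq> multi_indices" using M \<Lambda> by (auto simp: M'_def)
  have "(\<Sum>\<nu>\<in>M. (norm (fourier_legendre u \<nu>))\<^sup>2) \<le> (\<Sum>\<nu>\<in>M'. (norm (fourier_legendre u \<nu>))\<^sup>2)"
    using M'(1) by (intro sum_mono2) (auto simp: M'_def)
  then have small: "(\<integral>y. (norm (e M' y))\<^sup>2 \<partial>param_measure) \<le> \<delta>\<^sup>2 * measure param_measure N / 2"
    using M(3) unfolding e_def mean_square_distance_legendre_sum[OF u M'] by simp
  have large: "\<delta> < norm (e M' z)" if z: "z \<in> N" for z
  proof -
    have zU: "z \<in> param_domain" using z by (simp add: N_def space_param_measure)
    have "e \<Lambda> z = e M' z + (\<Sum>\<nu>\<in>M - \<Lambda>. legendre_multi \<nu> z *\<^sub>R fourier_legendre u \<nu>)"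
      unfolding e_def M'_def using M(1) \<Lambda>(1) by (subst sum.union_disjoint) auto
    then have "norm (e \<Lambda> z) \<le> norm (e M' z) + norm (\<Sum>\<nu>\<in>M - \<Lambda>. legendre_multi \<nu> z *\<^sub>R fourier_legendre u \<nu>)"
      using norm_triangle_ineq by metis
    also have "norm (\<Sum>\<nu>\<in>M - \<Lambda>. legendre_multi \<nu> z *\<^sub>R fourier_legendre u \<nu>) \<le>
        (\<Sum>\<nu>\<in>M - \<Lambda>. norm (legendre_multi \<nu> z *\<^sub>R fourier_legendre u \<nu>))"
      by (rule norm_sum)
    also have "\<dots> \<le> (\<Sum>\<nu>\<in>M - \<Lambda>. norm (fourier_legendre u \<nu>) * beta_weight \<nu>)"
      using abs_legendre_multi_le[OF zU] by (intro sum_mono) (simp add: mult.commute mult_right_mono)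
    also have "\<dots> \<le> B" using M by (intro tail) auto
    finally show ?thesis using z by (simp add: N_def)
  qed
  have "\<delta>\<^sup>2 * measure param_measure N = (\<integral>z. \<delta>\<^sup>2 * indicator N z \<partial>param_measure)"
    using N by simp
  also have "\<dots> \<le> (\<integral>z. (norm (e M' z))\<^sup>2 \<partial>param_measure)"
  proof (rule integral_mono)
    show "integrable param_measure (\<lambda>z. \<delta>\<^sup>2 * indicator N z)"
      using N by (intro integrable_mult_right) (simp add: param_measure.emeasure_eq_measure)
    show "integrable param_measure (\<lambda>z. (norm (e M' z))\<^sup>2)"
      by (intro continuous_imp_integrable_param continuous_intros e)
    show "\<delta>\<^sup>2 * indicator N z \<le> (norm (e M' z))\<^sup>2" for z
      using large[of z] \<delta>(1) by (cases "z \<in> N") (auto intro!: power_mono)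
  qed
  finally show False
    using small mult_pos_pos[OF zero_less_power[OF \<delta>(1), of 2] pos] by linarith
qed

section \<open>A weighted energy estimate for systems with the Legendre coupling\<close>

text \<open>
  A Schur test for one edge of the Jacobi matrix.  The test vector is \<open>h\<^sub>n = sqrt (2 n + 1)\<close>, the
  value at \<open>1\<close> of the normalised polynomial of degree \<open>n\<close>.  By the recurrence at \<open>t = 1\<close>, it is a
  positive generalised eigenvector of the Jacobi matrix for the eigenvalue \<open>1\<close>.  The weights
  \<open>c \<le> d\<close> may grow by the factor \<open>\<rho>\<close> because \<open>c / d + d / c \<le> 2 \<rho>\<close>.
\<close>

lemma jacobi_edge_bound:
  fixes b c d \<rho> X Y :: real
  assumes young: "\<And>s. s > 0 \<Longrightarrow> \<bar>b\<bar> \<le> (s * X + Y / s) / 2"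
    and "0 < c" "c \<le> d" "d \<le> \<rho> * c" "1 \<le> \<rho>"
  shows "- (\<rho> * ((real n + 1) / (2 * real n + 1) * c\<^sup>2 * X + (real n + 1) / (2 * real n + 3) * d\<^sup>2 * Y))
    \<le> (c\<^sup>2 + d\<^sup>2) * jacobi (Suc n) * b"
proof -
  define h k where "h = sqrt (2 * real n + 1)" and "k = sqrt (2 * real n + 3)"
  have hk: "h > 0" "k > 0" "h\<^sup>2 = 2 * real n + 1" "k\<^sup>2 = 2 * real n + 3"
    by (simp_all add: h_def k_def)
  have j: "jacobi (Suc n) = (real n + 1) / (h * k)"
    by (simp add: jacobi_def h_def k_def algebra_simps)
  have cd: "0 < c" "0 < d" using assms by auto
  have "c\<^sup>2 \<le> \<rho> * (c * d)"
  proof -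
    have "c * c \<le> c * d" using assms by (intro mult_left_mono) auto
    also have "\<dots> \<le> \<rho> * (c * d)" using assms cd by simp
    finally show ?thesis by (simp add: power2_eq_square)
  qed
  moreover have "d\<^sup>2 \<le> \<rho> * (c * d)"
    using mult_right_mono[OF assms(4), of d] cd by (simp add: power2_eq_square mult.assoc)
  ultimately have sq: "c\<^sup>2 + d\<^sup>2 \<le> 2 * \<rho> * (c * d)" by simp
  \<comment> \<open>This choice weighs the two ends of the edge by \<open>h\<^bsub>n+1\<^esub> / h\<^sub>n\<close> and its inverse, after rescaling by \<open>c\<close> and \<open>d\<close>.\<close>
  define s where "s = (c * k) / (d * h)"
  have s: "s > 0" using cd hk by (simp add: s_def)
  have "(c\<^sup>2 + d\<^sup>2) * jacobi (Suc n) * \<bar>b\<bar> \<le> (2 * \<rho> * (c * d)) * jacobi (Suc n) * ((s * X + Y / s) / 2)"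
    using young[OF s] sq cd assms(5) jacobi_nonneg[of "Suc n"] by (intro mult_mono) auto
  also have "\<dots> = \<rho> * ((real n + 1) / h\<^sup>2 * c\<^sup>2 * X + (real n + 1) / k\<^sup>2 * d\<^sup>2 * Y)"
    using cd hk(1,2) by (simp add: j s_def field_simps power2_eq_square)
  finally have "(c\<^sup>2 + d\<^sup>2) * jacobi (Suc n) * \<bar>b\<bar> \<le>
      \<rho> * ((real n + 1) / (2 * real n + 1) * c\<^sup>2 * X + (real n + 1) / (2 * real n + 3) * d\<^sup>2 * Y)"
    by (simp only: hk)
  moreover have "- ((c\<^sup>2 + d\<^sup>2) * jacobi (Suc n) * \<bar>b\<bar>) \<le> (c\<^sup>2 + d\<^sup>2) * jacobi (Suc n) * b"
  proof -
    have "(c\<^sup>2 + d\<^sup>2) * jacobi (Suc n) * - \<bar>b\<bar> \<le> (c\<^sup>2 + d\<^sup>2) * jacobi (Suc n) * b"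
      using jacobi_nonneg[of "Suc n"] by (intro mult_left_mono) auto
    then show ?thesis by simp
  qed
  ultimately show ?thesis by linarith
qed

text \<open>
  Each index \<open>n\<close> belongs to two edges, whose shares \<open>n / (2 n + 1)\<close> and \<open>(n + 1) / (2 n + 1)\<close> add up
  to \<open>1\<close>.  The edge from \<open>K\<close> to \<open>K + 1\<close> leaves the segment and contributes a boundary term.
\<close>

lemma jacobi_segment_bound:
  fixes B :: "'v \<Rightarrow> 'v \<Rightarrow> real" and Q :: "'v \<Rightarrow> real" and x :: "nat \<Rightarrow> 'v" and c :: "nat \<Rightarrow> real"
  assumes young: "\<And>s a b. s > 0 \<Longrightarrow> \<bar>B a b\<bar> \<le> (s * Q a + Q b / s) / 2"
    and sym: "\<And>a b. B a b = B b a"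
    and Q: "\<And>a. 0 \<le> Q a"
    and c: "\<And>n. 0 < c n" "\<And>n. c n \<le> c (Suc n)" "\<And>n. c (Suc n) \<le> \<rho> * c n" and \<rho>: "1 \<le> \<rho>"
  shows "- (\<rho> * (\<Sum>n\<le>K. (c n)\<^sup>2 * Q (x n))) - (c K)\<^sup>2 * jacobi (Suc K) * \<bar>B (x (Suc K)) (x K)\<bar>
    \<le> (\<Sum>n\<le>K. (c n)\<^sup>2 * (jacobi (Suc n) * B (x (Suc n)) (x n) + jacobi n * B (x (n - 1)) (x n)))"
proof -
  define T where "T n = (c n)\<^sup>2 * (jacobi (Suc n) * B (x (Suc n)) (x n) + jacobi n * B (x (n - 1)) (x n))" for n
  define R where "R n = (c n)\<^sup>2 * Q (x n)" for n
  have R: "R n \<ge> 0" for n by (simp add: R_def Q)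
  have "- (\<rho> * ((\<Sum>n<K. R n) + real K / (2 * real K + 1) * R K))
      \<le> (\<Sum>n\<le>K. T n) - (c K)\<^sup>2 * jacobi (Suc K) * B (x (Suc K)) (x K)"
  proof (induction K)
    case 0
    then show ?case by (simp add: T_def)
  next
    case (Suc K)
    have edge: "- (\<rho> * ((real K + 1) / (2 * real K + 1) * R K + (real K + 1) / (2 * real K + 3) * R (Suc K)))
        \<le> ((c K)\<^sup>2 + (c (Suc K))\<^sup>2) * jacobi (Suc K) * B (x (Suc K)) (x K)"
      using jacobi_edge_bound[of "B (x (Suc K)) (x K)" "Q (x K)" "Q (x (Suc K))" "c K" "c (Suc K)" \<rho> K]
        young[of _ "x K" "x (Suc K)"] sym c \<rho> by (simp add: R_def mult.assoc)
    have split: "R K = real K / (2 * real K + 1) * R K + (real K + 1) / (2 * real K + 1) * R K"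
    proof -
      have "real K / (2 * real K + 1) + (real K + 1) / (2 * real K + 1) = 1"
        unfolding add_divide_distrib[symmetric] by simp
      from arg_cong[OF this[symmetric], of "\<lambda>t. t * R K"] show ?thesis
        by (simp only: distrib_right mult_1_left)
    qed
    have "- (\<rho> * ((\<Sum>n<Suc K. R n) + real (Suc K) / (2 * real (Suc K) + 1) * R (Suc K))) =
        - (\<rho> * ((\<Sum>n<K. R n) + real K / (2 * real K + 1) * R K))
        - \<rho> * ((real K + 1) / (2 * real K + 1) * R K + (real K + 1) / (2 * real K + 3) * R (Suc K))"
    proof -
      have "(\<Sum>n<Suc K. R n) + real (Suc K) / (2 * real (Suc K) + 1) * R (Suc K) =
         ((\<Sum>n<K. R n) + real K / (2 * real K + 1) * R K) +
         ((real K + 1) / (2 * real K + 1) * R K + (real K + 1) / (2 * real K + 3) * R (Suc K))"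
        using split by (simp add: algebra_simps)
      then show ?thesis by (simp only: distrib_left)
    qed
    also have "\<dots> \<le> (\<Sum>n\<le>K. T n) - (c K)\<^sup>2 * jacobi (Suc K) * B (x (Suc K)) (x K)
        + ((c K)\<^sup>2 + (c (Suc K))\<^sup>2) * jacobi (Suc K) * B (x (Suc K)) (x K)"
      using Suc.IH edge by linarith
    also have "\<dots> = (\<Sum>n\<le>Suc K. T n) - (c (Suc K))\<^sup>2 * jacobi (Suc (Suc K)) * B (x (Suc (Suc K))) (x (Suc K))"
      by (simp add: T_def sym[of "x K" "x (Suc K)"] algebra_simps)
    finally show ?case .
  qed
  moreover have "\<rho> * ((\<Sum>n<K. R n) + real K / (2 * real K + 1) * R K) \<le> \<rho> * (\<Sum>n\<le>K. R n)"
  proof -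
    have "real K / (2 * real K + 1) * R K \<le> 1 * R K"
      by (intro mult_right_mono R) simp
    then show ?thesis using \<rho> by (intro mult_left_mono) (auto simp: lessThan_Suc_atMost[symmetric])
  qed
  moreover have "- ((c K)\<^sup>2 * jacobi (Suc K) * \<bar>B (x (Suc K)) (x K)\<bar>) \<le> (c K)\<^sup>2 * jacobi (Suc K) * B (x (Suc K)) (x K)"
  proof -
    have "(c K)\<^sup>2 * jacobi (Suc K) * - \<bar>B (x (Suc K)) (x K)\<bar> \<le> (c K)\<^sup>2 * jacobi (Suc K) * B (x (Suc K)) (x K)"
      using jacobi_nonneg[of "Suc K"] by (intro mult_left_mono) auto
    then show ?thesis by simp
  qed
  ultimately show ?thesis
    unfolding T_def[symmetric] R_def[symmetric] by linarith
qed

definition index_box :: "nat \<Rightarrow> nat \<Rightarrow> (nat \<Rightarrow> nat) set" where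
  "index_box J K = {\<nu>. (\<forall>j<J. \<nu> j \<le> K) \<and> (\<forall>j\<ge>J. \<nu> j = 0)}"

lemma index_box_subset: "index_box J K \<subseteq> multi_indices"
proof
  fix \<nu> assume "\<nu> \<in> index_box J K"
  then have "{j. \<nu> j \<noteq> 0} \<subseteq> {..<J}" by (auto simp: index_box_def) (metis less_not_refl not_le)
  then show "\<nu> \<in> multi_indices" by (auto simp: multi_indices_def intro: finite_subset)
qed

lemma finite_index_box: "finite (index_box J K)"
proof -
  have "inj_on (\<lambda>\<nu>. restrict \<nu> {..<J}) (index_box J K)"
  proof (rule inj_onI)
    fix \<mu> \<nu> assume *: "\<mu> \<in> index_box J K" "\<nu> \<in> index_box J K" "restrict \<mu> {..<J} = restrict \<nu> {..<J}"
    show "\<mu> = \<nu>"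
    proof
      fix j show "\<mu> j = \<nu> j"
        using *(1,2) fun_cong[OF *(3), of j] by (cases "j < J") (simp_all add: index_box_def)
    qed
  qed
  moreover have "(\<lambda>\<nu>. restrict \<nu> {..<J}) ` index_box J K \<subseteq> (\<Pi>\<^sub>E j\<in>{..<J}. {..K})"
    by (auto simp: index_box_def split: if_splits)
  moreover have "finite (\<Pi>\<^sub>E j\<in>{..<J}. {..K})" by (intro finite_PiE) auto
  ultimately show ?thesis by (meson finite_imageD finite_subset)
qed

lemma index_box_upd:
  assumes "\<nu> \<in> index_box J K" "j < J" "n \<le> L" "K \<le> L"
  shows "\<nu>(j := n) \<in> index_box J L"
  using assms by (auto simp: index_box_def intro: order_trans)

lemma index_box_mono: "K \<le> L \<Longrightarrow> index_box J K \<subseteq> index_box J L"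
  by (auto simp: index_box_def intro: order_trans)

lemma sum_index_box_lines:
  assumes "j < J"
  shows "(\<Sum>\<nu>\<in>index_box J K. f \<nu>) = (\<Sum>\<mu>\<in>{\<mu>\<in>index_box J K. \<mu> j = 0}. \<Sum>n\<le>K. f (\<mu>(j := n)))"
proof -
  have "(\<Sum>\<mu>\<in>{\<mu>\<in>index_box J K. \<mu> j = 0}. \<Sum>n\<le>K. f (\<mu>(j := n))) =
      (\<Sum>(\<mu>, n)\<in>{\<mu>\<in>index_box J K. \<mu> j = 0} \<times> {..K}. f (\<mu>(j := n)))"
    by (rule sum.cartesian_product)
  also have "\<dots> = (\<Sum>\<nu>\<in>index_box J K. f \<nu>)"
  proof (rule sum.reindex_bij_witness[where i="\<lambda>\<nu>. (\<nu>(j := 0), \<nu> j)" and j="\<lambda>(\<mu>, n). \<mu>(j := n)"])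
    fix \<nu> assume "\<nu> \<in> index_box J K"
    then show "(\<nu>(j := 0), \<nu> j) \<in> {\<mu>\<in>index_box J K. \<mu> j = 0} \<times> {..K}"
      using assms index_box_upd[of \<nu> J K j 0 K] by (auto simp: index_box_def)
  next
    fix p assume "p \<in> {\<mu>\<in>index_box J K. \<mu> j = 0} \<times> {..K}"
    then show "(case p of (\<mu>, n) \<Rightarrow> \<mu>(j := n)) \<in> index_box J K"
      using assms by (auto intro: index_box_upd)
  qed (auto simp: fun_eq_iff)
  finally show ?thesis by simp
qed

text \<open>
  The weights \<open>\<rho>\<^sup>\<nu>\<close> with exponents cut off at \<open>N\<close>.  They are bounded, so that Bessel's inequality
  controls the boundary terms of large boxes.
\<close>

definition cut_weight :: "(nat \<Rightarrow> real) \<Rightarrow> nat \<Rightarrow> nat \<Rightarrow> (nat \<Rightarrow> nat) \<Rightarrow> real" where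
  "cut_weight \<rho> N J \<nu> = (\<Prod>j<J. \<rho> j ^ min (\<nu> j) N)"

lemma cut_weight_upd:
  assumes "j < J" "\<mu> j = 0"
  shows "cut_weight \<rho> N J (\<mu>(j := n)) = \<rho> j ^ min n N * cut_weight \<rho> N J \<mu>"
proof -
  have "cut_weight \<rho> N J \<nu> = \<rho> j ^ min (\<nu> j) N * (\<Prod>i\<in>{..<J} - {j}. \<rho> i ^ min (\<nu> i) N)" for \<nu>
    unfolding cut_weight_def using assms(1) by (intro prod.remove) auto
  moreover have "(\<Prod>i\<in>{..<J} - {j}. \<rho> i ^ min ((\<mu>(j := n)) i) N) = (\<Prod>i\<in>{..<J} - {j}. \<rho> i ^ min (\<mu> i) N)"
    by (intro prod.cong) auto
  ultimately show ?thesis using assms(2) by simp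
qed

text \<open>
  The equation of index \<open>\<nu>\<close>, already tested with \<open>w\<^sub>\<nu>\<close>, is multiplied by the squared weight and
  summed over a box.  Along each line of the box in direction \<open>j\<close>, the segment bound shows that the
  coupling consumes at most the part \<open>\<rho>\<^sub>j Q\<^sub>j\<close> of the coercivity of \<open>A\<close>.
\<close>

lemma weighted_energy_box:
  fixes w :: "(nat \<Rightarrow> nat) \<Rightarrow> 'v" and A :: "'v \<Rightarrow> real" and B :: "nat \<Rightarrow> 'v \<Rightarrow> 'v \<Rightarrow> real"
    and Q :: "nat \<Rightarrow> 'v \<Rightarrow> real" and G :: "'v \<Rightarrow> real"
  assumes eq: "\<And>\<nu>. \<nu> \<in> index_box J K \<Longrightarrow>
      A (w \<nu>) + (\<Sum>j<J. jacobi (Suc (\<nu> j)) * B j (w (\<nu>(j := Suc (\<nu> j)))) (w \<nu>)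
        + jacobi (\<nu> j) * B j (w (\<nu>(j := \<nu> j - 1))) (w \<nu>)) = (if \<nu> = (\<lambda>_. 0) then l else 0)"
    and coercive: "\<And>\<nu>. \<nu> \<in> index_box J K \<Longrightarrow> (\<Sum>j<J. \<rho> j * Q j (w \<nu>)) + G (w \<nu>) \<le> A (w \<nu>)"
    and young: "\<And>j s a b. s > 0 \<Longrightarrow> \<bar>B j a b\<bar> \<le> (s * Q j a + Q j b / s) / 2"
    and sym: "\<And>j a b. B j a b = B j b a"
    and Q: "\<And>j a. 0 \<le> Q j a"
    and \<rho>: "\<And>j. 1 \<le> \<rho> j"
  shows "(\<Sum>\<nu>\<in>index_box J K. (cut_weight \<rho> N J \<nu>)\<^sup>2 * G (w \<nu>)) \<le> l +
    (\<Sum>j<J. \<Sum>\<mu>\<in>{\<mu>\<in>index_box J K. \<mu> j = 0}.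
      (cut_weight \<rho> N J (\<mu>(j := K)))\<^sup>2 * jacobi (Suc K) * \<bar>B j (w (\<mu>(j := Suc K))) (w (\<mu>(j := K)))\<bar>)"
proof -
  define C where "C \<nu> = (cut_weight \<rho> N J \<nu>)\<^sup>2" for \<nu>
  define T where "T j \<nu> = jacobi (Suc (\<nu> j)) * B j (w (\<nu>(j := Suc (\<nu> j)))) (w \<nu>)
        + jacobi (\<nu> j) * B j (w (\<nu>(j := \<nu> j - 1))) (w \<nu>)" for j \<nu>
  define bd where "bd j = (\<Sum>\<mu>\<in>{\<mu>\<in>index_box J K. \<mu> j = 0}.
      C (\<mu>(j := K)) * jacobi (Suc K) * \<bar>B j (w (\<mu>(j := Suc K))) (w (\<mu>(j := K)))\<bar>)" for j
  let ?box = "index_box J K"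
  have C: "C \<nu> \<ge> 0" for \<nu> by (simp add: C_def)
  have line: "- (\<rho> j * (\<Sum>\<nu>\<in>?box. C \<nu> * Q j (w \<nu>))) - bd j \<le> (\<Sum>\<nu>\<in>?box. C \<nu> * T j \<nu>)" if j: "j < J" for j
  proof -
    have "- (\<rho> j * (\<Sum>\<nu>\<in>?box. C \<nu> * Q j (w \<nu>))) - bd j =
        (\<Sum>\<mu>\<in>{\<mu>\<in>?box. \<mu> j = 0}. - (\<rho> j * (\<Sum>n\<le>K. C (\<mu>(j := n)) * Q j (w (\<mu>(j := n)))))
          - C (\<mu>(j := K)) * jacobi (Suc K) * \<bar>B j (w (\<mu>(j := Suc K))) (w (\<mu>(j := K)))\<bar>)"
      unfolding sum_index_box_lines[OF j] bd_def by (simp add: sum_distrib_left sum_negf sum_subtractf)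
    also have "\<dots> \<le> (\<Sum>\<mu>\<in>{\<mu>\<in>?box. \<mu> j = 0}. \<Sum>n\<le>K. C (\<mu>(j := n)) * T j (\<mu>(j := n)))"
    proof (rule sum_mono)
      fix \<mu> assume \<mu>: "\<mu> \<in> {\<mu>\<in>?box. \<mu> j = 0}"
      define c where "c n = cut_weight \<rho> N J (\<mu>(j := n))" for n
      have cw: "c n = \<rho> j ^ min n N * cut_weight \<rho> N J \<mu>" for n
        unfolding c_def using \<mu> j by (intro cut_weight_upd) auto
      have pos: "0 < cut_weight \<rho> N J \<mu>"
        unfolding cut_weight_def using \<rho> by (intro prod_pos zero_less_power) (auto intro: less_le_trans[OF zero_less_one])
      have \<rho>j: "\<rho> j > 0" using \<rho>[of j] by simp
      have "- (\<rho> j * (\<Sum>n\<le>K. (c n)\<^sup>2 * Q j (w (\<mu>(j := n)))))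
          - (c K)\<^sup>2 * jacobi (Suc K) * \<bar>B j (w (\<mu>(j := Suc K))) (w (\<mu>(j := K)))\<bar>
        \<le> (\<Sum>n\<le>K. (c n)\<^sup>2 * (jacobi (Suc n) * B j (w (\<mu>(j := Suc n))) (w (\<mu>(j := n)))
            + jacobi n * B j (w (\<mu>(j := n - 1))) (w (\<mu>(j := n)))))"
      proof (rule jacobi_segment_bound[where B="B j" and x="\<lambda>n. w (\<mu>(j := n))", OF young sym Q])
        show "0 < c n" for n using pos \<rho>j by (simp add: cw)
        show "c n \<le> c (Suc n)" for n
          unfolding cw using pos \<rho> by (intro mult_right_mono power_increasing) auto
        show "c (Suc n) \<le> \<rho> j * c n" for n
        proof -
          have "\<rho> j ^ min (Suc n) N \<le> \<rho> j ^ Suc (min n N)"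
            using \<rho> by (intro power_increasing) auto
          then show ?thesis unfolding cw using pos by (simp flip: mult.assoc)
        qed
      qed (use \<rho> in auto)
      then show "- (\<rho> j * (\<Sum>n\<le>K. C (\<mu>(j := n)) * Q j (w (\<mu>(j := n)))))
          - C (\<mu>(j := K)) * jacobi (Suc K) * \<bar>B j (w (\<mu>(j := Suc K))) (w (\<mu>(j := K)))\<bar>
        \<le> (\<Sum>n\<le>K. C (\<mu>(j := n)) * T j (\<mu>(j := n)))"
        by (simp add: C_def c_def T_def)
    qed
    also have "\<dots> = (\<Sum>\<nu>\<in>?box. C \<nu> * T j \<nu>)"
      unfolding sum_index_box_lines[OF j] ..
    finally show ?thesis .
  qed
  have zero: "(\<lambda>_. 0) \<in> ?box" by (simp add: index_box_def)
  have "(\<Sum>\<nu>\<in>?box. C \<nu> * A (w \<nu>)) + (\<Sum>\<nu>\<in>?box. \<Sum>j<J. C \<nu> * T j \<nu>) =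
      (\<Sum>\<nu>\<in>?box. C \<nu> * (if \<nu> = (\<lambda>_. 0) then l else 0))"
    unfolding sum.distrib[symmetric]
    by (intro sum.cong refl) (simp add: eq[symmetric] T_def distrib_left sum_distrib_left)
  also have "\<dots> = (\<Sum>\<nu>\<in>?box. if \<nu> = (\<lambda>_. 0) then C (\<lambda>_. 0) * l else 0)"
    by (intro sum.cong) auto
  also have "\<dots> = l"
    using zero finite_index_box by (subst sum.delta) (auto simp: C_def cut_weight_def)
  also have "(\<Sum>\<nu>\<in>?box. \<Sum>j<J. C \<nu> * T j \<nu>) = (\<Sum>j<J. \<Sum>\<nu>\<in>?box. C \<nu> * T j \<nu>)"
    by (rule sum.swap)
  finally have total: "(\<Sum>\<nu>\<in>?box. C \<nu> * A (w \<nu>)) + (\<Sum>j<J. \<Sum>\<nu>\<in>?box. C \<nu> * T j \<nu>) = l" .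
  have "(\<Sum>j<J. - (\<rho> j * (\<Sum>\<nu>\<in>?box. C \<nu> * Q j (w \<nu>))) - bd j) \<le> (\<Sum>j<J. \<Sum>\<nu>\<in>?box. C \<nu> * T j \<nu>)"
    by (intro sum_mono line) simp
  moreover have "(\<Sum>j<J. \<rho> j * (\<Sum>\<nu>\<in>?box. C \<nu> * Q j (w \<nu>))) + (\<Sum>\<nu>\<in>?box. C \<nu> * G (w \<nu>)) \<le> (\<Sum>\<nu>\<in>?box. C \<nu> * A (w \<nu>))"
  proof -
    have "(\<Sum>j<J. \<rho> j * (\<Sum>\<nu>\<in>?box. C \<nu> * Q j (w \<nu>))) = (\<Sum>\<nu>\<in>?box. C \<nu> * (\<Sum>j<J. \<rho> j * Q j (w \<nu>)))"
      unfolding sum_distrib_left by (subst sum.swap) (simp add: ac_simps)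
    then have "(\<Sum>j<J. \<rho> j * (\<Sum>\<nu>\<in>?box. C \<nu> * Q j (w \<nu>))) + (\<Sum>\<nu>\<in>?box. C \<nu> * G (w \<nu>)) =
        (\<Sum>\<nu>\<in>?box. C \<nu> * ((\<Sum>j<J. \<rho> j * Q j (w \<nu>)) + G (w \<nu>)))"
      by (simp add: sum.distrib distrib_left)
    also have "\<dots> \<le> (\<Sum>\<nu>\<in>?box. C \<nu> * A (w \<nu>))"
      by (intro sum_mono mult_left_mono coercive C)
    finally show ?thesis .
  qed
  ultimately have "(\<Sum>\<nu>\<in>?box. C \<nu> * G (w \<nu>)) \<le> l + (\<Sum>j<J. bd j)"
    using total by (simp add: sum_subtractf sum_negf)
  then show ?thesis by (simp add: bd_def C_def)
qed

lemma jacobi_le_1: "jacobi n \<le> 1"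
proof (cases "n = 0")
  case False
  then have "real n \<ge> 1" by simp
  then have "sqrt (real n) * sqrt (real n) \<le> sqrt (2 * real n - 1) * sqrt (2 * real n + 1)"
    by (intro mult_mono real_sqrt_le_mono) auto
  then have "real n \<le> sqrt (2 * real n - 1) * sqrt (2 * real n + 1)"
    by simp
  moreover have "0 < sqrt (2 * real n - 1) * sqrt (2 * real n + 1)"
    using \<open>real n \<ge> 1\<close> by simp
  ultimately show ?thesis by (simp add: jacobi_def)
qed simp

text \<open>
  Bessel's inequality, the hypothesis on \<open>S\<close>, makes the square sums of \<open>w\<close> over the boxes
  converge.  The boundary terms are dominated by increments of these sums, so they vanish in the
  limit of large boxes.
\<close>

lemma weighted_energy:
  fixes w :: "(nat \<Rightarrow> nat) \<Rightarrow> 'v::real_normed_vector" and A :: "'v \<Rightarrow> real" and B :: "nat \<Rightarrow> 'v \<Rightarrow> 'v \<Rightarrow> real"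
    and Q :: "nat \<Rightarrow> 'v \<Rightarrow> real" and G :: "'v \<Rightarrow> real"
  assumes eq: "\<And>K \<nu>. \<nu> \<in> index_box J K \<Longrightarrow>
      A (w \<nu>) + (\<Sum>j<J. jacobi (Suc (\<nu> j)) * B j (w (\<nu>(j := Suc (\<nu> j)))) (w \<nu>)
        + jacobi (\<nu> j) * B j (w (\<nu>(j := \<nu> j - 1))) (w \<nu>)) = (if \<nu> = (\<lambda>_. 0) then l else 0)"
    and coercive: "\<And>K \<nu>. \<nu> \<in> index_box J K \<Longrightarrow> (\<Sum>j<J. \<rho> j * Q j (w \<nu>)) + G (w \<nu>) \<le> A (w \<nu>)"
    and young: "\<And>j s a b. s > 0 \<Longrightarrow> \<bar>B j a b\<bar> \<le> (s * Q j a + Q j b / s) / 2"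
    and sym: "\<And>j a b. B j a b = B j b a"
    and Q: "\<And>j a. 0 \<le> Q j a" and G: "\<And>a. 0 \<le> G a"
    and bounded: "\<And>j a b. j < J \<Longrightarrow> \<bar>B j a b\<bar> \<le> \<beta> * norm a * norm b"
    and bessel: "\<And>X. finite X \<Longrightarrow> X \<subseteq> multi_indices \<Longrightarrow> (\<Sum>\<nu>\<in>X. (norm (w \<nu>))\<^sup>2) \<le> S"
    and \<rho>: "\<And>j. 1 \<le> \<rho> j"
    and X: "X \<subseteq> index_box J N"
  shows "(\<Sum>\<nu>\<in>X. (\<Prod>j<J. \<rho> j ^ \<nu> j)\<^sup>2 * G (w \<nu>)) \<le> l"
proof -
  define E where "E K = (\<Sum>\<nu>\<in>index_box J K. (norm (w \<nu>))\<^sup>2)" for K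
  define W where "W = (\<Prod>j<J. \<rho> j ^ N)"
  define \<beta>' where "\<beta>' = max \<beta> 0"
  have inc: "incseq E"
    unfolding E_def by (intro incseq_SucI sum_mono2 finite_index_box index_box_mono) auto
  have "\<forall>K. E K \<le> S"
    unfolding E_def by (intro allI bessel finite_index_box index_box_subset)
  from incseq_convergent[OF inc this] obtain L where L: "E \<longlonglongrightarrow> L" by blast
  have cut: "0 \<le> cut_weight \<rho> N J \<nu>" "cut_weight \<rho> N J \<nu> \<le> W" for \<nu>
    unfolding cut_weight_def W_def using \<rho>
    by (auto intro!: prod_nonneg prod_mono power_increasing zero_le_power intro: order_trans[OF zero_le_one])
  have main: "(\<Sum>\<nu>\<in>X. (\<Prod>j<J. \<rho> j ^ \<nu> j)\<^sup>2 * G (w \<nu>)) \<le> l + real J * (W\<^sup>2 * \<beta>') * (E (Suc (Suc K)) - E K)"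
    if K: "N \<le> K" for K
  proof -
    have "(\<Sum>\<nu>\<in>X. (\<Prod>j<J. \<rho> j ^ \<nu> j)\<^sup>2 * G (w \<nu>)) = (\<Sum>\<nu>\<in>X. (cut_weight \<rho> N J \<nu>)\<^sup>2 * G (w \<nu>))"
    proof (rule sum.cong[OF refl])
      fix \<nu> assume "\<nu> \<in> X"
      then have "\<nu> j \<le> N" if "j < J" for j using X that by (auto simp: index_box_def)
      then have "(\<Prod>j<J. \<rho> j ^ \<nu> j) = cut_weight \<rho> N J \<nu>"
        unfolding cut_weight_def by (intro prod.cong) (auto simp: min_def)
      then show "(\<Prod>j<J. \<rho> j ^ \<nu> j)\<^sup>2 * G (w \<nu>) = (cut_weight \<rho> N J \<nu>)\<^sup>2 * G (w \<nu>)" by simp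
    qed
    also have "\<dots> \<le> (\<Sum>\<nu>\<in>index_box J (Suc K). (cut_weight \<rho> N J \<nu>)\<^sup>2 * G (w \<nu>))"
      using X index_box_mono[of N "Suc K" J] K G by (intro sum_mono2 finite_index_box) auto
    also have "\<dots> \<le> l + (\<Sum>j<J. \<Sum>\<mu>\<in>{\<mu>\<in>index_box J (Suc K). \<mu> j = 0}.
      (cut_weight \<rho> N J (\<mu>(j := Suc K)))\<^sup>2 * jacobi (Suc (Suc K)) *
        \<bar>B j (w (\<mu>(j := Suc (Suc K)))) (w (\<mu>(j := Suc K)))\<bar>)"
      by (rule weighted_energy_box[where A=A and Q=Q, OF eq coercive young sym Q \<rho>])
    also have "\<dots> \<le> l + (\<Sum>j<J. W\<^sup>2 * \<beta>' * (E (Suc (Suc K)) - E K))"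
    proof (intro add_left_mono sum_mono)
      fix j assume "j \<in> {..<J}"
      then have j: "j < J" by simp
      define f where "f \<nu> = (norm (w \<nu>))\<^sup>2" for \<nu>
      define M where "M K = {\<mu>\<in>index_box J K. \<mu> j = 0}" for K
      have finM: "finite (M K)" for K using finite_index_box by (simp add: M_def)
      have monoM: "M K \<subseteq> M (Suc K)" for K using index_box_mono[of K "Suc K" J] by (auto simp: M_def)
      have f0: "f \<nu> \<ge> 0" for \<nu> by (simp add: f_def)
      have "(\<Sum>\<mu>\<in>M (Suc K). (cut_weight \<rho> N J (\<mu>(j := Suc K)))\<^sup>2 * jacobi (Suc (Suc K)) *
          \<bar>B j (w (\<mu>(j := Suc (Suc K)))) (w (\<mu>(j := Suc K)))\<bar>)
        \<le> (\<Sum>\<mu>\<in>M (Suc K). (W\<^sup>2 * \<beta>') * (f (\<mu>(j := Suc (Suc K))) + f (\<mu>(j := Suc K))))"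
      proof (rule sum_mono)
        fix \<mu>
        let ?a = "w (\<mu>(j := Suc (Suc K)))" and ?b = "w (\<mu>(j := Suc K))"
        have "\<beta> * (norm ?a * norm ?b) \<le> \<beta>' * (norm ?a * norm ?b)"
          by (intro mult_right_mono) (auto simp: \<beta>'_def)
        also have "\<dots> \<le> \<beta>' * ((norm ?a)\<^sup>2 + (norm ?b)\<^sup>2)"
        proof (rule mult_left_mono)
          show "norm ?a * norm ?b \<le> (norm ?a)\<^sup>2 + (norm ?b)\<^sup>2"
            using sum_squares_bound[of "norm ?a" "norm ?b"]
              mult_nonneg_nonneg[OF norm_ge_zero[of ?a] norm_ge_zero[of ?b]] by linarith
        qed (simp add: \<beta>'_def)
        finally have Bab: "\<bar>B j ?a ?b\<bar> \<le> \<beta>' * (f (\<mu>(j := Suc (Suc K))) + f (\<mu>(j := Suc K)))"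
          using bounded[OF j, of ?a ?b] by (simp add: f_def mult.assoc)
        have "(cut_weight \<rho> N J (\<mu>(j := Suc K)))\<^sup>2 * jacobi (Suc (Suc K)) \<le> W\<^sup>2 * 1"
          using cut[of "\<mu>(j := Suc K)"] jacobi_nonneg jacobi_le_1 by (intro mult_mono power_mono) auto
        then have "(cut_weight \<rho> N J (\<mu>(j := Suc K)))\<^sup>2 * jacobi (Suc (Suc K)) * \<bar>B j ?a ?b\<bar> \<le>
            W\<^sup>2 * (\<beta>' * (f (\<mu>(j := Suc (Suc K))) + f (\<mu>(j := Suc K))))"
          using Bab by (intro mult_mono) auto
        then show "(cut_weight \<rho> N J (\<mu>(j := Suc K)))\<^sup>2 * jacobi (Suc (Suc K)) * \<bar>B j ?a ?b\<bar> \<le>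
            (W\<^sup>2 * \<beta>') * (f (\<mu>(j := Suc (Suc K))) + f (\<mu>(j := Suc K)))"
          by (simp add: mult.assoc)
      qed
      also have "\<dots> = (W\<^sup>2 * \<beta>') * (\<Sum>\<mu>\<in>M (Suc K). f (\<mu>(j := Suc (Suc K))) + f (\<mu>(j := Suc K)))"
        by (simp add: sum_distrib_left)
      also have "\<dots> \<le> (W\<^sup>2 * \<beta>') * (E (Suc (Suc K)) - E K)"
      proof (rule mult_left_mono)
        have "E K = (\<Sum>\<mu>\<in>M K. \<Sum>n\<le>K. f (\<mu>(j := n)))"
          unfolding E_def f_def M_def by (rule sum_index_box_lines[OF j])
        also have "\<dots> \<le> (\<Sum>\<mu>\<in>M (Suc K). \<Sum>n\<le>K. f (\<mu>(j := n)))"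
          by (intro sum_mono2 finM monoM sum_nonneg f0)
        finally have 1: "E K \<le> (\<Sum>\<mu>\<in>M (Suc K). \<Sum>n\<le>K. f (\<mu>(j := n)))" .
        have "(\<Sum>\<mu>\<in>M (Suc K). \<Sum>n\<le>Suc (Suc K). f (\<mu>(j := n))) \<le>
            (\<Sum>\<mu>\<in>M (Suc (Suc K)). \<Sum>n\<le>Suc (Suc K). f (\<mu>(j := n)))"
          by (intro sum_mono2 finM monoM sum_nonneg f0)
        also have "\<dots> = E (Suc (Suc K))"
          unfolding E_def f_def M_def by (rule sum_index_box_lines[OF j, symmetric])
        finally have 2: "(\<Sum>\<mu>\<in>M (Suc K). \<Sum>n\<le>Suc (Suc K). f (\<mu>(j := n))) \<le> E (Suc (Suc K))" .
        show "(\<Sum>\<mu>\<in>M (Suc K). f (\<mu>(j := Suc (Suc K))) + f (\<mu>(j := Suc K))) \<le> E (Suc (Suc K)) - E K"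
          using 1 2 by (simp add: sum.distrib)
      qed (simp add: \<beta>'_def)
      finally show "(\<Sum>\<mu>\<in>{\<mu>\<in>index_box J (Suc K). \<mu> j = 0}.
          (cut_weight \<rho> N J (\<mu>(j := Suc K)))\<^sup>2 * jacobi (Suc (Suc K)) *
          \<bar>B j (w (\<mu>(j := Suc (Suc K)))) (w (\<mu>(j := Suc K)))\<bar>) \<le> W\<^sup>2 * \<beta>' * (E (Suc (Suc K)) - E K)"
        by (simp only: M_def)
    qed
    finally show ?thesis by (simp add: mult.assoc)
  qed
  have "(\<lambda>K. E (Suc (Suc K)) - E K) \<longlonglongrightarrow> L - L"
    by (intro tendsto_diff L LIMSEQ_Suc)
  then have "(\<lambda>K. l + real J * (W\<^sup>2 * \<beta>') * (E (Suc (Suc K)) - E K)) \<longlonglongrightarrow> l + real J * (W\<^sup>2 * \<beta>') * (L - L)"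
    by (rule tendsto_add[OF tendsto_const tendsto_mult[OF tendsto_const]])
  then have "(\<lambda>K. l + real J * (W\<^sup>2 * \<beta>') * (E (Suc (Suc K)) - E K)) \<longlonglongrightarrow> l" by simp
  then show ?thesis
    by (rule LIMSEQ_le_const) (use main in blast)
qed

section \<open>Summability of monotone majorants and best approximation rates\<close>

lemma sum_prod_index_box:
  "(\<Sum>\<nu>\<in>index_box N K. \<Prod>j<N. H j (\<nu> j)) = (\<Prod>j<N. \<Sum>k\<le>K. H j k)"
  for H :: "nat \<Rightarrow> nat \<Rightarrow> real"
proof (induction N)
  case 0
  have "index_box 0 K = {\<lambda>_. 0}" by (auto simp: index_box_def)
  then show ?case by simp
next
  case (Suc N)
  have M: "{\<mu>\<in>index_box (Suc N) K. \<mu> N = 0} = index_box N K"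
  proof (intro set_eqI iffI)
    fix \<mu> assume "\<mu> \<in> {\<mu>\<in>index_box (Suc N) K. \<mu> N = 0}"
    then have "\<forall>j<N. \<mu> j \<le> K" and "\<mu> j = 0" if "j \<ge> N" for j
      using that by (cases "j = N"; simp add: index_box_def)+
    then show "\<mu> \<in> index_box N K" by (auto simp: index_box_def)
  qed (auto simp: index_box_def less_Suc_eq)
  have "(\<Sum>\<nu>\<in>index_box (Suc N) K. \<Prod>j<Suc N. H j (\<nu> j)) =
      (\<Sum>\<mu>\<in>index_box N K. \<Sum>n\<le>K. (\<Prod>j<N. H j (\<mu> j)) * H N n)"
    unfolding sum_index_box_lines[of N "Suc N", OF lessI] M
  proof (intro sum.cong refl)
    fix \<mu> n
    have "(\<Prod>j<N. H j ((\<mu>(N := n)) j)) = (\<Prod>j<N. H j (\<mu> j))"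
      by (intro prod.cong) auto
    then show "(\<Prod>j<Suc N. H j ((\<mu>(N := n)) j)) = (\<Prod>j<N. H j (\<mu> j)) * H N n"
      by (simp only: prod.lessThan_Suc) simp
  qed
  also have "\<dots> = (\<Prod>j<Suc N. \<Sum>k\<le>K. H j k)"
    by (simp add: sum_distrib_left[symmetric] sum_distrib_right[symmetric] Suc.IH)
  finally show ?case .
qed

lemma finite_subset_index_box:
  assumes "finite X" "X \<subseteq> multi_indices"
  obtains N K where "N0 \<le> N" "X \<subseteq> index_box N K"
proof -
  define F where "F = (\<Union>\<nu>\<in>X. {j. \<nu> j \<noteq> 0})"
  have F: "finite F" using assms by (auto simp: F_def multi_indices_def)
  define K where "K = (\<Sum>\<nu>\<in>X. \<Sum>j\<in>F. \<nu> j)"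
  define N where "N = N0 + Suc (\<Sum>j\<in>F. j)"
  have "\<nu> \<in> index_box N K" if \<nu>: "\<nu> \<in> X" for \<nu>
  proof -
    have "\<nu> j \<le> K" for j
    proof (cases "j \<in> F")
      case True
      have "\<nu> j \<le> (\<Sum>j\<in>F. \<nu> j)" using F True by (intro member_le_sum) auto
      also have "\<dots> \<le> K" unfolding K_def
        using assms(1) \<nu> by (intro member_le_sum[of \<nu> X "\<lambda>\<nu>. \<Sum>j\<in>F. \<nu> j"]) auto
      finally show ?thesis .
    next
      case False
      then show ?thesis using \<nu> by (auto simp: F_def)
    qed
    moreover have "\<nu> j = 0" if "j \<ge> N" for j
    proof (rule ccontr)
      assume "\<nu> j \<noteq> 0"
      then have "j \<in> F" using \<nu> by (auto simp: F_def)
      then have "j \<le> (\<Sum>j\<in>F. j)" using F by (intro member_le_sum) auto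
      then show False using that by (simp add: N_def)
    qed
    ultimately show ?thesis by (simp add: index_box_def)
  qed
  then show ?thesis by (intro that[of N K]) (auto simp: N_def)
qed

text \<open>
  Over a box, the sum of a product of univariate factors is the product of their sums, and
  \<open>1 + s \<le> exp s\<close>.
\<close>

lemma sum_prod_multi_indices_bound:
  fixes H :: "nat \<Rightarrow> nat \<Rightarrow> real" and s :: "nat \<Rightarrow> real"
  assumes H: "\<And>j k. 0 \<le> H j k" and s: "\<And>j K. (\<Sum>k\<le>K. H j k) \<le> 1 + s j"
    and s0: "\<And>j. 0 \<le> s j" "summable s" and X: "X \<subseteq> index_box N K"
  shows "(\<Sum>\<nu>\<in>X. \<Prod>j<N. H j (\<nu> j)) \<le> exp (suminf s)"
proof -
  have "(\<Sum>\<nu>\<in>X. \<Prod>j<N. H j (\<nu> j)) \<le> (\<Sum>\<nu>\<in>index_box N K. \<Prod>j<N. H j (\<nu> j))"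
    using X by (intro sum_mono2 finite_index_box prod_nonneg H) auto
  also have "\<dots> = (\<Prod>j<N. \<Sum>k\<le>K. H j k)"
    by (rule sum_prod_index_box)
  also have "\<dots> \<le> (\<Prod>j<N. exp (s j))"
  proof (intro prod_mono conjI)
    fix j
    show "(\<Sum>k\<le>K. H j k) \<le> exp (s j)" by (rule order_trans[OF s exp_ge_add_one_self])
  qed (intro sum_nonneg H)
  also have "\<dots> = exp (\<Sum>j<N. s j)" by (simp add: exp_sum)
  also have "\<dots> \<le> exp (suminf s)" using s0 by (simp add: sum_le_suminf)
  finally show ?thesis .
qed

text \<open>
  The univariate factors \<open>b\<^sup>k (1 + 2 k)\<close> decrease in \<open>k\<close> as soon as \<open>b \<le> 1/3\<close>.  In this case they
  are their own monotone majorant, with a sum \<open>1 + O(b\<^sup>q)\<close> of \<open>q\<close>-th powers.  Only finitely many factors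
  are not of this kind; for these any geometric majorant will do.
\<close>

definition legendre_factor :: "real \<Rightarrow> nat \<Rightarrow> real" where
  "legendre_factor b k = b ^ k * (1 + 2 * real k)"

lemma legendre_factor_Suc_le:
  assumes "0 \<le> b" "b \<le> 1 / 3"
  shows "legendre_factor b (Suc k) \<le> legendre_factor b k"
proof -
  have "b * (3 + 2 * real k) \<le> 1 / 3 * (3 + 2 * real k)"
    using assms by (intro mult_right_mono) auto
  also have "\<dots> \<le> 1 + 2 * real k" by simp
  finally have "b ^ k * (b * (3 + 2 * real k)) \<le> b ^ k * (1 + 2 * real k)"
    using assms by (intro mult_left_mono) auto
  then show ?thesis by (simp add: legendre_factor_def algebra_simps)
qed

lemma legendre_factor_Suc_bound:
  assumes "0 \<le> b" "b \<le> 1 / 3"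
  shows "legendre_factor b (Suc k) \<le> 3 * b * (5 / 9) ^ k"
proof (induction k)
  case (Suc k)
  have "b * (5 + 2 * real k) \<le> 5 / 9 * (3 + 2 * real k)"
  proof -
    have "b * (5 + 2 * real k) \<le> 1 / 3 * (5 + 2 * real k)"
      using assms by (intro mult_right_mono) auto
    also have "\<dots> \<le> 5 / 9 * (3 + 2 * real k)" by simp
    finally show ?thesis .
  qed
  then have "b ^ Suc k * (b * (5 + 2 * real k)) \<le> b ^ Suc k * (5 / 9 * (3 + 2 * real k))"
    using assms by (intro mult_left_mono) auto
  then have "legendre_factor b (Suc (Suc k)) \<le> 5 / 9 * legendre_factor b (Suc k)"
    by (simp add: legendre_factor_def algebra_simps)
  with Suc.IH show ?case by simp
qed (simp add: legendre_factor_def)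

lemma legendre_factor_geometric_bound:
  assumes "0 < b" "b < 1"
  obtains M \<tau> where "1 \<le> M" "0 < \<tau>" "\<tau> < 1" "\<And>k. legendre_factor b k \<le> M * \<tau> ^ k"
proof -
  define \<tau> where "\<tau> = sqrt b"
  have \<tau>: "0 < \<tau>" "\<tau> < 1" "b = \<tau> * \<tau>" using assms by (auto simp: \<tau>_def)
  have "summable (\<lambda>k. real k * \<tau> ^ k)"
  proof -
    have "summable (\<lambda>k. diffs (\<lambda>_. 1) k * \<tau> ^ k)"
      using \<tau> by (intro termdiff_converges[of \<tau> 1]) (auto intro: summable_geometric)
    then have "summable (\<lambda>k. real (Suc k) * \<tau> ^ k - \<tau> ^ k)"
      using \<tau> by (intro summable_diff summable_geometric) (auto simp: diffs_def)
    then show ?thesis by (simp add: algebra_simps)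
  qed
  then have "Bseq (\<lambda>k. real k * \<tau> ^ k)"
    by (intro convergent_imp_Bseq convergentI[OF summable_LIMSEQ_zero])
  then obtain B where B: "B > 0" "\<And>k. norm (real k * \<tau> ^ k) \<le> B" by (auto simp: Bseq_def)
  have "legendre_factor b k \<le> (1 + 2 * B) * \<tau> ^ k" for k
  proof -
    have "(1 + 2 * real k) * \<tau> ^ k \<le> 1 + 2 * B"
    proof -
      have "\<tau> ^ k \<le> 1" using \<tau> by (intro power_le_one) auto
      moreover have "real k * \<tau> ^ k \<le> B" using B(2)[of k] by (simp add: abs_le_iff)
      ultimately show ?thesis by (simp add: algebra_simps)
    qed
    then have "(1 + 2 * real k) * \<tau> ^ k * \<tau> ^ k \<le> (1 + 2 * B) * \<tau> ^ k"
      using \<tau> by (intro mult_right_mono) auto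
    then show ?thesis by (simp add: legendre_factor_def \<tau>(3) power_mult_distrib mult_ac)
  qed
  with B \<tau> that[of "1 + 2 * B" \<tau>] show ?thesis by simp
qed

lemma multi_power_beta_weight:
  assumes "finite J" "{j. \<nu> j \<noteq> 0} \<subseteq> J"
  shows "multi_power b \<nu> * (beta_weight \<nu>)\<^sup>2 = (\<Prod>j\<in>J. legendre_factor (b j) (\<nu> j))"
proof -
  have "(beta_weight \<nu>)\<^sup>2 = (\<Prod>j | \<nu> j \<noteq> 0. 1 + 2 * real (\<nu> j))"
    unfolding beta_weight_def prod_power_distrib by (intro prod.cong) auto
  then have "multi_power b \<nu> * (beta_weight \<nu>)\<^sup>2 = (\<Prod>j | \<nu> j \<noteq> 0. legendre_factor (b j) (\<nu> j))"
    by (simp add: multi_power_def legendre_factor_def prod.distrib)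
  also have "\<dots> = (\<Prod>j\<in>J. legendre_factor (b j) (\<nu> j))"
    by (rule prod.mono_neutral_left) (use assms in \<open>auto simp: legendre_factor_def\<close>)
  finally show ?thesis .
qed

text \<open>
  A product of decreasing univariate majorants decreases in the multi-index and hence dominates the
  monotone majorant.  Only the finitely many factors with \<open>b\<^sub>j > 1/3\<close> need to be enlarged.
\<close>

lemma monotone_majorant_summable:
  fixes b :: "nat \<Rightarrow> real"
  assumes b: "\<And>j. 0 < b j" "\<And>j. b j < 1" and q: "0 < q" and sum: "summable (\<lambda>j. b j powr q)"
    and \<kappa>: "\<And>\<nu>. \<nu> \<in> multi_indices \<Longrightarrow> 0 \<le> \<kappa> \<nu> \<and> \<kappa> \<nu> \<le> multi_power b \<nu> * (beta_weight \<nu>)\<^sup>2"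
  shows "\<And>\<nu>. \<nu> \<in> multi_indices \<Longrightarrow> \<kappa> \<nu> \<le> monotone_majorant \<kappa> \<nu>"
    and "\<exists>S. \<forall>X. finite X \<longrightarrow> X \<subseteq> multi_indices \<longrightarrow> (\<Sum>\<nu>\<in>X. monotone_majorant \<kappa> \<nu> powr q) \<le> S"
proof -
  have "(\<lambda>j. b j powr q) \<longlonglongrightarrow> 0" by (rule summable_LIMSEQ_zero[OF sum])
  then have "\<forall>\<^sub>F j in sequentially. b j powr q < (1 / 3) powr q"
    by (rule order_tendstoD) simp
  then obtain J0 where J0: "\<And>j. j \<ge> J0 \<Longrightarrow> b j powr q < (1 / 3) powr q"
    unfolding eventually_sequentially by blast
  have b3: "b j \<le> 1 / 3" if "j \<ge> J0" for j
    using J0[OF that] powr_mono2[of q "1 / 3" "b j"] q by (cases "b j \<le> 1 / 3") auto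
  have "\<forall>j. \<exists>M \<tau>. 1 \<le> M \<and> 0 < \<tau> \<and> \<tau> < 1 \<and> (\<forall>k. legendre_factor (b j) k \<le> M * \<tau> ^ k)"
  proof
    fix j
    obtain M \<tau> where "1 \<le> M" "0 < \<tau>" "\<tau> < 1" "\<And>k. legendre_factor (b j) k \<le> M * \<tau> ^ k"
      using legendre_factor_geometric_bound[OF b] by metis
    then show "\<exists>M \<tau>. 1 \<le> M \<and> 0 < \<tau> \<and> \<tau> < 1 \<and> (\<forall>k. legendre_factor (b j) k \<le> M * \<tau> ^ k)" by blast
  qed
  from choice[OF this] obtain M where
    "\<forall>j. \<exists>\<tau>. 1 \<le> M j \<and> 0 < \<tau> \<and> \<tau> < 1 \<and> (\<forall>k. legendre_factor (b j) k \<le> M j * \<tau> ^ k)" ..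
  from choice[OF this] obtain \<tau> where M: "\<And>j. 1 \<le> M j" and \<tau>: "\<And>j. 0 < \<tau> j" "\<And>j. \<tau> j < 1"
    and M\<tau>: "\<And>j k. legendre_factor (b j) k \<le> M j * \<tau> j ^ k" by blast
  define H where "H j k = (if j < J0 then M j * \<tau> j ^ k else legendre_factor (b j) k)" for j k
  have factor_pos: "legendre_factor (b j) k > 0" for j k
    using b(1)[of j] by (simp add: legendre_factor_def add_pos_nonneg)
  have H_pos: "H j k > 0" for j k
    using M[of j] \<tau>(1)[of j] factor_pos by (simp add: H_def)
  have H_ge: "legendre_factor (b j) k \<le> H j k" for j k
    using M\<tau> by (simp add: H_def)
  have H_decseq: "decseq (H j)" for j
  proof (rule decseq_SucI)
    fix k
    have "\<tau> j ^ Suc k \<le> \<tau> j ^ k" using \<tau>[of j] by (intro power_decreasing) auto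
    then show "H j (Suc k) \<le> H j k"
      using M[of j] legendre_factor_Suc_le[of "b j" k] b(1)[of j] b3[of j]
      by (simp add: H_def less_imp_le mult_left_mono)
  qed
  have H_0: "H j 0 = 1" if "j \<ge> J0" for j
    using that by (simp add: H_def legendre_factor_def)
  define P where "P \<nu> = (\<Prod>j\<in>{..<J0} \<union> {j. \<nu> j \<noteq> 0}. H j (\<nu> j))" for \<nu>
  have P_eq: "P \<nu> = (\<Prod>j<N. H j (\<nu> j))" if "J0 \<le> N" "{j. \<nu> j \<noteq> 0} \<subseteq> {..<N}" for \<nu> N
    unfolding P_def by (rule prod.mono_neutral_left) (use that H_0 in \<open>auto simp: not_less\<close>)
  have majorant: "\<kappa> \<nu>' \<le> P \<nu>"
    if \<nu>: "\<nu>' \<in> multi_indices" "\<nu> \<le> \<nu>'" for \<nu> \<nu>'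
  proof -
    have "finite {j. \<nu>' j \<noteq> 0}" using \<nu>(1) by (simp add: multi_indices_def)
    then obtain N1 where N1: "{j. \<nu>' j \<noteq> 0} \<subseteq> {..<N1}"
      using finite_nat_iff_bounded by blast
    define N where "N = max J0 N1"
    have N: "J0 \<le> N" "{j. \<nu>' j \<noteq> 0} \<subseteq> {..<N}" using N1 by (auto simp: N_def)
    have le: "\<nu> j \<le> \<nu>' j" for j using \<nu>(2) by (simp add: le_fun_def)
    have sub: "{j. \<nu> j \<noteq> 0} \<subseteq> {j. \<nu>' j \<noteq> 0}"
    proof (intro Collect_mono impI notI)
      fix j assume "\<nu> j \<noteq> 0" "\<nu>' j = 0"
      then show False using le[of j] by simp
    qed
    have "\<kappa> \<nu>' \<le> (\<Prod>j<N. legendre_factor (b j) (\<nu>' j))"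
      using \<kappa>[OF \<nu>(1)] multi_power_beta_weight[OF _ N(2)] by simp
    also have "\<dots> \<le> (\<Prod>j<N. H j (\<nu> j))"
    proof (rule prod_mono, intro conjI)
      fix j
      show "0 \<le> legendre_factor (b j) (\<nu>' j)" using factor_pos by (rule less_imp_le)
      show "legendre_factor (b j) (\<nu>' j) \<le> H j (\<nu> j)"
        by (rule order_trans[OF H_ge decseqD[OF H_decseq le]])
    qed
    also have "\<dots> = P \<nu>"
      by (rule P_eq[OF N(1) subset_trans[OF sub N(2)], symmetric])
    finally show ?thesis .
  qed
  have upper: "\<kappa> \<nu> \<le> monotone_majorant \<kappa> \<nu>" and lower: "monotone_majorant \<kappa> \<nu> \<le> P \<nu>"
    if \<nu>: "\<nu> \<in> multi_indices" for \<nu>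
  proof -
    have abs: "\<bar>\<kappa> \<nu>'\<bar> \<le> P \<nu>" if "\<nu>' \<in> multi_indices" "\<nu> \<le> \<nu>'" for \<nu>'
      using majorant[OF that] \<kappa>[OF that(1)] by simp
    then have "bdd_above ((\<lambda>\<nu>'. \<bar>\<kappa> \<nu>'\<bar>) ` {\<nu>'\<in>multi_indices. \<nu> \<le> \<nu>'})"
      by (intro bdd_aboveI[of _ "P \<nu>"]) auto
    then have "\<bar>\<kappa> \<nu>\<bar> \<le> monotone_majorant \<kappa> \<nu>"
      unfolding monotone_majorant_def by (rule cSUP_upper[rotated]) (use \<nu> in auto)
    then show "\<kappa> \<nu> \<le> monotone_majorant \<kappa> \<nu>" by simp
    show "monotone_majorant \<kappa> \<nu> \<le> P \<nu>"
      unfolding monotone_majorant_def by (rule cSUP_least) (use \<nu> abs in auto)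
  qed
  define \<theta> where "\<theta> = (5 / 9 :: real) powr q"
  have \<theta>: "0 < \<theta>" "\<theta> < 1" using powr_less_mono2[of q "5 / 9" 1] q by (auto simp: \<theta>_def)
  have \<tau>q: "0 < \<tau> j powr q" "\<tau> j powr q < 1" for j
    using powr_less_mono2[of q "\<tau> j" 1] \<tau>[of j] q by auto
  define s where "s j = (if j < J0 then M j powr q / (1 - \<tau> j powr q) else 3 powr q / (1 - \<theta>) * b j powr q)" for j
  have geo: "(\<Sum>k\<le>K. x ^ k) \<le> 1 / (1 - x)" if "0 < x" "x < 1" for x :: real and K
  proof -
    have "(\<Sum>k<Suc K. x ^ k) \<le> (\<Sum>k. x ^ k)"
      using that by (intro sum_le_suminf summable_geometric) auto
    then show ?thesis using that by (simp add: suminf_geometric lessThan_Suc_atMost)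
  qed
  have power_powr: "(x ^ k) powr q = (x powr q) ^ k" if "x > 0" for x :: real and k
    using that by (simp add: powr_powr mult.commute flip: powr_realpow)
  have s_bound: "(\<Sum>k\<le>K. H j k powr q) \<le> 1 + s j" for j K
  proof (cases "j < J0")
    case True
    have "(\<Sum>k\<le>K. H j k powr q) = M j powr q * (\<Sum>k\<le>K. (\<tau> j powr q) ^ k)"
      using True M[of j] \<tau>(1)[of j] by (simp add: H_def powr_mult power_powr sum_distrib_left)
    also have "\<dots> \<le> M j powr q * (1 / (1 - \<tau> j powr q))"
      using \<tau>q[of j] by (intro mult_left_mono geo) auto
    finally show ?thesis using True by (simp add: s_def)
  next
    case False
    then have b3j: "b j \<le> 1 / 3" by (intro b3) simp
    have "(\<Sum>k\<le>K. H j k powr q) \<le> (\<Sum>k\<le>Suc K. H j k powr q)"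
      by (intro sum_mono2) auto
    also have "\<dots> = 1 + (\<Sum>k\<le>K. legendre_factor (b j) (Suc k) powr q)"
      using False by (subst sum.atMost_Suc_shift) (simp add: H_def legendre_factor_def)
    also have "(\<Sum>k\<le>K. legendre_factor (b j) (Suc k) powr q) \<le> (\<Sum>k\<le>K. (3 * b j * (5 / 9) ^ k) powr q)"
      using q b(1)[of j] b3j factor_pos
      by (intro sum_mono powr_mono2 legendre_factor_Suc_bound) (auto intro: less_imp_le)
    also have "\<dots> = 3 powr q * b j powr q * (\<Sum>k\<le>K. \<theta> ^ k)"
      using b(1)[of j] by (simp add: powr_mult power_powr sum_distrib_left \<theta>_def)
    also have "\<dots> \<le> 3 powr q * b j powr q * (1 / (1 - \<theta>))"
      using \<theta> by (intro mult_left_mono geo) auto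
    finally show ?thesis using False by (simp add: s_def)
  qed
  have s_nonneg: "0 \<le> s j" for j
    using \<theta> \<tau>q[of j] by (simp add: s_def)
  have s_summable: "summable s"
  proof (subst summable_cong)
    show "\<forall>\<^sub>F j in sequentially. s j = 3 powr q / (1 - \<theta>) * b j powr q"
      by (rule eventually_sequentiallyI[of J0]) (simp add: s_def)
    show "summable (\<lambda>j. 3 powr q / (1 - \<theta>) * b j powr q)"
      by (intro summable_mult sum)
  qed
  have total: "(\<Sum>\<nu>\<in>X. monotone_majorant \<kappa> \<nu> powr q) \<le> exp (suminf s)"
    if X: "finite X" "X \<subseteq> multi_indices" for X
  proof -
    obtain N K where N: "J0 \<le> N" "X \<subseteq> index_box N K"
      by (rule finite_subset_index_box[OF X])
    have "(\<Sum>\<nu>\<in>X. monotone_majorant \<kappa> \<nu> powr q) \<le> (\<Sum>\<nu>\<in>X. \<Prod>j<N. H j (\<nu> j) powr q)"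
    proof (rule sum_mono)
      fix \<nu> assume "\<nu> \<in> X"
      then have "\<nu> \<in> index_box N K" and \<nu>1: "\<nu> \<in> multi_indices"
        using X N(2) by auto
      then have zero: "\<nu> j = 0" if "\<not> j < N" for j
        using that by (simp add: index_box_def)
      have \<nu>2: "{j. \<nu> j \<noteq> 0} \<subseteq> {..<N}"
      proof
        fix j assume "j \<in> {j. \<nu> j \<noteq> 0}"
        then show "j \<in> {..<N}" using zero[of j] by (cases "j < N") auto
      qed
      note \<nu> = \<nu>1 \<nu>2
      have "0 \<le> monotone_majorant \<kappa> \<nu>"
        using upper[OF \<nu>(1)] \<kappa>[OF \<nu>(1)] by simp
      then have "monotone_majorant \<kappa> \<nu> powr q \<le> P \<nu> powr q"
        using lower[OF \<nu>(1)] q by (intro powr_mono2) auto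
      also have "\<dots> = (\<Prod>j<N. H j (\<nu> j) powr q)"
        unfolding P_eq[OF N(1) \<nu>(2)] by (rule prod_powr_distrib)
      finally show "monotone_majorant \<kappa> \<nu> powr q \<le> (\<Prod>j<N. H j (\<nu> j) powr q)" .
    qed
    also have "\<dots> \<le> exp (suminf s)"
      by (rule sum_prod_multi_indices_bound[OF _ s_bound s_nonneg s_summable N(2)]) simp
    finally show ?thesis .
  qed
  show "\<kappa> \<nu> \<le> monotone_majorant \<kappa> \<nu>" if "\<nu> \<in> multi_indices" for \<nu>
    by (rule upper[OF that])
  show "\<exists>S. \<forall>X. finite X \<longrightarrow> X \<subseteq> multi_indices \<longrightarrow> (\<Sum>\<nu>\<in>X. monotone_majorant \<kappa> \<nu> powr q) \<le> S"
    using total by blast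
qed

text \<open>
  Stechkin's inequality: each of the \<open>n\<close> selected terms is at least as large as any discarded one,
  so \<open>n\<close> times the \<open>q\<close>-th power of the latter is at most the sum of all \<open>q\<close>-th powers.
\<close>

lemma n_largest_tail_max:
  fixes c :: "(nat \<Rightarrow> nat) \<Rightarrow> real"
  assumes q: "0 < q" and c: "\<And>\<nu>. \<nu> \<in> multi_indices \<Longrightarrow> 0 \<le> c \<nu>"
    and S: "\<And>X. finite X \<Longrightarrow> X \<subseteq> multi_indices \<Longrightarrow> (\<Sum>\<nu>\<in>X. c \<nu> powr q) \<le> S"
    and n: "n_largest c n \<Lambda>" "1 \<le> n" and \<mu>: "\<mu> \<in> multi_indices - \<Lambda>"
  shows "c \<mu> \<le> S powr (1 / q) * real n powr (- (1 / q))"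
proof -
  have \<Lambda>: "\<Lambda> \<subseteq> multi_indices" "finite \<Lambda>" "card \<Lambda> = n" "\<And>\<nu>. \<nu> \<in> \<Lambda> \<Longrightarrow> c \<mu> \<le> c \<nu>"
    using n(1) \<mu> by (auto simp: n_largest_def)
  have "real n * c \<mu> powr q = (\<Sum>\<nu>\<in>\<Lambda>. c \<mu> powr q)" by (simp add: \<Lambda>(3))
  also have "\<dots> \<le> (\<Sum>\<nu>\<in>\<Lambda>. c \<nu> powr q)"
    using \<Lambda>(4) c \<mu> q by (intro sum_mono powr_mono2) auto
  also have "\<dots> \<le> S" by (rule S[OF \<Lambda>(2,1)])
  finally have "c \<mu> powr q \<le> S / real n" using n(2) by (simp add: field_simps)
  then have "(c \<mu> powr q) powr (1 / q) \<le> (S / real n) powr (1 / q)"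
    using q by (intro powr_mono2) auto
  moreover have "(c \<mu> powr q) powr (1 / q) = c \<mu>"
    using c \<mu> q by (simp add: powr_powr)
  moreover have "0 \<le> S" using S[of "{}"] by simp
  ultimately show ?thesis
    using n(2) by (simp add: powr_divide powr_minus_divide)
qed

text \<open>
  The bound for the maximum is raised to the power \<open>2 - q\<close>; the remaining \<open>q\<close>-th powers are summable.
\<close>

lemma n_largest_tail_square_sum:
  fixes c :: "(nat \<Rightarrow> nat) \<Rightarrow> real"
  assumes q: "0 < q" "q < 2" and c: "\<And>\<nu>. \<nu> \<in> multi_indices \<Longrightarrow> 0 \<le> c \<nu>"
    and S: "\<And>X. finite X \<Longrightarrow> X \<subseteq> multi_indices \<Longrightarrow> (\<Sum>\<nu>\<in>X. c \<nu> powr q) \<le> S"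
    and n: "n_largest c n \<Lambda>" "1 \<le> n" and X: "finite X" "X \<subseteq> multi_indices - \<Lambda>"
  shows "(\<Sum>\<nu>\<in>X. (c \<nu>)\<^sup>2) \<le> (S powr (1 / q) * real n powr (- (1 / q - 1 / 2)))\<^sup>2"
proof -
  define m where "m = S powr (1 / q) * real n powr (- (1 / q))"
  have S0: "0 \<le> S" using S[of "{}"] by simp
  have "(\<Sum>\<nu>\<in>X. (c \<nu>)\<^sup>2) \<le> (\<Sum>\<nu>\<in>X. m powr (2 - q) * c \<nu> powr q)"
  proof (rule sum_mono)
    fix \<nu> assume \<nu>: "\<nu> \<in> X"
    then have c0: "0 \<le> c \<nu>" using X c by auto
    have "(c \<nu>)\<^sup>2 = c \<nu> powr (2 - q) * c \<nu> powr q"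
      using c0 by (cases "c \<nu> = 0") (simp_all flip: powr_add powr_numeral)
    also have "\<dots> \<le> m powr (2 - q) * c \<nu> powr q"
      using n_largest_tail_max[OF q(1) c S n, of \<nu>] \<nu> X c0 q
      by (intro mult_right_mono powr_mono2) (auto simp: m_def)
    finally show "(c \<nu>)\<^sup>2 \<le> m powr (2 - q) * c \<nu> powr q" .
  qed
  also have "\<dots> \<le> m powr (2 - q) * S"
    unfolding sum_distrib_left[symmetric] using X by (intro mult_left_mono S) auto
  also have "\<dots> = (S powr (1 / q) * real n powr (- (1 / q - 1 / 2)))\<^sup>2"
  proof (cases "S = 0")
    case False
    then have S: "S > 0" using S0 by simp
    have np: "real n > 0" using n(2) by simp
    have "m powr (2 - q) * S = S powr ((1 / q) * (2 - q) + 1) * real n powr (- (1 / q) * (2 - q))"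
      using S np by (simp add: m_def powr_mult powr_powr powr_add)
    also have "(1 / q) * (2 - q) + 1 = (1 / q) * 2" using q by (simp add: field_simps)
    also have "- (1 / q) * (2 - q) = - (1 / q - 1 / 2) * 2" using q by (simp add: field_simps)
    finally show ?thesis
      using S np by (simp only: power_mult_distrib powr_powr[symmetric]) (simp flip: powr_numeral)
  qed simp
  finally show ?thesis .
qed

section \<open>Weighted \<open>L\<^sup>2\<close> forms on a subset\<close>

lemma rep_L2_add: "AE x in lebesgue. rep_L2 (h + k) x = rep_L2 h x + rep_L2 k x"
proof -
  have "h + k = to_L2 (\<lambda>x. rep_L2 h x + rep_L2 k x)"
    using to_L2_add[OF square_integrable_rep_L2[of h] square_integrable_rep_L2[of k]] by (simp add: to_L2_rep_L2)
  then show ?thesis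
    using rep_L2_to_L2[OF square_integrable_add[OF square_integrable_rep_L2[of h] square_integrable_rep_L2[of k]]]
    by simp
qed

lemma rep_L2_scaleR: "AE x in lebesgue. rep_L2 (c *\<^sub>R h) x = c *\<^sub>R rep_L2 h x"
proof -
  have "c *\<^sub>R h = to_L2 (\<lambda>x. c *\<^sub>R rep_L2 h x)"
    using to_L2_scaleR[OF square_integrable_rep_L2[of h]] by (simp add: to_L2_rep_L2)
  then show ?thesis
    using rep_L2_to_L2[OF square_integrable_scaleR[OF square_integrable_rep_L2[of h], of c]] by simp
qed

lemma inner_L2_rep: "h \<bullet> k = (\<integral>x. rep_L2 h x \<bullet> rep_L2 k x \<partial>lebesgue)"
  by (rule inner_L2.rep_eq)

lemma AE_lebesgue_on:
  assumes "D \<in> sets lebesgue" "AE x in lebesgue. P x"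
  shows "AE x in lebesgue_on D. P x"
  using assms by (subst AE_restrict_space_iff) (auto elim: AE_mp)

lemma rep_L2_borel_measurable [measurable]:
  "rep_L2 h \<in> borel_measurable lebesgue" "rep_L2 h \<in> borel_measurable (lebesgue_on D)"
  using square_integrable_rep_L2[of h] by (auto simp: square_integrable_def intro: measurable_restrict_space1)

definition weighted_form ::
  "'a::euclidean_space set \<Rightarrow> ('a \<Rightarrow> real) \<Rightarrow> ('a, 'b::euclidean_space) L2 \<Rightarrow> ('a, 'b) L2 \<Rightarrow> real" where
  "weighted_form D a h k = (\<integral>x. a x * (rep_L2 h x \<bullet> rep_L2 k x) \<partial>lebesgue_on D)"

context
  fixes D :: "'a::euclidean_space set"
  assumes D: "D \<in> sets lebesgue"
begin

lemma integrable_lebesgue_on: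
  fixes f :: "'a \<Rightarrow> real"
  assumes "integrable lebesgue f"
  shows "integrable (lebesgue_on D) f"
  using D integrable_mult_indicator[OF D assms] by (simp add: integrable_restrict_space)

lemma norm_rep_product:
  fixes h k :: "('a, 'b::euclidean_space) L2"
  shows "integrable lebesgue (\<lambda>x. norm (rep_L2 h x) * norm (rep_L2 k x))"
    and "(\<integral>x. norm (rep_L2 h x) * norm (rep_L2 k x) \<partial>lebesgue) \<le> norm h * norm k"
proof -
  have sq: "square_integrable lebesgue (\<lambda>x. norm (rep_L2 h x))" for h :: "('a, 'c::euclidean_space) L2"
    using square_integrable_rep_L2[of h] by (auto simp: square_integrable_def)
  have n: "norm (to_L2 (\<lambda>x. norm (rep_L2 h x))) = norm h" for h :: "('a, 'c::euclidean_space) L2"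
    using norm_to_L2[OF sq[of h]] norm_to_L2[OF square_integrable_rep_L2[of h]]
    by (simp add: L2_norm_def to_L2_rep_L2)
  show "integrable lebesgue (\<lambda>x. norm (rep_L2 h x) * norm (rep_L2 k x))"
    using square_integrable_inner[OF sq[of h] sq[of k]] by simp
  have "(\<integral>x. norm (rep_L2 h x) * norm (rep_L2 k x) \<partial>lebesgue) =
      to_L2 (\<lambda>x. norm (rep_L2 h x)) \<bullet> to_L2 (\<lambda>x. norm (rep_L2 k x))"
    using inner_L2.abs_eq[of "\<lambda>x. norm (rep_L2 h x)" "\<lambda>x. norm (rep_L2 k x)"] sq[of h] sq[of k]
    by (simp add: L2_rel_def)
  also have "\<dots> \<le> norm h * norm k"
    using norm_cauchy_schwarz[of "to_L2 (\<lambda>x. norm (rep_L2 h x))" "to_L2 (\<lambda>x. norm (rep_L2 k x))"]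
    by (simp add: n)
  finally show "(\<integral>x. norm (rep_L2 h x) * norm (rep_L2 k x) \<partial>lebesgue) \<le> norm h * norm k" .
qed

lemma integrable_weighted_form:
  assumes "essentially_bounded (lebesgue_on D) a"
  shows "integrable (lebesgue_on D) (\<lambda>x. a x * (rep_L2 h x \<bullet> rep_L2 k x))"
proof -
  obtain B where a: "a \<in> borel_measurable (lebesgue_on D)" and B: "AE x in lebesgue_on D. \<bar>a x\<bar> \<le> B"
    using assms by (auto simp: essentially_bounded_def)
  show ?thesis
  proof (rule Bochner_Integration.integrable_bound)
    show "integrable (lebesgue_on D) (\<lambda>x. B * (norm (rep_L2 h x) * norm (rep_L2 k x)))"
      by (intro integrable_mult_right integrable_lebesgue_on norm_rep_product)
    show "(\<lambda>x. a x * (rep_L2 h x \<bullet> rep_L2 k x)) \<in> borel_measurable (lebesgue_on D)"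
      using a by (intro borel_measurable_times borel_measurable_inner rep_L2_borel_measurable)
    show "AE x in lebesgue_on D. norm (a x * (rep_L2 h x \<bullet> rep_L2 k x)) \<le> norm (B * (norm (rep_L2 h x) * norm (rep_L2 k x)))"
      using B
    proof eventually_elim
      case (elim x)
      have "\<bar>a x\<bar> * \<bar>rep_L2 h x \<bullet> rep_L2 k x\<bar> \<le> \<bar>B\<bar> * (norm (rep_L2 h x) * norm (rep_L2 k x))"
        using elim by (intro mult_mono Cauchy_Schwarz_ineq2) auto
      then show ?case by (simp add: abs_mult)
    qed
  qed
qed

lemma weighted_form_commute: "weighted_form D a h k = weighted_form D a k h"
  by (simp add: weighted_form_def inner_commute)

lemma weighted_form_add_left:
  assumes "essentially_bounded (lebesgue_on D) a"
  shows "weighted_form D a (h1 + h2) k = weighted_form D a h1 k + weighted_form D a h2 k"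
proof -
  have "weighted_form D a (h1 + h2) k =
      (\<integral>x. a x * (rep_L2 h1 x \<bullet> rep_L2 k x) + a x * (rep_L2 h2 x \<bullet> rep_L2 k x) \<partial>lebesgue_on D)"
    unfolding weighted_form_def
  proof (rule integral_cong_AE)
    show "AE x in lebesgue_on D. a x * (rep_L2 (h1 + h2) x \<bullet> rep_L2 k x) =
        a x * (rep_L2 h1 x \<bullet> rep_L2 k x) + a x * (rep_L2 h2 x \<bullet> rep_L2 k x)"
      using AE_lebesgue_on[OF D rep_L2_add[of h1 h2]]
      by eventually_elim (simp add: inner_add_left distrib_left)
  qed (intro borel_measurable_integrable Bochner_Integration.integrable_add integrable_weighted_form assms)+
  also have "\<dots> = weighted_form D a h1 k + weighted_form D a h2 k"
    unfolding weighted_form_def by (intro Bochner_Integration.integral_add integrable_weighted_form assms)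
  finally show ?thesis .
qed

lemma weighted_form_scaleR_left:
  assumes "essentially_bounded (lebesgue_on D) a"
  shows "weighted_form D a (c *\<^sub>R h) k = c * weighted_form D a h k"
proof -
  have "weighted_form D a (c *\<^sub>R h) k = (\<integral>x. c * (a x * (rep_L2 h x \<bullet> rep_L2 k x)) \<partial>lebesgue_on D)"
    unfolding weighted_form_def
  proof (rule integral_cong_AE)
    show "AE x in lebesgue_on D. a x * (rep_L2 (c *\<^sub>R h) x \<bullet> rep_L2 k x) = c * (a x * (rep_L2 h x \<bullet> rep_L2 k x))"
      using AE_lebesgue_on[OF D rep_L2_scaleR[of c h]] by eventually_elim simp
  qed (intro borel_measurable_integrable integrable_mult_right integrable_weighted_form assms)+
  then show ?thesis by (simp add: weighted_form_def)
qed

lemma weighted_form_bound: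
  assumes a: "a \<in> borel_measurable (lebesgue_on D)" and B: "AE x in lebesgue_on D. \<bar>a x\<bar> \<le> B" "0 \<le> B"
  shows "\<bar>weighted_form D a h k\<bar> \<le> B * (norm h * norm k)"
proof -
  have eb: "essentially_bounded (lebesgue_on D) a"
    using a B by (auto simp: essentially_bounded_def)
  have int: "integrable (lebesgue_on D) (\<lambda>x. B * (norm (rep_L2 h x) * norm (rep_L2 k x)))"
    by (intro integrable_mult_right integrable_lebesgue_on norm_rep_product)
  have "\<bar>weighted_form D a h k\<bar> \<le> (\<integral>x. \<bar>a x * (rep_L2 h x \<bullet> rep_L2 k x)\<bar> \<partial>lebesgue_on D)"
    unfolding weighted_form_def by (rule integral_abs_bound)
  also have "\<dots> \<le> (\<integral>x. B * (norm (rep_L2 h x) * norm (rep_L2 k x)) \<partial>lebesgue_on D)"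
  proof (rule integral_mono_AE[OF integrable_abs[OF integrable_weighted_form[OF eb]] int])
    show "AE x in lebesgue_on D. \<bar>a x * (rep_L2 h x \<bullet> rep_L2 k x)\<bar> \<le> B * (norm (rep_L2 h x) * norm (rep_L2 k x))"
      using B(1)
    proof eventually_elim
      case (elim x)
      then show ?case unfolding abs_mult by (intro mult_mono Cauchy_Schwarz_ineq2) auto
    qed
  qed
  also have "\<dots> \<le> (\<integral>x. B * (norm (rep_L2 h x) * norm (rep_L2 k x)) \<partial>lebesgue)"
  proof -
    have "(\<integral>x. B * (norm (rep_L2 h x) * norm (rep_L2 k x)) \<partial>lebesgue_on D) =
        (\<integral>x. indicator D x *\<^sub>R (B * (norm (rep_L2 h x) * norm (rep_L2 k x))) \<partial>lebesgue)"
      using D by (intro integral_restrict_space) simp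
    also have "\<dots> \<le> (\<integral>x. B * (norm (rep_L2 h x) * norm (rep_L2 k x)) \<partial>lebesgue)"
      using norm_rep_product(1)[of h k] D B(2)
      by (intro integral_mono integrable_mult_indicator integrable_mult_right) (auto simp: indicator_def)
    finally show ?thesis .
  qed
  also have "\<dots> \<le> B * (norm h * norm k)"
    using norm_rep_product(2)[of h k] B(2) by (simp add: mult_left_mono)
  finally show ?thesis .
qed

lemma weighted_form_mono:
  assumes "essentially_bounded (lebesgue_on D) a" "essentially_bounded (lebesgue_on D) a'"
    and "AE x in lebesgue_on D. a x \<le> a' x"
  shows "weighted_form D a h h \<le> weighted_form D a' h h"
  unfolding weighted_form_def
  by (rule integral_mono_AE[OF integrable_weighted_form[OF assms(1)] integrable_weighted_form[OF assms(2)]])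
    (use assms(3) in eventually_elim, simp add: mult_right_mono)

lemma weighted_form_add_weight:
  assumes "essentially_bounded (lebesgue_on D) a" "essentially_bounded (lebesgue_on D) a'"
  shows "weighted_form D (\<lambda>x. a x + a' x) h k = weighted_form D a h k + weighted_form D a' h k"
  unfolding weighted_form_def distrib_right
  by (intro Bochner_Integration.integral_add integrable_weighted_form assms)

lemma weighted_form_scale_weight: "weighted_form D (\<lambda>x. c * a x) h k = c * weighted_form D a h k"
  by (simp add: weighted_form_def mult.assoc)

text \<open>
  The parameter \<open>s\<close> lets a later Schur test distribute the coupling of \<open>h\<close> and \<open>k\<close> unevenly.
\<close>

lemma weighted_form_young:
  assumes a: "essentially_bounded (lebesgue_on D) a" and s: "s > 0"
  shows "\<bar>weighted_form D a h k\<bar> \<le>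
    (s * weighted_form D (\<lambda>x. \<bar>a x\<bar>) h h + weighted_form D (\<lambda>x. \<bar>a x\<bar>) k k / s) / 2"
proof -
  have a': "essentially_bounded (lebesgue_on D) (\<lambda>x. \<bar>a x\<bar>)"
    using a by (auto simp: essentially_bounded_def)
  let ?i = "\<lambda>h x. \<bar>a x\<bar> * (rep_L2 h x \<bullet> rep_L2 h x)"
  have int: "integrable (lebesgue_on D) (?i h)" for h :: "('a, 'c::euclidean_space) L2"
    by (rule integrable_weighted_form[OF a'])
  have "\<bar>weighted_form D a h k\<bar> \<le> (\<integral>x. \<bar>a x * (rep_L2 h x \<bullet> rep_L2 k x)\<bar> \<partial>lebesgue_on D)"
    unfolding weighted_form_def by (rule integral_abs_bound)
  also have "\<dots> \<le> (\<integral>x. (s / 2) * ?i h x + (1 / (2 * s)) * ?i k x \<partial>lebesgue_on D)"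
  proof (rule integral_mono)
    fix x
    let ?h = "rep_L2 h x" and ?k = "rep_L2 k x"
    have "\<bar>?h \<bullet> ?k\<bar> \<le> norm ?h * norm ?k" by (rule Cauchy_Schwarz_ineq2)
    also have "\<dots> \<le> (s / 2) * (norm ?h)\<^sup>2 + (1 / (2 * s)) * (norm ?k)\<^sup>2"
    proof -
      have "0 \<le> (s * norm ?h - norm ?k)\<^sup>2 / (2 * s)" using s by simp
      also have "\<dots> = (s / 2) * (norm ?h)\<^sup>2 + (1 / (2 * s)) * (norm ?k)\<^sup>2 - norm ?h * norm ?k"
        using s by (simp add: power2_eq_square field_simps)
      finally show ?thesis by simp
    qed
    finally have "\<bar>a x\<bar> * \<bar>?h \<bullet> ?k\<bar> \<le> \<bar>a x\<bar> * ((s / 2) * (?h \<bullet> ?h) + (1 / (2 * s)) * (?k \<bullet> ?k))"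
      by (intro mult_left_mono) (simp_all add: power2_norm_eq_inner)
    then show "\<bar>a x * (?h \<bullet> ?k)\<bar> \<le> (s / 2) * ?i h x + (1 / (2 * s)) * ?i k x"
      by (simp add: abs_mult distrib_left mult_ac)
  qed (intro integrable_abs integrable_weighted_form a Bochner_Integration.integrable_add integrable_mult_right int)+
  also have "\<dots> = (s / 2) * weighted_form D (\<lambda>x. \<bar>a x\<bar>) h h + (1 / (2 * s)) * weighted_form D (\<lambda>x. \<bar>a x\<bar>) k k"
    unfolding weighted_form_def
    by (subst Bochner_Integration.integral_add) (simp_all only: integrable_mult_right int integral_mult_right_zero)
  finally show ?thesis by (simp add: field_simps)
qed

lemma weighted_form_nonneg:
  assumes "\<And>x. 0 \<le> a x"
  shows "0 \<le> weighted_form D a h h"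
  unfolding weighted_form_def using assms by (intro Bochner_Integration.integral_nonneg) simp

lemma essentially_bounded_const: "essentially_bounded (lebesgue_on D) (\<lambda>x. c)"
  by (auto simp: essentially_bounded_def)

lemma bounded_bilinear_weighted_form:
  assumes a: "essentially_bounded (lebesgue_on D) a"
  shows "bounded_bilinear (weighted_form D a :: ('a, 'b::euclidean_space) L2 \<Rightarrow> ('a, 'b) L2 \<Rightarrow> real)"
proof
  obtain B where B: "a \<in> borel_measurable (lebesgue_on D)" "AE x in lebesgue_on D. \<bar>a x\<bar> \<le> B"
    using a by (auto simp: essentially_bounded_def)
  have B': "AE x in lebesgue_on D. \<bar>a x\<bar> \<le> max B 0"
    using B(2) by eventually_elim simp
  show "\<exists>K. \<forall>(h::('a, 'b) L2) k. norm (weighted_form D a h k) \<le> norm h * norm k * K"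
  proof (intro exI[of _ "max B 0"] allI)
    fix h k :: "('a, 'b) L2"
    show "norm (weighted_form D a h k) \<le> norm h * norm k * max B 0"
      using weighted_form_bound[OF B(1) B', of h k] by (simp add: mult.commute)
  qed
  fix h h' k k' :: "('a, 'b) L2" and r
  show "weighted_form D a (h + h') k = weighted_form D a h k + weighted_form D a h' k"
    by (rule weighted_form_add_left[OF a])
  then show "weighted_form D a k (h + h') = weighted_form D a k h + weighted_form D a k h'"
    by (simp only: weighted_form_commute[of a k])
  show "weighted_form D a (r *\<^sub>R h) k = r *\<^sub>R weighted_form D a h k"
    using weighted_form_scaleR_left[OF a] by simp
  then show "weighted_form D a k (r *\<^sub>R h) = r *\<^sub>R weighted_form D a k h"
    by (simp only: weighted_form_commute[of a k])
qed

end

section \<open>The space \<open>H\<^sup>1\<^sub>0\<close> and the inequality of Poincare\<close>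

lemma compact_support_integrable:
  fixes f :: "'a::euclidean_space \<Rightarrow> 'b::euclidean_space"
  assumes f: "continuous_on UNIV f" and K: "compact K" "\<And>x. x \<notin> K \<Longrightarrow> f x = 0"
  shows "integrable lborel f" "integrable lebesgue f" "(\<integral>x. f x \<partial>lebesgue) = (\<integral>x. f x \<partial>lborel)"
proof -
  have m: "f \<in> borel_measurable lborel"
    using borel_measurable_continuous_onI[OF f] by simp
  have "integrable lborel (\<lambda>x. indicator K x *\<^sub>R f x)"
    using K(1) continuous_on_subset[OF f subset_UNIV] by (rule borel_integrable_compact)
  moreover have "(\<lambda>x. indicator K x *\<^sub>R f x) = f"
    using K(2) by (auto simp: indicator_def fun_eq_iff)
  ultimately show 1: "integrable lborel f" by simp
  show "integrable lebesgue f"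
    using 1 integrable_completion[OF m] by simp
  show "(\<integral>x. f x \<partial>lebesgue) = (\<integral>x. f x \<partial>lborel)"
    by (rule integral_completion[OF m])
qed

lemma compact_support_square_integrable:
  fixes f :: "'a::euclidean_space \<Rightarrow> 'b::euclidean_space"
  assumes f: "continuous_on UNIV f" and K: "compact K" "\<And>x. x \<notin> K \<Longrightarrow> f x = 0"
  shows "square_integrable lebesgue f"
  unfolding square_integrable_def
proof
  show "f \<in> borel_measurable lebesgue"
    using compact_support_integrable(2)[OF assms] by (rule borel_measurable_integrable)
  show "integrable lebesgue (\<lambda>x. (norm (f x))\<^sup>2)"
    by (rule compact_support_integrable(2)[OF _ K(1)]) (use K in \<open>auto intro!: continuous_intros f\<close>)
qed

text \<open>
  The integral of a directional derivative of a function with compact support is the limit of the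
  integrals of difference quotients, which vanish because Lebesgue measure is invariant under translations.
\<close>

lemma integral_directional_derivative:
  fixes g dg :: "'a::euclidean_space \<Rightarrow> real" and e :: 'a
  assumes g: "continuous_on UNIV g" and dg: "continuous_on UNIV dg"
    and deriv: "\<And>x. ((\<lambda>t. g (x + t *\<^sub>R e)) has_real_derivative dg x) (at 0)"
    and e: "norm e = 1" and supp: "\<And>x. norm x > R \<Longrightarrow> g x = 0 \<and> dg x = 0"
  shows "(\<integral>x. dg x \<partial>lborel) = 0"
proof -
  have deriv': "((\<lambda>t. g (x + t *\<^sub>R e)) has_real_derivative dg (x + t *\<^sub>R e)) (at t)" for x t
  proof -
    have "((\<lambda>h. g ((x + t *\<^sub>R e) + h *\<^sub>R e)) has_real_derivative dg (x + t *\<^sub>R e)) (at 0)"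
      by (rule deriv)
    then have "((\<lambda>h. g (x + (h + t) *\<^sub>R e)) has_real_derivative dg (x + t *\<^sub>R e)) (at 0)"
      by (simp add: scaleR_add_left algebra_simps)
    then show ?thesis
      using DERIV_shift[of "\<lambda>t. g (x + t *\<^sub>R e)" "dg (x + t *\<^sub>R e)" 0 t] by simp
  qed
  have "bounded (dg ` cball 0 R)"
    by (intro compact_imp_bounded compact_continuous_image continuous_on_subset[OF dg]) auto
  then obtain B where B: "B > 0" "\<And>x. x \<in> cball 0 R \<Longrightarrow> norm (dg x) \<le> B"
    unfolding bounded_pos by auto
  have M: "\<bar>dg x\<bar> \<le> B" for x
    using B(1) B(2)[of x] supp[of x] by (cases "norm x \<le> R") auto
  define h where "h n = inverse (real (Suc n))" for n
  have h: "0 < h n" "h n \<le> 1" for n by (auto simp: h_def field_simps)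
  define s where "s n x = (g (x + h n *\<^sub>R e) - g x) / h n" for n x
  have int_g: "integrable lborel g"
    by (rule compact_support_integrable(1)[OF g compact_cball[of 0 R]]) (use supp in auto)
  have shift: "integrable lborel (\<lambda>x. g (x + c))" "(\<integral>x. g (x + c) \<partial>lborel) = (\<integral>x. g x \<partial>lborel)" for c
  proof -
    have m: "(+) c \<in> measurable lborel borel" by simp
    have gm: "g \<in> borel_measurable borel" using borel_measurable_continuous_onI[OF g] .
    show "integrable lborel (\<lambda>x. g (x + c))"
      using integrable_distr[OF m, of g] int_g by (simp add: lborel_distr_plus add.commute)
    show "(\<integral>x. g (x + c) \<partial>lborel) = (\<integral>x. g x \<partial>lborel)"
      using integral_distr[OF m gm] by (simp add: lborel_distr_plus add.commute)
  qed
  have zero: "(\<integral>x. s n x \<partial>lborel) = 0" for n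
    unfolding s_def using shift[of "h n *\<^sub>R e"] int_g by simp
  have "(\<lambda>n. \<integral>x. s n x \<partial>lborel) \<longlonglongrightarrow> (\<integral>x. dg x \<partial>lborel)"
  proof (rule integral_dominated_convergence[where w="\<lambda>x. B * indicator (cball 0 (R + 1)) x"])
    show "dg \<in> borel_measurable lborel"
      using borel_measurable_continuous_onI[OF dg] by simp
    show "s n \<in> borel_measurable lborel" for n
      unfolding s_def[abs_def] using shift[of "h n *\<^sub>R e"] int_g
      by (intro borel_measurable_divide borel_measurable_diff borel_measurable_const)
        (auto dest: borel_measurable_integrable)
    show "integrable lborel (\<lambda>x::'a. B * indicator (cball 0 (R + 1)) x)"
      by (intro integrable_mult_right integrable_real_indicator) (use emeasure_bounded_finite[OF bounded_cball[of 0 "R + 1"]] in auto)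
    show "AE x in lborel. (\<lambda>n. s n x) \<longlonglongrightarrow> dg x"
    proof (rule AE_I2)
      fix x
      have "((\<lambda>t. (g (x + t *\<^sub>R e) - g x) / t) \<longlongrightarrow> dg x) (at 0)"
        using deriv[of x] by (simp add: has_field_derivative_iff)
      moreover have "filterlim h (at 0) sequentially"
        unfolding filterlim_at
      proof
        show "\<forall>\<^sub>F n in sequentially. h n \<in> UNIV \<and> h n \<noteq> 0"
          using h(1) by (intro always_eventually allI) (metis UNIV_I less_irrefl)
        show "h \<longlonglongrightarrow> 0"
          unfolding h_def by (rule LIMSEQ_inverse_real_of_nat)
      qed
      ultimately show "(\<lambda>n. s n x) \<longlonglongrightarrow> dg x"
        unfolding s_def by (rule filterlim_compose)
    qed
    show "AE x in lborel. norm (s n x) \<le> B * indicator (cball 0 (R + 1)) x" for n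
    proof (rule AE_I2)
      fix x
      show "norm (s n x) \<le> B * indicator (cball 0 (R + 1)) x"
      proof (cases "norm x \<le> R + 1")
        case True
        obtain t where "g (x + h n *\<^sub>R e) - g (x + 0 *\<^sub>R e) = (h n - 0) * dg (x + t *\<^sub>R e)"
          using MVT2[of 0 "h n" "\<lambda>t. g (x + t *\<^sub>R e)" "\<lambda>t. dg (x + t *\<^sub>R e)"] h(1)[of n] deriv' by blast
        then have "s n x = dg (x + t *\<^sub>R e)" using h(1)[of n] by (simp add: s_def)
        then show ?thesis using M True by simp
      next
        case False
        have "norm x \<le> norm (x + h n *\<^sub>R e) + norm (h n *\<^sub>R e)"
          using norm_triangle_ineq4[of "x + h n *\<^sub>R e" "h n *\<^sub>R e"] by simp
        then have "norm (x + h n *\<^sub>R e) > R" "norm x > R"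
          using False h[of n] e by auto
        then show ?thesis using supp[of x] supp[of "x + h n *\<^sub>R e"] B(1) by (simp add: s_def)
      qed
    qed
  qed
  then have "(\<lambda>n::nat. 0) \<longlonglongrightarrow> (\<integral>x. dg x \<partial>lborel)" unfolding zero .
  then show ?thesis using LIMSEQ_unique[OF tendsto_const] by metis
qed

lemma Ck_const: "Ck m (\<lambda>x. c)"
  by (induction m arbitrary: c) simp_all

lemma Ck_lincomb: "Ck m \<phi> \<Longrightarrow> Ck m \<psi> \<Longrightarrow> Ck m (\<lambda>x. c * \<phi> x + \<psi> x)"
proof (induction m arbitrary: \<phi> \<psi>)
  case 0
  then show ?case by (auto intro!: continuous_intros)
next
  case (Suc m)
  have d: "\<phi> differentiable at x" "\<psi> differentiable at x" for x using Suc.prems by auto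
  have "((\<lambda>x. c * \<phi> x + \<psi> x) has_derivative
      (\<lambda>h. c * frechet_derivative \<phi> (at x) h + frechet_derivative \<psi> (at x) h)) (at x)" for x
    using d[of x] by (intro derivative_intros) (simp_all only: frechet_derivative_works)
  then have "frechet_derivative (\<lambda>x. c * \<phi> x + \<psi> x) (at x) =
      (\<lambda>h. c * frechet_derivative \<phi> (at x) h + frechet_derivative \<psi> (at x) h)" for x
    by (rule frechet_derivative_at[symmetric])
  then show ?case
    using Suc d by (auto intro!: differentiable_add differentiable_mult differentiable_const)
qed

context
  fixes D :: "'a::euclidean_space set" and \<phi> :: "'a \<Rightarrow> real"
  assumes \<phi>: "\<phi> \<in> test_functions D"
begin

lemma test_function_support: "compact (closure {x. \<phi> x \<noteq> 0})" "closure {x. \<phi> x \<noteq> 0} \<subseteq> D"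
  using \<phi> by (auto simp: test_functions_def)

lemma test_function_continuous: "continuous_on UNIV \<phi>"
  using \<phi> Ck.simps(1)[of \<phi>] unfolding test_functions_def by blast

lemma test_function_has_derivative: "(\<phi> has_derivative frechet_derivative \<phi> (at x)) (at x)"
  using \<phi> Ck.simps(2)[of 0 \<phi>] unfolding test_functions_def by (metis (mono_tags, lifting) frechet_derivative_works mem_Collect_eq)

lemma continuous_on_gradient: "continuous_on UNIV (gradient \<phi>)"
proof -
  have "Ck (Suc 0) \<phi>" using \<phi> unfolding test_functions_def by blast
  then show ?thesis unfolding gradient_def[abs_def] by (intro continuous_intros) simp
qed

lemma gradient_eq_0:
  assumes "x \<notin> closure {x. \<phi> x \<noteq> 0}"
  shows "gradient \<phi> x = 0"
proof -
  have "(\<phi> has_derivative (\<lambda>_. 0)) (at x)"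
  proof (rule has_derivative_transform_within_open)
    show "((\<lambda>_. 0) has_derivative (\<lambda>_. 0)) (at x)" by simp
    show "open (- closure {x. \<phi> x \<noteq> 0})" by auto
    show "x \<in> - closure {x. \<phi> x \<noteq> 0}" using assms by simp
    show "0 = \<phi> y" if "y \<in> - closure {x. \<phi> x \<noteq> 0}" for y
      using that closure_subset[of "{x. \<phi> x \<noteq> 0}"] by auto
  qed
  from frechet_derivative_at[OF this] have "frechet_derivative \<phi> (at x) = (\<lambda>_. 0)" by simp
  then show ?thesis by (simp add: gradient_def)
qed

lemma test_function_eq_0: "x \<notin> closure {x. \<phi> x \<noteq> 0} \<Longrightarrow> \<phi> x = 0"
  using closure_subset[of "{x. \<phi> x \<noteq> 0}"] by auto

lemma square_integrable_test_function: "square_integrable lebesgue \<phi>"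
  by (rule compact_support_square_integrable[OF test_function_continuous test_function_support(1) test_function_eq_0])

lemma square_integrable_gradient: "square_integrable lebesgue (gradient \<phi>)"
  by (rule compact_support_square_integrable[OF continuous_on_gradient test_function_support(1) gradient_eq_0])

lemma frechet_derivative_eq_gradient:
  assumes "e \<in> Basis"
  shows "frechet_derivative \<phi> (at x) e = gradient \<phi> x \<bullet> e"
  using assms by (simp add: gradient_def inner_sum_left inner_Basis if_distrib[of "\<lambda>t. _ * t"] sum.delta' cong: if_cong)

text \<open>
  Integration by parts against the coordinate \<open>x \<bullet> e\<close>: the integral of
  \<open>\<phi>\<^sup>2 + 2 (x \<bullet> e) \<phi> \<partial>\<^sub>e\<phi>\<close>, a directional derivative, is zero.
\<close>

lemma poincare_test_function:
  assumes R: "\<And>x. x \<in> D \<Longrightarrow> norm x \<le> R"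
  shows "norm (to_L2 \<phi>) \<le> 2 * R * norm (to_L2 (gradient \<phi>))"
proof (cases "D = {}")
  case True
  then have "closure {x. \<phi> x \<noteq> 0} = {}" using test_function_support(2) by simp
  then have e: "x \<notin> closure {x. \<phi> x \<noteq> 0}" for x by (simp only: empty_iff not_False_eq_True)
  have "\<phi> = (\<lambda>_. 0)" by (rule ext) (rule test_function_eq_0[OF e])
  moreover have "gradient \<phi> = (\<lambda>_. 0)" by (rule ext) (rule gradient_eq_0[OF e])
  ultimately show ?thesis by (simp only: to_L2_zero norm_zero mult_zero_right order_refl)
next
  case False
  then obtain x0 where "x0 \<in> D" by blast
  from order_trans[OF norm_ge_zero R[OF this]] have R0: "R \<ge> 0" .
  obtain e :: 'a where e: "e \<in> Basis" using nonempty_Basis by blast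
  define K where "K = closure {x. \<phi> x \<noteq> 0}"
  have K: "compact K" "\<And>x. x \<in> K \<Longrightarrow> norm x \<le> R"
    using test_function_support R by (auto simp: K_def)
  define d where "d x = gradient \<phi> x \<bullet> e" for x
  have d: "continuous_on UNIV d" unfolding d_def by (intro continuous_intros continuous_on_gradient)
  note c = test_function_continuous
  have z: "\<phi> x = 0" "d x = 0" "gradient \<phi> x = 0" if "x \<notin> K" for x
    using that test_function_eq_0[of x] gradient_eq_0[of x] by (auto simp: K_def d_def)
  have zero: "(\<integral>x. (\<phi> x)\<^sup>2 + 2 * (x \<bullet> e) * \<phi> x * d x \<partial>lborel) = 0"
  proof (rule integral_directional_derivative[where g="\<lambda>x. (x \<bullet> e) * (\<phi> x)\<^sup>2" and e=e and R=R])
    fix x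
    have "((\<lambda>t. \<phi> (x + t *\<^sub>R e)) has_derivative (\<lambda>h. frechet_derivative \<phi> (at x) (h *\<^sub>R e))) (at 0)"
    proof (rule has_derivative_compose[of "\<lambda>t. x + t *\<^sub>R e" "\<lambda>h. h *\<^sub>R e"])
      show "((\<lambda>t. x + t *\<^sub>R e) has_derivative (\<lambda>h. h *\<^sub>R e)) (at 0)"
        by (auto intro!: derivative_eq_intros)
      show "(\<phi> has_derivative frechet_derivative \<phi> (at x)) (at (x + 0 *\<^sub>R e))"
        using test_function_has_derivative[of x] by simp
    qed
    moreover have "(\<lambda>h. frechet_derivative \<phi> (at x) (h *\<^sub>R e)) = (*) (d x)"
      using linear_scale[OF has_derivative_linear[OF test_function_has_derivative[of x]]]
      by (simp add: fun_eq_iff d_def frechet_derivative_eq_gradient[OF e])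
    ultimately have 1: "((\<lambda>t. \<phi> (x + t *\<^sub>R e)) has_real_derivative d x) (at 0)"
      by (simp add: has_field_derivative_def)
    have 2: "((\<lambda>t. (x + t *\<^sub>R e) \<bullet> e) has_real_derivative 1) (at 0)"
      using e by (auto intro!: derivative_eq_intros simp: inner_add_left)
    show "((\<lambda>t. ((x + t *\<^sub>R e) \<bullet> e) * (\<phi> (x + t *\<^sub>R e))\<^sup>2) has_real_derivative
        (\<phi> x)\<^sup>2 + 2 * (x \<bullet> e) * \<phi> x * d x) (at 0)"
      by (rule derivative_eq_intros 1 2 refl | simp)+
  next
    fix x :: 'a assume "norm x > R"
    then have "x \<notin> K" using K(2)[of x] by auto
    then show "(x \<bullet> e) * (\<phi> x)\<^sup>2 = 0 \<and> (\<phi> x)\<^sup>2 + 2 * (x \<bullet> e) * \<phi> x * d x = 0" by (simp add: z)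
  qed (use e in \<open>auto intro!: continuous_intros c d\<close>)
  have i1: "integrable lborel (\<lambda>x. (\<phi> x)\<^sup>2)" "(\<integral>x. (\<phi> x)\<^sup>2 \<partial>lebesgue) = (\<integral>x. (\<phi> x)\<^sup>2 \<partial>lborel)"
    by (rule compact_support_integrable[OF _ K(1)]; use z in \<open>auto intro!: continuous_intros c\<close>)+
  have i2: "integrable lborel (\<lambda>x. (norm (gradient \<phi> x))\<^sup>2)"
    "(\<integral>x. (norm (gradient \<phi> x))\<^sup>2 \<partial>lebesgue) = (\<integral>x. (norm (gradient \<phi> x))\<^sup>2 \<partial>lborel)"
    by (rule compact_support_integrable[OF _ K(1)]; use z in \<open>auto intro!: continuous_intros continuous_on_gradient\<close>)+
  have i3: "integrable lborel (\<lambda>x. (\<phi> x)\<^sup>2 + 2 * (x \<bullet> e) * \<phi> x * d x)"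
    by (rule compact_support_integrable(1)[OF _ K(1)]) (use z in \<open>auto intro!: continuous_intros c d\<close>)
  have "(\<integral>x. (1/2) * (\<phi> x)\<^sup>2 \<partial>lborel) \<le>
      (\<integral>x. 2 * R\<^sup>2 * (norm (gradient \<phi> x))\<^sup>2 + ((\<phi> x)\<^sup>2 + 2 * (x \<bullet> e) * \<phi> x * d x) \<partial>lborel)"
  proof (rule integral_mono)
    fix x
    show "(1/2) * (\<phi> x)\<^sup>2 \<le> 2 * R\<^sup>2 * (norm (gradient \<phi> x))\<^sup>2 + ((\<phi> x)\<^sup>2 + 2 * (x \<bullet> e) * \<phi> x * d x)"
    proof (cases "x \<in> K")
      case True
      have "0 \<le> (\<phi> x + 2 * (x \<bullet> e) * d x)\<^sup>2 / 2" by simp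
      also have "\<dots> = (1/2) * (\<phi> x)\<^sup>2 + 2 * (x \<bullet> e) * \<phi> x * d x + 2 * ((x \<bullet> e)\<^sup>2 * (d x)\<^sup>2)"
        by (simp add: power2_eq_square algebra_simps add_divide_distrib)
      also have "(x \<bullet> e)\<^sup>2 * (d x)\<^sup>2 \<le> R\<^sup>2 * (norm (gradient \<phi> x))\<^sup>2"
      proof (rule mult_mono)
        have "\<bar>x \<bullet> e\<bar> \<le> R" using Basis_le_norm[OF e, of x] K(2)[OF True] by simp
        then show "(x \<bullet> e)\<^sup>2 \<le> R\<^sup>2" using R0 by (simp add: abs_le_square_iff[symmetric])
        have "\<bar>d x\<bar> \<le> norm (gradient \<phi> x)" unfolding d_def by (rule Basis_le_norm[OF e])
        then show "(d x)\<^sup>2 \<le> (norm (gradient \<phi> x))\<^sup>2" by (simp add: abs_le_square_iff[symmetric])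
      qed auto
      finally show ?thesis by simp
    qed (simp add: z)
  qed (use i1 i2 i3 in auto)
  also have "\<dots> = 2 * R\<^sup>2 * (\<integral>x. (norm (gradient \<phi> x))\<^sup>2 \<partial>lborel)"
    using i2 i3 zero by simp
  finally have "(\<integral>x. (\<phi> x)\<^sup>2 \<partial>lebesgue) \<le> (2 * R)\<^sup>2 * (\<integral>x. (norm (gradient \<phi> x))\<^sup>2 \<partial>lebesgue)"
    unfolding i1(2) i2(2) by (simp add: power_mult_distrib)
  then have "sqrt (\<integral>x. (\<phi> x)\<^sup>2 \<partial>lebesgue) \<le> sqrt ((2 * R)\<^sup>2 * (\<integral>x. (norm (gradient \<phi> x))\<^sup>2 \<partial>lebesgue))"
    by (rule real_sqrt_le_mono)
  then show ?thesis
    using R0 by (simp add: norm_to_L2 square_integrable_test_function square_integrable_gradient L2_norm_def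
        real_sqrt_mult)
qed

text \<open>
  The gradient vanishes outside \<open>D\<close>, so integrating over \<open>D\<close> alone loses nothing.
\<close>

lemma norm_gradient_eq_form:
  assumes D: "D \<in> sets lebesgue"
  shows "(norm (to_L2 (gradient \<phi>)))\<^sup>2 = weighted_form D (\<lambda>x. 1) (to_L2 (gradient \<phi>)) (to_L2 (gradient \<phi>))"
proof -
  let ?h = "to_L2 (gradient \<phi>)"
  have ae: "AE x in lebesgue. rep_L2 ?h x = gradient \<phi> x"
    by (rule rep_L2_to_L2[OF square_integrable_gradient])
  have "(norm ?h)\<^sup>2 = (\<integral>x. rep_L2 ?h x \<bullet> rep_L2 ?h x \<partial>lebesgue)"
    by (simp add: power2_norm_eq_inner inner_L2_rep)
  also have "\<dots> = (\<integral>x. indicator D x *\<^sub>R (1 * (rep_L2 ?h x \<bullet> rep_L2 ?h x)) \<partial>lebesgue)"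
  proof (rule integral_cong_AE)
    show "AE x in lebesgue. rep_L2 ?h x \<bullet> rep_L2 ?h x = indicator D x *\<^sub>R (1 * (rep_L2 ?h x \<bullet> rep_L2 ?h x))"
      using ae
    proof eventually_elim
      case (elim x)
      show ?case
      proof (cases "x \<in> D")
        case False
        then have "x \<notin> closure {x. \<phi> x \<noteq> 0}" using test_function_support(2) by blast
        then show ?thesis using elim gradient_eq_0 by simp
      qed simp
    qed
  qed (use D in measurable)
  also have "\<dots> = weighted_form D (\<lambda>x. 1) ?h ?h"
    unfolding weighted_form_def using D by (intro integral_restrict_space[symmetric]) simp
  finally show ?thesis .
qed

end

lemma gradient_lincomb:
  assumes "\<phi> \<in> test_functions D" "\<psi> \<in> test_functions D"
  shows "gradient (\<lambda>x. c * \<phi> x + \<psi> x) = (\<lambda>x. c *\<^sub>R gradient \<phi> x + gradient \<psi> x)"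
proof
  fix x
  have "((\<lambda>x. c * \<phi> x + \<psi> x) has_derivative
      (\<lambda>h. c * frechet_derivative \<phi> (at x) h + frechet_derivative \<psi> (at x) h)) (at x)"
    by (intro derivative_intros test_function_has_derivative[OF assms(1)] test_function_has_derivative[OF assms(2)])
  note frechet_derivative_at[OF this, symmetric, simp]
  show "gradient (\<lambda>x. c * \<phi> x + \<psi> x) x = c *\<^sub>R gradient \<phi> x + gradient \<psi> x"
    unfolding gradient_def by (simp add: scaleR_add_left sum.distrib scaleR_sum_right)
qed

lemma test_functions_lincomb:
  assumes "\<phi> \<in> test_functions D" "\<psi> \<in> test_functions D"
  shows "(\<lambda>x. c * \<phi> x + \<psi> x) \<in> test_functions D"
proof -
  have "{x. c * \<phi> x + \<psi> x \<noteq> 0} \<subseteq> closure {x. \<phi> x \<noteq> 0} \<union> closure {x. \<psi> x \<noteq> 0}"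
  proof
    fix x assume "x \<in> {x. c * \<phi> x + \<psi> x \<noteq> 0}"
    then have "\<phi> x \<noteq> 0 \<or> \<psi> x \<noteq> 0" by auto
    then show "x \<in> closure {x. \<phi> x \<noteq> 0} \<union> closure {x. \<psi> x \<noteq> 0}"
      using test_function_eq_0[OF assms(1), of x] test_function_eq_0[OF assms(2), of x] by blast
  qed
  then have sub: "closure {x. c * \<phi> x + \<psi> x \<noteq> 0} \<subseteq> closure {x. \<phi> x \<noteq> 0} \<union> closure {x. \<psi> x \<noteq> 0}"
    by (rule closure_minimal) auto
  have "compact (closure {x. \<phi> x \<noteq> 0} \<union> closure {x. \<psi> x \<noteq> 0})"
    using assms by (auto simp: test_functions_def)
  from closed_Int_compact[OF closed_closure this, of "{x. c * \<phi> x + \<psi> x \<noteq> 0}"]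
  have "compact (closure {x. c * \<phi> x + \<psi> x \<noteq> 0})"
    unfolding Int_absorb2[OF sub] .
  then show ?thesis
    using assms sub by (auto simp: test_functions_def intro: Ck_lincomb)
qed

lemma zero_test_function: "(\<lambda>x. 0) \<in> test_functions D"
  by (simp add: test_functions_def Ck_const)

lemma gradient_0: "gradient (\<lambda>x. 0) = (\<lambda>x. 0)"
  by (simp add: gradient_def fun_eq_iff)

lemma subspace_closure:
  fixes S :: "'v::real_normed_vector set"
  assumes "subspace S"
  shows "subspace (closure S)"
  unfolding subspace_def
proof (intro conjI ballI allI)
  show "0 \<in> closure S" using assms closure_subset subspace_0 by blast
next
  fix x y assume "x \<in> closure S" "y \<in> closure S"
  then obtain X Y where "\<And>n. X n \<in> S" "X \<longlonglongrightarrow> x" "\<And>n. Y n \<in> S" "Y \<longlonglongrightarrow> y"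
    unfolding closure_sequential by blast
  then have "\<And>n. X n + Y n \<in> S" "(\<lambda>n. X n + Y n) \<longlonglongrightarrow> x + y"
    using assms by (auto intro: subspace_add tendsto_add)
  then show "x + y \<in> closure S"
    unfolding closure_sequential by (intro exI[of _ "\<lambda>n. X n + Y n"]) blast
next
  fix c :: real and x assume "x \<in> closure S"
  then obtain X where "\<And>n. X n \<in> S" "X \<longlonglongrightarrow> x"
    unfolding closure_sequential by blast
  then have "\<And>n. c *\<^sub>R X n \<in> S" "(\<lambda>n. c *\<^sub>R X n) \<longlonglongrightarrow> c *\<^sub>R x"
    using assms by (auto intro: subspace_scale tendsto_scaleR)
  then show "c *\<^sub>R x \<in> closure S"
    unfolding closure_sequential by (intro exI[of _ "\<lambda>n. c *\<^sub>R X n"]) blast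
qed

lemma subspace_H1_0: "subspace (H1_0 D)"
proof -
  let ?I = "(\<lambda>\<phi>. (to_L2 \<phi>, to_L2 (gradient \<phi>))) ` test_functions D"
  have comb: "c *\<^sub>R (to_L2 \<phi>, to_L2 (gradient \<phi>)) + (to_L2 \<psi>, to_L2 (gradient \<psi>)) \<in> ?I"
    if \<phi>: "\<phi> \<in> test_functions D" and \<psi>: "\<psi> \<in> test_functions D" for c \<phi> \<psi>
  proof (rule image_eqI[OF _ test_functions_lincomb[OF that, of c]])
    show "c *\<^sub>R (to_L2 \<phi>, to_L2 (gradient \<phi>)) + (to_L2 \<psi>, to_L2 (gradient \<psi>)) =
        (to_L2 (\<lambda>x. c * \<phi> x + \<psi> x), to_L2 (gradient (\<lambda>x. c * \<phi> x + \<psi> x)))"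
      using square_integrable_test_function[OF \<phi>] square_integrable_test_function[OF \<psi>]
        square_integrable_gradient[OF \<phi>] square_integrable_gradient[OF \<psi>]
        square_integrable_scaleR[of lebesgue \<phi> c] square_integrable_scaleR[of lebesgue "gradient \<phi>" c]
      by (simp add: gradient_lincomb[OF that] to_L2_scaleR to_L2_add)
  qed
  have zero: "0 \<in> ?I"
  proof (rule image_eqI[OF _ zero_test_function])
    show "0 = (to_L2 (\<lambda>x::'a. 0), to_L2 (gradient (\<lambda>x::'a. 0)))"
      by (simp add: gradient_0 to_L2_zero zero_prod_def)
  qed
  have "subspace ?I"
    unfolding subspace_def
  proof (intro conjI ballI allI zero)
    fix x y assume "x \<in> ?I" "y \<in> ?I"
    then show "x + y \<in> ?I" using comb[of _ _ 1] by auto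
  next
    fix c :: real and x assume "x \<in> ?I"
    then obtain \<phi> where \<phi>: "\<phi> \<in> test_functions D" "x = (to_L2 \<phi>, to_L2 (gradient \<phi>))" by blast
    have "c *\<^sub>R x + 0 \<in> ?I" 
      using comb[OF \<phi>(1) zero_test_function, of c] zero \<phi>(2) 
      by (simp add: to_L2_zero zero_prod_def gradient_0)
    then show "c *\<^sub>R x \<in> ?I" by simp
  qed
  then show ?thesis unfolding H1_0_def by (rule subspace_closure)
qed

lemma closed_H1_0: "closed (H1_0 D)"
  by (simp add: H1_0_def)

lemma H1_0_closed_property:
  assumes "closed {v. P v}" "\<And>\<phi>. \<phi> \<in> test_functions D \<Longrightarrow> P (to_L2 \<phi>, to_L2 (gradient \<phi>))" "v \<in> H1_0 D"
  shows "P v"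
proof -
  have "H1_0 D \<subseteq> {v. P v}"
    unfolding H1_0_def by (rule closure_minimal) (use assms in auto)
  with assms(3) show ?thesis by blast
qed

lemma poincare_H1_0:
  assumes "\<And>x. x \<in> D \<Longrightarrow> norm x \<le> R" and "v \<in> H1_0 D"
  shows "norm (fst v) \<le> 2 * R * norm (snd v)"
proof (rule H1_0_closed_property[OF _ _ assms(2)])
  show "closed {v :: 'a H1_pair. norm (fst v) \<le> 2 * R * norm (snd v)}"
    by (intro closed_Collect_le continuous_intros)
qed (simp add: poincare_test_function assms(1))

lemma norm_snd_H1_0:
  fixes v :: "'a::euclidean_space H1_pair"
  assumes D: "D \<in> sets lebesgue" and v: "v \<in> H1_0 D"
  shows "(norm (snd v))\<^sup>2 = weighted_form D (\<lambda>x. 1) (snd v) (snd v)"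
proof (rule H1_0_closed_property[OF _ _ v])
  show "closed {v :: 'a H1_pair. (norm (snd v))\<^sup>2 = weighted_form D (\<lambda>x. 1) (snd v) (snd v)}"
    by (intro closed_Collect_eq continuous_intros
        bounded_bilinear.continuous_on[OF bounded_bilinear_weighted_form[OF D essentially_bounded_const[OF D]]])
qed (simp add: norm_gradient_eq_form D)

section \<open>The affine parametric elliptic problem\<close>

lemma essentially_bounded_add:
  "essentially_bounded M a \<Longrightarrow> essentially_bounded M b \<Longrightarrow> essentially_bounded M (\<lambda>x. a x + b x)"
proof -
  assume "essentially_bounded M a" "essentially_bounded M b"
  then obtain A B where m: "a \<in> borel_measurable M" "b \<in> borel_measurable M"
    and A: "AE x in M. \<bar>a x\<bar> \<le> A" and B: "AE x in M. \<bar>b x\<bar> \<le> B"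
    by (auto simp: essentially_bounded_def)
  have "AE x in M. \<bar>a x + b x\<bar> \<le> A + B"
    using A B by eventually_elim linarith
  then show ?thesis using m by (auto simp: essentially_bounded_def)
qed

lemma essentially_bounded_scale:
  "essentially_bounded M a \<Longrightarrow> essentially_bounded M (\<lambda>x. c * a x)"
proof -
  assume "essentially_bounded M a"
  then obtain A where m: "a \<in> borel_measurable M" and A: "AE x in M. \<bar>a x\<bar> \<le> A"
    by (auto simp: essentially_bounded_def)
  have "AE x in M. \<bar>c * a x\<bar> \<le> \<bar>c\<bar> * A"
    using A by eventually_elim (simp add: abs_mult mult_left_mono)
  then show ?thesis using m by (auto simp: essentially_bounded_def)
qed

lemma essentially_bounded_abs: "essentially_bounded M a \<Longrightarrow> essentially_bounded M (\<lambda>x. \<bar>a x\<bar>)"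
  by (auto simp: essentially_bounded_def)

lemma essentially_bounded_sum:
  fixes a :: "nat \<Rightarrow> 'x \<Rightarrow> real"
  assumes "\<And>j. essentially_bounded M (a j)"
  shows "essentially_bounded M (\<lambda>x. \<Sum>j<J. a j x)"
proof (induction J)
  case 0
  then show ?case by (auto simp: essentially_bounded_def)
next
  case (Suc J)
  then show ?case using assms by (simp add: essentially_bounded_add)
qed

lemma weighted_form_sum_weight:
  fixes a :: "nat \<Rightarrow> 'a::euclidean_space \<Rightarrow> real"
  assumes "D \<in> sets lebesgue" "\<And>j. essentially_bounded (lebesgue_on D) (a j)"
  shows "weighted_form D (\<lambda>x. \<Sum>j<J. a j x) h k = (\<Sum>j<J. weighted_form D (a j) h k)"
proof (induction J)
  case 0
  then show ?case by (simp add: weighted_form_def)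
next
  case (Suc J)
  then show ?case
    unfolding sum.lessThan_Suc
    by (subst weighted_form_add_weight[OF assms(1) essentially_bounded_sum[of _ a, OF assms(2)] assms(2)[of J]])
      (simp only: Suc.IH)
qed

definition truncate_param :: "nat \<Rightarrow> (nat \<Rightarrow> real) \<Rightarrow> nat \<Rightarrow> real" where
  "truncate_param J y j = (if j < J then y j else 0)"

lemma truncate_param_in_domain: "y \<in> param_domain \<Longrightarrow> truncate_param J y \<in> param_domain"
  by (auto simp: truncate_param_def param_domain_def)

lemma continuous_on_truncate_param: "continuous_on S (truncate_param J)"
proof (rule continuous_on_coordinatewise_then_product)
  fix j
  show "continuous_on S (\<lambda>y. truncate_param J y j)"
    unfolding truncate_param_def
    by (cases "j < J") (auto intro: continuous_on_subset[OF continuous_on_product_coordinates])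
qed

lemma affine_coefficient_truncate_param:
  "affine_coefficient abar \<psi> (truncate_param J y) x = abar x + (\<Sum>j<J. y j * \<psi> j x)"
proof -
  have "(\<Sum>j. truncate_param J y j * \<psi> j x) = (\<Sum>j<J. truncate_param J y j * \<psi> j x)"
    by (rule suminf_finite) (auto simp: truncate_param_def)
  then show ?thesis by (simp add: affine_coefficient_def truncate_param_def)
qed

locale affine_elliptic =
  fixes D :: "'a::euclidean_space set" and f abar :: "'a \<Rightarrow> real" and \<psi> :: "nat \<Rightarrow> 'a \<Rightarrow> real"
    and u :: "(nat \<Rightarrow> real) \<Rightarrow> 'a H1_pair" and \<rho> :: "nat \<Rightarrow> real" and r :: real
  assumes open_D: "open D" and bounded_D: "bounded D"
    and f: "square_integrable (lebesgue_on D) f"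
    and abar: "essentially_bounded (lebesgue_on D) abar"
    and \<psi>: "\<And>j. essentially_bounded (lebesgue_on D) (\<psi> j)"
    and solution: "\<And>y. y \<in> param_domain \<Longrightarrow> weak_solution D (affine_coefficient abar \<psi> y) f (u y)"
    and r: "r > 0"
    and weighted_ellipticity: "AE x in lebesgue_on D. summable (\<lambda>j. \<rho> j * \<bar>\<psi> j x\<bar>) \<and>
           (\<Sum>j. \<rho> j * \<bar>\<psi> j x\<bar>) \<le> abar x - r"
    and \<rho>_gt_1: "\<And>j. \<rho> j > 1"
    and \<rho>_inverse: "(\<lambda>j. inverse (\<rho> j)) \<longlonglongrightarrow> 0"
begin

definition form :: "('a \<Rightarrow> real) \<Rightarrow> 'a H1_pair \<Rightarrow> 'a H1_pair \<Rightarrow> real" where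
  "form a v w = weighted_form D a (snd v) (snd w)"

definition load_L2 :: "('a, real) L2" where
  "load_L2 = to_L2 (\<lambda>x. indicator D x *\<^sub>R f x)"

definition load :: "'a H1_pair \<Rightarrow> real" where
  "load v = load_L2 \<bullet> fst v"

definition domain_radius :: real where
  "domain_radius = (SOME B. B > 0 \<and> (\<forall>x\<in>D. norm x \<le> B))"

definition coefficient_bound :: real where
  "coefficient_bound = (SOME B. B > 0 \<and> (AE x in lebesgue_on D. \<bar>abar x\<bar> \<le> B))"

lemma domain_radius: "domain_radius > 0" "\<And>x. x \<in> D \<Longrightarrow> norm x \<le> domain_radius"
proof -
  have "\<exists>B. B > 0 \<and> (\<forall>x\<in>D. norm x \<le> B)" using bounded_D unfolding bounded_pos by simp
  from someI_ex[OF this] show "domain_radius > 0" "\<And>x. x \<in> D \<Longrightarrow> norm x \<le> domain_radius"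
    unfolding domain_radius_def by auto
qed

lemma coefficient_bound: "coefficient_bound > 0" "AE x in lebesgue_on D. \<bar>abar x\<bar> \<le> coefficient_bound"
proof -
  obtain B where B: "AE x in lebesgue_on D. \<bar>abar x\<bar> \<le> B"
    using abar by (auto simp: essentially_bounded_def)
  have "AE x in lebesgue_on D. \<bar>abar x\<bar> \<le> max B 1"
    using B by eventually_elim simp
  then have "\<exists>B. B > 0 \<and> (AE x in lebesgue_on D. \<bar>abar x\<bar> \<le> B)"
    by (intro exI[of _ "max B 1"]) simp
  from someI_ex[OF this] show "coefficient_bound > 0" "AE x in lebesgue_on D. \<bar>abar x\<bar> \<le> coefficient_bound"
    unfolding coefficient_bound_def by auto
qed

lemma D: "D \<in> sets lebesgue"
  using open_D by simp

lemma \<rho>_pos: "\<rho> j > 0"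
  using \<rho>_gt_1[of j] by simp

lemma weighted_sum_bound: "AE x in lebesgue_on D. summable (\<lambda>j. \<rho> j * \<bar>\<psi> j x\<bar>) \<and>
    (\<Sum>j. \<rho> j * \<bar>\<psi> j x\<bar>) \<le> abar x - r \<and> (\<Sum>j. \<rho> j * \<bar>\<psi> j x\<bar>) \<le> coefficient_bound"
  using weighted_ellipticity coefficient_bound(2) by eventually_elim (use r in auto)

text \<open>
  A perturbation of the parameters by at most \<open>t \<rho>\<^sub>j\<close> is controlled by the weighted ellipticity.
\<close>

lemma weighted_series:
  assumes s: "summable (\<lambda>j. \<rho> j * \<bar>\<psi> j x\<bar>)" and z: "\<And>j. \<bar>z j\<bar> \<le> t * \<rho> j" and t: "0 \<le> t"
  shows "summable (\<lambda>j. z j * \<psi> j x)" "\<bar>\<Sum>j. z j * \<psi> j x\<bar> \<le> t * (\<Sum>j. \<rho> j * \<bar>\<psi> j x\<bar>)"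
proof -
  have le: "\<bar>z j * \<psi> j x\<bar> \<le> t * (\<rho> j * \<bar>\<psi> j x\<bar>)" for j
    using mult_right_mono[OF z[of j], of "\<bar>\<psi> j x\<bar>"] by (simp add: abs_mult mult.assoc)
  have st: "summable (\<lambda>j. t * (\<rho> j * \<bar>\<psi> j x\<bar>))" by (rule summable_mult[OF s])
  have sa: "summable (\<lambda>j. \<bar>z j * \<psi> j x\<bar>)"
    by (rule summable_comparison_test'[OF st, of 0]) (use le in simp)
  then show "summable (\<lambda>j. z j * \<psi> j x)" by (rule summable_rabs_cancel)
  have "\<bar>\<Sum>j. z j * \<psi> j x\<bar> \<le> (\<Sum>j. \<bar>z j * \<psi> j x\<bar>)" by (rule summable_rabs[OF sa])
  also have "\<dots> \<le> (\<Sum>j. t * (\<rho> j * \<bar>\<psi> j x\<bar>))" by (rule suminf_le[OF le sa st])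
  also have "\<dots> = t * (\<Sum>j. \<rho> j * \<bar>\<psi> j x\<bar>)" by (rule suminf_mult[OF s])
  finally show "\<bar>\<Sum>j. z j * \<psi> j x\<bar> \<le> t * (\<Sum>j. \<rho> j * \<bar>\<psi> j x\<bar>)" .
qed

lemma param_le_\<rho>: "y \<in> param_domain \<Longrightarrow> \<bar>y j\<bar> \<le> 1 * \<rho> j"
  using \<rho>_gt_1[of j] by (auto simp: param_domain_def abs_le_iff dest!: spec[of _ j])

lemma measurable_affine_coefficient: "affine_coefficient abar \<psi> y \<in> borel_measurable (lebesgue_on D)"
proof -
  have "abar \<in> borel_measurable (lebesgue_on D)" "\<psi> j \<in> borel_measurable (lebesgue_on D)" for j
    using abar \<psi>[of j] by (auto simp: essentially_bounded_def)
  then show ?thesis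
    unfolding affine_coefficient_def[abs_def]
    by (intro borel_measurable_add borel_measurable_suminf borel_measurable_times) auto
qed

lemma affine_coefficient_bounds:
  assumes y: "y \<in> param_domain"
  shows "AE x in lebesgue_on D. r \<le> affine_coefficient abar \<psi> y x \<and>
    \<bar>affine_coefficient abar \<psi> y x\<bar> \<le> 2 * coefficient_bound"
  using weighted_sum_bound coefficient_bound(2)
proof eventually_elim
  case (elim x)
  then show ?case
    using weighted_series(2)[of x y 1] param_le_\<rho>[OF y] by (simp add: affine_coefficient_def abs_le_iff)
qed

lemma essentially_bounded_affine_coefficient:
  assumes "y \<in> param_domain"
  shows "essentially_bounded (lebesgue_on D) (affine_coefficient abar \<psi> y)"
  unfolding essentially_bounded_def
  using measurable_affine_coefficient affine_coefficient_bounds[OF assms] by (auto elim: AE_mp)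

lemma affine_coefficient_diff:
  assumes y: "y \<in> param_domain" "y' \<in> param_domain" and t: "0 \<le> t" "\<And>j. \<bar>y' j - y j\<bar> \<le> t * \<rho> j"
  shows "AE x in lebesgue_on D. \<bar>affine_coefficient abar \<psi> y' x - affine_coefficient abar \<psi> y x\<bar> \<le> t * coefficient_bound"
  using weighted_sum_bound
proof eventually_elim
  case (elim x)
  have s: "summable (\<lambda>j. y j * \<psi> j x)" "summable (\<lambda>j. y' j * \<psi> j x)"
    using weighted_series(1)[of x _ 1] elim param_le_\<rho> y by simp_all
  have "affine_coefficient abar \<psi> y' x - affine_coefficient abar \<psi> y x = (\<Sum>j. (y' j - y j) * \<psi> j x)"
    unfolding affine_coefficient_def using suminf_diff[OF s(2) s(1)] by (simp add: left_diff_distrib)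
  also have "\<bar>\<dots>\<bar> \<le> t * (\<Sum>j. \<rho> j * \<bar>\<psi> j x\<bar>)"
    using weighted_series(2)[of x "\<lambda>j. y' j - y j" t] elim t by simp
  also have "\<dots> \<le> t * coefficient_bound"
    using elim t(1) by (intro mult_left_mono) auto
  finally show ?case .
qed

lemma bounded_linear_form:
  assumes "essentially_bounded (lebesgue_on D) a"
  shows "bounded_linear (\<lambda>v. form a v w)"
  unfolding form_def
  by (rule bounded_linear_compose[OF bounded_bilinear.bounded_linear_left[OF bounded_bilinear_weighted_form[OF D assms]] bounded_linear_snd])

lemma form_commute: "form a v w = form a w v"
  unfolding form_def by (rule weighted_form_commute[OF D])

lemma load_eq: "load v = (\<integral>x. f x * rep_L2 (fst v) x \<partial>lebesgue_on D)"
proof -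
  have sq: "square_integrable lebesgue (\<lambda>x. indicator D x *\<^sub>R f x)"
    unfolding square_integrable_def
  proof
    have fm: "f \<in> borel_measurable (lebesgue_on D)" and fi: "integrable (lebesgue_on D) (\<lambda>x. (norm (f x))\<^sup>2)"
      using f by (auto simp: square_integrable_def)
    show "(\<lambda>x. indicator D x *\<^sub>R f x) \<in> borel_measurable lebesgue"
      using fm D by (subst (asm) borel_measurable_restrict_space_iff) (auto simp: mult.commute)
    have "integrable lebesgue (\<lambda>x. indicator D x *\<^sub>R (norm (f x))\<^sup>2)"
      using fi D by (subst (asm) integrable_restrict_space) auto
    moreover have "(norm (indicator D x *\<^sub>R f x))\<^sup>2 = indicator D x *\<^sub>R (norm (f x))\<^sup>2" for x
      by (auto simp: indicator_def)
    ultimately show "integrable lebesgue (\<lambda>x. (norm (indicator D x *\<^sub>R f x))\<^sup>2)" by simp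
  qed
  have "load v = (\<integral>x. rep_L2 load_L2 x \<bullet> rep_L2 (fst v) x \<partial>lebesgue)"
    unfolding load_def by (rule inner_L2_rep)
  also have "\<dots> = (\<integral>x. indicator D x *\<^sub>R (f x * rep_L2 (fst v) x) \<partial>lebesgue)"
  proof (rule integral_cong_AE)
    show "AE x in lebesgue. rep_L2 load_L2 x \<bullet> rep_L2 (fst v) x = indicator D x *\<^sub>R (f x * rep_L2 (fst v) x)"
      using rep_L2_to_L2[OF sq] unfolding load_L2_def by eventually_elim simp
    have "(\<lambda>x. (indicator D x *\<^sub>R f x) * rep_L2 (fst v) x) \<in> borel_measurable lebesgue"
      using sq by (intro borel_measurable_times rep_L2_borel_measurable) (simp add: square_integrable_def)
    then show "(\<lambda>x. indicator D x *\<^sub>R (f x * rep_L2 (fst v) x)) \<in> borel_measurable lebesgue"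
      by (simp add: mult.assoc)
  qed (intro borel_measurable_inner rep_L2_borel_measurable)
  also have "\<dots> = (\<integral>x. f x * rep_L2 (fst v) x \<partial>lebesgue_on D)"
    using D by (intro integral_restrict_space[symmetric]) simp
  finally show ?thesis .
qed

lemma weak_formulation:
  assumes "y \<in> param_domain"
  shows "u y \<in> H1_0 D" "\<And>v. v \<in> H1_0 D \<Longrightarrow> form (affine_coefficient abar \<psi> y) (u y) v = load v"
  using solution[OF assms] unfolding weak_solution_def load_eq form_def weighted_form_def by auto

lemma form_coercive:
  assumes a: "essentially_bounded (lebesgue_on D) a" "AE x in lebesgue_on D. r \<le> a x" and v: "v \<in> H1_0 D"
  shows "r * (norm (snd v))\<^sup>2 \<le> form a v v"
proof -
  have "r * (norm (snd v))\<^sup>2 = weighted_form D (\<lambda>x. r * 1) (snd v) (snd v)"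
    unfolding weighted_form_scale_weight[OF D] norm_snd_H1_0[OF D v] ..
  also have "\<dots> \<le> form a v v"
    unfolding form_def
    by (rule weighted_form_mono[OF D]) (use a in \<open>auto intro: essentially_bounded_const[OF D]\<close>)
  finally show ?thesis .
qed

lemma norm_H1_0_le: "v \<in> H1_0 D \<Longrightarrow> norm v \<le> (1 + 2 * domain_radius) * norm (snd v)"
proof -
  assume v: "v \<in> H1_0 D"
  have "norm v \<le> norm (fst v) + norm (snd v)"
    unfolding norm_prod_def by (rule sqrt_sum_squares_le_sum) auto
  also have "norm (fst v) \<le> 2 * domain_radius * norm (snd v)"
    by (rule poincare_H1_0[OF domain_radius(2) v])
  finally show ?thesis by (simp add: algebra_simps)
qed

lemma load_le: "\<bar>load v\<bar> \<le> norm load_L2 * norm v"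
proof -
  have "\<bar>load v\<bar> \<le> norm load_L2 * norm (fst v)" unfolding load_def by (rule Cauchy_Schwarz_ineq2)
  also have "\<dots> \<le> norm load_L2 * norm v"
    using norm_fst_le[of "fst v" "snd v"] by (intro mult_left_mono) auto
  finally show ?thesis .
qed

definition gradient_bound :: real where
  "gradient_bound = norm load_L2 * (1 + 2 * domain_radius) / r"

lemma gradient_bound_nonneg: "0 \<le> gradient_bound"
  using domain_radius(1) r by (simp add: gradient_bound_def)

lemma norm_gradient_solution_le:
  assumes "y \<in> param_domain"
  shows "norm (snd (u y)) \<le> gradient_bound"
proof -
  note uy = weak_formulation[OF assms]
  have "r * (norm (snd (u y)))\<^sup>2 \<le> load (u y)"
    using form_coercive[OF essentially_bounded_affine_coefficient[OF assms] _ uy(1)] affine_coefficient_bounds[OF assms]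
    unfolding uy(2)[OF uy(1)] by (auto elim: AE_mp)
  also have "\<dots> \<le> norm load_L2 * ((1 + 2 * domain_radius) * norm (snd (u y)))"
    using load_le[of "u y"] mult_left_mono[OF norm_H1_0_le[OF uy(1)], of "norm load_L2"] by simp
  finally have "norm (snd (u y)) * (r * norm (snd (u y))) \<le> norm (snd (u y)) * (norm load_L2 * (1 + 2 * domain_radius))"
    by (simp add: power2_eq_square mult_ac)
  then have "r * norm (snd (u y)) \<le> norm load_L2 * (1 + 2 * domain_radius)"
    using domain_radius(1) by (cases "norm (snd (u y)) = 0") (auto simp: mult_le_cancel_left)
  then show ?thesis using r by (simp add: gradient_bound_def field_simps)
qed

definition lipschitz_bound :: real where
  "lipschitz_bound = (1 + 2 * domain_radius) * (coefficient_bound * gradient_bound / r)"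

lemma lipschitz_bound_nonneg: "0 \<le> lipschitz_bound"
  using domain_radius(1) r coefficient_bound(1) gradient_bound_nonneg by (simp add: lipschitz_bound_def)

text \<open>
  Since \<open>\<bar>y\<^sub>j' - y\<^sub>j\<bar> \<le> t \<rho>\<^sub>j\<close> for all \<open>j\<close> makes the coefficients differ by at most a multiple of \<open>t\<close>,
  the solution is Lipschitz continuous for the metric \<open>sup\<^sub>j \<bar>y\<^sub>j' - y\<^sub>j\<bar> / \<rho>\<^sub>j\<close>, which induces the
  product topology because \<open>\<rho>\<^sub>j\<close> tends to infinity.
\<close>

lemma solution_lipschitz:
  assumes y: "y \<in> param_domain" "y' \<in> param_domain" and t: "0 \<le> t" "\<And>j. \<bar>y' j - y j\<bar> \<le> t * \<rho> j"
  shows "norm (u y - u y') \<le> lipschitz_bound * t"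
proof -
  define d where "d = u y - u y'"
  define a a' where "a = affine_coefficient abar \<psi> y" and "a' = affine_coefficient abar \<psi> y'"
  note u = weak_formulation[OF y(1)] and u' = weak_formulation[OF y(2)]
  have d: "d \<in> H1_0 D" unfolding d_def by (intro subspace_diff subspace_H1_0 u u')
  have ea: "essentially_bounded (lebesgue_on D) a" "essentially_bounded (lebesgue_on D) a'"
    unfolding a_def a'_def using essentially_bounded_affine_coefficient y by auto
  have "form a d d = form a (u y) d - form a (u y') d"
    unfolding d_def by (rule linear_diff[OF bounded_linear.linear[OF bounded_linear_form[OF ea(1)]]])
  also have "\<dots> = form a' (u y') d - form a (u y') d"
    using u(2)[OF d] u'(2)[OF d] by (simp add: a_def a'_def)
  also have "\<dots> = weighted_form D (\<lambda>x. a' x - a x) (snd (u y')) (snd d)"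
    using weighted_form_add_weight[OF D ea(2) essentially_bounded_scale[OF ea(1), of "-1"], of "snd (u y')" "snd d"]
      weighted_form_scale_weight[OF D, of "-1" a "snd (u y')" "snd d"] by (simp add: form_def)
  also have "\<dots> \<le> (t * coefficient_bound) * (norm (snd (u y')) * norm (snd d))"
  proof (rule order_trans[OF abs_ge_self weighted_form_bound[OF D]])
    show "(\<lambda>x. a' x - a x) \<in> borel_measurable (lebesgue_on D)"
      unfolding a_def a'_def by (intro borel_measurable_diff measurable_affine_coefficient)
    show "AE x in lebesgue_on D. \<bar>a' x - a x\<bar> \<le> t * coefficient_bound"
      unfolding a_def a'_def by (rule affine_coefficient_diff[OF y t])
  qed (use t coefficient_bound in auto)
  also have "\<dots> \<le> (t * coefficient_bound) * (gradient_bound * norm (snd d))"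
    using norm_gradient_solution_le[OF y(2)] t coefficient_bound(1)
    by (intro mult_left_mono mult_right_mono) auto
  finally have "r * (norm (snd d))\<^sup>2 \<le> (t * coefficient_bound) * (gradient_bound * norm (snd d))"
    using form_coercive[OF ea(1) _ d] affine_coefficient_bounds[OF y(1)] unfolding a_def
    by (auto elim!: AE_mp)
  then have "norm (snd d) * (r * norm (snd d)) \<le> norm (snd d) * (t * coefficient_bound * gradient_bound)"
    by (simp add: power2_eq_square mult_ac)
  then have "r * norm (snd d) \<le> t * coefficient_bound * gradient_bound"
    using t coefficient_bound(1) gradient_bound_nonneg by (cases "norm (snd d) = 0") (auto simp: mult_le_cancel_left)
  then have "norm (snd d) \<le> t * (coefficient_bound * gradient_bound / r)"
    using r by (simp add: field_simps)
  then have "(1 + 2 * domain_radius) * norm (snd d) \<le> (1 + 2 * domain_radius) * (t * (coefficient_bound * gradient_bound / r))"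
    using domain_radius(1) by (intro mult_left_mono) auto
  with norm_H1_0_le[OF d] have "norm d \<le> lipschitz_bound * t"
    by (simp add: lipschitz_bound_def mult_ac)
  then show ?thesis by (simp add: d_def)
qed

lemma eventually_le_\<rho>:
  assumes "t > 0"
  obtains J where "\<And>j. J \<le> j \<Longrightarrow> 2 \<le> t * \<rho> j"
proof -
  have "\<forall>\<^sub>F j in sequentially. inverse (\<rho> j) < t / 2"
    using order_tendstoD(2)[OF \<rho>_inverse, of "t / 2"] assms by simp
  then obtain J where "\<And>j. J \<le> j \<Longrightarrow> inverse (\<rho> j) < t / 2"
    unfolding eventually_sequentially by blast
  then have "2 \<le> t * \<rho> j" if "J \<le> j" for j
    using that[THEN \<open>\<And>j. J \<le> j \<Longrightarrow> inverse (\<rho> j) < t / 2\<close>] \<rho>_pos[of j] by (simp add: field_simps)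
  then show ?thesis using that by blast
qed

lemma continuous_on_solution: "continuous_on param_domain u"
  unfolding continuous_on_topological
proof (intro ballI allI impI)
  fix y B assume y: "y \<in> param_domain" and B: "open B" "u y \<in> B"
  then obtain \<epsilon> where \<epsilon>: "\<epsilon> > 0" "ball (u y) \<epsilon> \<subseteq> B" using open_contains_ball by blast
  define t where "t = \<epsilon> / (lipschitz_bound + 1)"
  have t: "t > 0" "lipschitz_bound * t < \<epsilon>"
    using \<epsilon>(1) lipschitz_bound_nonneg by (auto simp: t_def field_simps)
  obtain J where J: "\<And>j. J \<le> j \<Longrightarrow> 2 \<le> t * \<rho> j" using eventually_le_\<rho>[OF t(1)] by blast
  define A where "A = {z. \<forall>j\<in>{..<J}. z j \<in> ball (y j) t}"
  have "open A"
    unfolding A_def by (rule product_topology_basis'[where x="\<lambda>j. j"]) auto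
  moreover have "y \<in> A" using t by (simp add: A_def)
  moreover have "u z \<in> B" if z: "z \<in> param_domain" "z \<in> A" for z
  proof -
    have "\<bar>z j - y j\<bar> \<le> t * \<rho> j" for j
    proof (cases "j < J")
      case True
      then have "\<bar>z j - y j\<bar> \<le> t" using z(2) by (simp add: A_def dist_real_def abs_minus_commute less_imp_le)
      also have "\<dots> \<le> t * \<rho> j" using t(1) \<rho>_gt_1[of j] by simp
      finally show ?thesis .
    next
      case False
      have "\<bar>z j\<bar> \<le> 1" "\<bar>y j\<bar> \<le> 1" using z(1) y by (auto simp: param_domain_def abs_le_iff dest!: spec[of _ j])
      then show ?thesis using J[of j] False by linarith
    qed
    then have "norm (u y - u z) \<le> lipschitz_bound * t"
      using t(1) by (intro solution_lipschitz y z(1)) auto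
    then show ?thesis using t(2) \<epsilon>(2) by (auto simp: dist_norm subset_eq)
  qed
  ultimately show "\<exists>A. open A \<and> y \<in> A \<and> (\<forall>z\<in>param_domain. z \<in> A \<longrightarrow> u z \<in> B)" by blast
qed

definition solution_bound :: real where
  "solution_bound = (1 + 2 * domain_radius) * gradient_bound"

lemma norm_solution_le:
  assumes "y \<in> param_domain"
  shows "norm (u y) \<le> solution_bound"
  unfolding solution_bound_def
  by (rule order_trans[OF norm_H1_0_le[OF weak_formulation(1)[OF assms]]
      mult_left_mono[OF norm_gradient_solution_le[OF assms]]]) (use domain_radius(1) in simp)

text \<open>
  With only the first \<open>J\<close> parameters active, the equations for the Legendre coefficients contain
  finite sums over \<open>j\<close>.  The bounds do not depend on \<open>J\<close>, which finally tends to infinity.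
\<close>

definition u_trunc :: "nat \<Rightarrow> (nat \<Rightarrow> real) \<Rightarrow> 'a H1_pair" where
  "u_trunc J y = u (truncate_param J y)"

lemma continuous_on_u_trunc: "continuous_on param_domain (u_trunc J)"
  unfolding u_trunc_def
  by (rule continuous_on_compose2[OF continuous_on_solution continuous_on_truncate_param])
    (auto intro: truncate_param_in_domain)

lemma norm_u_trunc_le: "y \<in> param_domain \<Longrightarrow> norm (u_trunc J y) \<le> solution_bound"
  unfolding u_trunc_def by (intro norm_solution_le truncate_param_in_domain)

lemma u_trunc_weak_formulation:
  assumes y: "y \<in> param_domain" and v: "v \<in> H1_0 D"
  shows "form abar (u_trunc J y) v + (\<Sum>j<J. y j * form (\<psi> j) (u_trunc J y) v) = load v"
proof -
  have a: "affine_coefficient abar \<psi> (truncate_param J y) = (\<lambda>x. abar x + (\<Sum>j<J. y j * \<psi> j x))"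
    by (rule ext) (rule affine_coefficient_truncate_param)
  have e: "essentially_bounded (lebesgue_on D) (\<lambda>x. y j * \<psi> j x)" for j
    by (rule essentially_bounded_scale[OF \<psi>])
  have "load v = form (affine_coefficient abar \<psi> (truncate_param J y)) (u_trunc J y) v"
    unfolding u_trunc_def using weak_formulation(2)[OF truncate_param_in_domain[OF y] v] by simp
  also have "\<dots> = form abar (u_trunc J y) v + (\<Sum>j<J. y j * form (\<psi> j) (u_trunc J y) v)"
    unfolding a form_def
    by (simp add: weighted_form_add_weight[OF D abar essentially_bounded_sum[OF e]]
        weighted_form_sum_weight[OF D e] weighted_form_scale_weight[OF D])
  finally show ?thesis by simp
qed

abbreviation "w_trunc J \<equiv> fourier_legendre (u_trunc J)"

lemma w_trunc_in_H1_0: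
  assumes "\<nu> \<in> multi_indices"
  shows "w_trunc J \<nu> \<in> H1_0 D"
proof -
  have "u_trunc J ` param_domain \<subseteq> H1_0 D"
    unfolding u_trunc_def using weak_formulation(1) truncate_param_in_domain by auto
  then have "span (u_trunc J ` param_domain) \<subseteq> H1_0 D"
    by (rule span_minimal) (rule subspace_H1_0)
  then have "closure (span (u_trunc J ` param_domain)) \<subseteq> H1_0 D"
    by (rule closure_minimal) (rule closed_H1_0)
  then show ?thesis using fourier_legendre_in_closure_span[OF continuous_on_u_trunc assms] by blast
qed

text \<open>
  The mean of the weak formulation against \<open>L\<^sub>\<nu>\<close>: multiplication by \<open>y\<^sub>j\<close> becomes the coupling of
  neighbouring coefficients, and the load, being independent of \<open>y\<close>, is seen only by \<open>\<nu> = 0\<close>.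
\<close>

lemma w_trunc_equation:
  assumes \<nu>: "\<nu> \<in> multi_indices" and v: "v \<in> H1_0 D"
  shows "form abar (w_trunc J \<nu>) v + (\<Sum>j<J. jacobi (Suc (\<nu> j)) * form (\<psi> j) (w_trunc J (\<nu>(j := Suc (\<nu> j)))) v
      + jacobi (\<nu> j) * form (\<psi> j) (w_trunc J (\<nu>(j := \<nu> j - 1))) v) = (if \<nu> = (\<lambda>_. 0) then load v else 0)"
proof -
  let ?U = "u_trunc J" and ?L = legendre_multi
  note c = continuous_on_u_trunc[of J]
  have i: "integrable param_measure (\<lambda>y. ?L \<mu> y *\<^sub>R ?U y)" for \<mu>
    by (rule integrable_legendre_scaleR[OF c])
  have form_w: "integrable param_measure (\<lambda>y. form a (?L \<mu> y *\<^sub>R ?U y) v)"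
      "(\<integral>y. form a (?L \<mu> y *\<^sub>R ?U y) v \<partial>param_measure) = form a (w_trunc J \<mu>) v"
    if a: "essentially_bounded (lebesgue_on D) a" for a \<mu>
    using integrable_bounded_linear[OF bounded_linear_form[OF a] i]
      integral_bounded_linear[OF bounded_linear_form[OF a] i] by (auto simp: fourier_legendre_def)
  have scale: "form a (c *\<^sub>R h) v = c * form a h v" if "essentially_bounded (lebesgue_on D) a" for a c h
    unfolding form_def using weighted_form_scaleR_left[OF D that] by simp
  have pointwise: "form abar (?L \<nu> y *\<^sub>R ?U y) v + (\<Sum>j<J.
        jacobi (Suc (\<nu> j)) * form (\<psi> j) (?L (\<nu>(j := Suc (\<nu> j))) y *\<^sub>R ?U y) v +
        jacobi (\<nu> j) * form (\<psi> j) (?L (\<nu>(j := \<nu> j - 1)) y *\<^sub>R ?U y) v) = load v * ?L \<nu> y"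
    if y: "y \<in> param_domain" for y
  proof -
    have "jacobi (Suc (\<nu> j)) * form (\<psi> j) (?L (\<nu>(j := Suc (\<nu> j))) y *\<^sub>R ?U y) v +
        jacobi (\<nu> j) * form (\<psi> j) (?L (\<nu>(j := \<nu> j - 1)) y *\<^sub>R ?U y) v =
        (y j * ?L \<nu> y) * form (\<psi> j) (?U y) v" for j
      unfolding legendre_multi_recurrence[OF \<nu>] scale[OF \<psi>] by (simp add: algebra_simps)
    then have "form abar (?L \<nu> y *\<^sub>R ?U y) v + (\<Sum>j<J.
        jacobi (Suc (\<nu> j)) * form (\<psi> j) (?L (\<nu>(j := Suc (\<nu> j))) y *\<^sub>R ?U y) v +
        jacobi (\<nu> j) * form (\<psi> j) (?L (\<nu>(j := \<nu> j - 1)) y *\<^sub>R ?U y) v) =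
        ?L \<nu> y * (form abar (?U y) v + (\<Sum>j<J. y j * form (\<psi> j) (?U y) v))"
      by (simp add: scale[OF abar] distrib_left sum_distrib_left mult_ac)
    then show ?thesis unfolding u_trunc_weak_formulation[OF y v] by (simp add: mult.commute)
  qed
  have ij: "integrable param_measure (\<lambda>y. jacobi (Suc (\<nu> j)) * form (\<psi> j) (?L (\<nu>(j := Suc (\<nu> j))) y *\<^sub>R ?U y) v +
        jacobi (\<nu> j) * form (\<psi> j) (?L (\<nu>(j := \<nu> j - 1)) y *\<^sub>R ?U y) v)" for j
    by (intro Bochner_Integration.integrable_add integrable_mult_right form_w \<psi>)
  have "form abar (w_trunc J \<nu>) v + (\<Sum>j<J. jacobi (Suc (\<nu> j)) * form (\<psi> j) (w_trunc J (\<nu>(j := Suc (\<nu> j)))) v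
      + jacobi (\<nu> j) * form (\<psi> j) (w_trunc J (\<nu>(j := \<nu> j - 1))) v) =
    (\<integral>y. form abar (?L \<nu> y *\<^sub>R ?U y) v + (\<Sum>j<J.
        jacobi (Suc (\<nu> j)) * form (\<psi> j) (?L (\<nu>(j := Suc (\<nu> j))) y *\<^sub>R ?U y) v +
        jacobi (\<nu> j) * form (\<psi> j) (?L (\<nu>(j := \<nu> j - 1)) y *\<^sub>R ?U y) v) \<partial>param_measure)"
  proof -
    have "(\<integral>y. jacobi (Suc (\<nu> j)) * form (\<psi> j) (?L (\<nu>(j := Suc (\<nu> j))) y *\<^sub>R ?U y) v +
        jacobi (\<nu> j) * form (\<psi> j) (?L (\<nu>(j := \<nu> j - 1)) y *\<^sub>R ?U y) v \<partial>param_measure) =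
        jacobi (Suc (\<nu> j)) * form (\<psi> j) (w_trunc J (\<nu>(j := Suc (\<nu> j)))) v
        + jacobi (\<nu> j) * form (\<psi> j) (w_trunc J (\<nu>(j := \<nu> j - 1))) v" for j
      by (subst Bochner_Integration.integral_add)
        (simp_all only: integrable_mult_right integral_mult_right_zero form_w[OF \<psi>])
    then show ?thesis
      by (subst Bochner_Integration.integral_add)
        (simp_all only: form_w[OF abar] Bochner_Integration.integrable_sum ij Bochner_Integration.integral_sum)
  qed
  also have "\<dots> = (\<integral>y. load v * ?L \<nu> y \<partial>param_measure)"
    by (rule Bochner_Integration.integral_cong[OF refl]) (use pointwise in \<open>simp add: space_param_measure\<close>)
  also have "\<dots> = load v * (if \<nu> = (\<lambda>_. 0) then 1 else 0)"
    using legendre_multi_orthonormal(2)[OF \<nu> multi_indices_0] by simp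
  finally show ?thesis by simp
qed

definition coefficient_sum_bound :: real where
  "coefficient_sum_bound = (1 + 2 * domain_radius)\<^sup>2 * (norm load_L2 * solution_bound / r)"

text \<open>
  The weighted ellipticity is the coercivity required by the energy estimate, with
  \<open>Q\<^sub>j v\<close> the integral of \<open>\<bar>\<psi>\<^sub>j\<bar> \<bar>\<nabla>v\<bar>\<^sup>2\<close>.
\<close>

lemma weighted_sum_w_trunc_le:
  assumes X: "X \<subseteq> index_box J N"
  shows "(\<Sum>\<nu>\<in>X. (\<Prod>j<J. \<rho> j ^ \<nu> j)\<^sup>2 * (norm (w_trunc J \<nu>))\<^sup>2) \<le> coefficient_sum_bound"
proof -
  note c = continuous_on_u_trunc[of J]
  have mi: "\<nu> \<in> multi_indices" if "\<nu> \<in> index_box J K" for \<nu> K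
    using that index_box_subset by blast
  have \<psi>_bound: "AE x in lebesgue_on D. \<bar>\<psi> j x\<bar> \<le> coefficient_bound" for j
    using weighted_sum_bound
  proof eventually_elim
    case (elim x)
    have "\<bar>\<psi> j x\<bar> \<le> \<rho> j * \<bar>\<psi> j x\<bar>" using \<rho>_gt_1[of j] by (simp add: mult_le_cancel_right1)
    also have "\<dots> \<le> (\<Sum>j. \<rho> j * \<bar>\<psi> j x\<bar>)"
      using elim \<rho>_pos by (intro sum_le_suminf[of _ "{j}", simplified]) (auto simp: less_imp_le)
    finally show ?case using elim by simp
  qed
  have "(\<Sum>\<nu>\<in>X. (\<Prod>j<J. \<rho> j ^ \<nu> j)\<^sup>2 * (r * (norm (snd (w_trunc J \<nu>)))\<^sup>2)) \<le> load (w_trunc J (\<lambda>_. 0))"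
  proof (rule weighted_energy[where A="\<lambda>v. form abar v v" and B="\<lambda>j. form (\<psi> j)"
        and Q="\<lambda>j v. form (\<lambda>x. \<bar>\<psi> j x\<bar>) v v" and \<beta>=coefficient_bound and N=N])
    fix K \<nu> assume \<nu>: "\<nu> \<in> index_box J K"
    note w = w_trunc_in_H1_0[OF mi[OF \<nu>], of J]
    show "form abar (w_trunc J \<nu>) (w_trunc J \<nu>) +
        (\<Sum>j<J. jacobi (Suc (\<nu> j)) * form (\<psi> j) (w_trunc J (\<nu>(j := Suc (\<nu> j)))) (w_trunc J \<nu>)
        + jacobi (\<nu> j) * form (\<psi> j) (w_trunc J (\<nu>(j := \<nu> j - 1))) (w_trunc J \<nu>)) =
        (if \<nu> = (\<lambda>_. 0) then load (w_trunc J (\<lambda>_. 0)) else 0)"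
      using w_trunc_equation[OF mi[OF \<nu>] w] by simp
    let ?v = "snd (w_trunc J \<nu>)"
    have e: "essentially_bounded (lebesgue_on D) (\<lambda>x. \<rho> j * \<bar>\<psi> j x\<bar>)" for j
      by (intro essentially_bounded_scale essentially_bounded_abs \<psi>)
    have "(\<Sum>j<J. \<rho> j * form (\<lambda>x. \<bar>\<psi> j x\<bar>) (w_trunc J \<nu>) (w_trunc J \<nu>)) + r * (norm ?v)\<^sup>2 =
        weighted_form D (\<lambda>x. (\<Sum>j<J. \<rho> j * \<bar>\<psi> j x\<bar>) + r * 1) ?v ?v"
      unfolding weighted_form_add_weight[OF D essentially_bounded_sum[OF e] essentially_bounded_const[OF D]]
        weighted_form_sum_weight[OF D e] weighted_form_scale_weight[OF D] norm_snd_H1_0[OF D w] form_def ..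
    also have "\<dots> \<le> weighted_form D abar ?v ?v"
    proof (rule weighted_form_mono[OF D essentially_bounded_add[OF essentially_bounded_sum[OF e] essentially_bounded_const[OF D]] abar])
      show "AE x in lebesgue_on D. (\<Sum>j<J. \<rho> j * \<bar>\<psi> j x\<bar>) + r * 1 \<le> abar x"
        using weighted_sum_bound
      proof eventually_elim
        case (elim x)
        then have "(\<Sum>j<J. \<rho> j * \<bar>\<psi> j x\<bar>) \<le> (\<Sum>j. \<rho> j * \<bar>\<psi> j x\<bar>)"
          using \<rho>_pos by (intro sum_le_suminf) (auto simp: less_imp_le)
        then show ?case using elim by simp
      qed
    qed
    finally show "(\<Sum>j<J. \<rho> j * form (\<lambda>x. \<bar>\<psi> j x\<bar>) (w_trunc J \<nu>) (w_trunc J \<nu>)) + r * (norm ?v)\<^sup>2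
        \<le> form abar (w_trunc J \<nu>) (w_trunc J \<nu>)"
      by (simp add: form_def)
  next
    show "\<bar>form (\<psi> j) v w\<bar> \<le> (s * form (\<lambda>x. \<bar>\<psi> j x\<bar>) v v + form (\<lambda>x. \<bar>\<psi> j x\<bar>) w w / s) / 2"
      if "s > 0" for s j v w
      unfolding form_def by (rule weighted_form_young[OF D \<psi> that])
    show "form (\<psi> j) v w = form (\<psi> j) w v" for j v w by (rule form_commute)
    show "0 \<le> form (\<lambda>x. \<bar>\<psi> j x\<bar>) v v" for j v
      unfolding form_def by (rule weighted_form_nonneg[OF D]) simp
    show "0 \<le> r * (norm (snd v))\<^sup>2" for v :: "'a H1_pair" using r by simp
    show "\<bar>form (\<psi> j) v w\<bar> \<le> coefficient_bound * norm v * norm w" for j v w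
    proof -
      have "\<bar>form (\<psi> j) v w\<bar> \<le> coefficient_bound * (norm (snd v) * norm (snd w))"
        unfolding form_def
        by (rule weighted_form_bound[OF D _ \<psi>_bound]) (use \<psi>[of j] coefficient_bound(1) in \<open>auto simp: essentially_bounded_def\<close>)
      also have "\<dots> \<le> coefficient_bound * (norm v * norm w)"
        using norm_snd_le[of "snd v" "fst v"] norm_snd_le[of "snd w" "fst w"] coefficient_bound(1)
        by (intro mult_left_mono mult_mono) auto
      finally show ?thesis by (simp add: mult.assoc)
    qed
    show "(\<Sum>\<nu>\<in>Y. (norm (w_trunc J \<nu>))\<^sup>2) \<le> (\<integral>y. (norm (u_trunc J y))\<^sup>2 \<partial>param_measure)"
      if "finite Y" "Y \<subseteq> multi_indices" for Y
      by (rule bessel_fourier_legendre[OF c that])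
    show "1 \<le> \<rho> j" for j using \<rho>_gt_1[of j] by simp
  qed (rule X)
  also have "\<dots> \<le> norm load_L2 * solution_bound"
  proof -
    have "(norm (w_trunc J (\<lambda>_. 0)))\<^sup>2 \<le> (\<integral>y. (norm (u_trunc J y))\<^sup>2 \<partial>param_measure)"
      using bessel_fourier_legendre[OF c, of "{\<lambda>_. 0}"] multi_indices_0 by simp
    also have "\<dots> \<le> solution_bound\<^sup>2"
      by (rule mean_square_le[OF c norm_u_trunc_le])
    finally have "norm (w_trunc J (\<lambda>_. 0)) \<le> solution_bound"
      by (rule power2_le_imp_le) (use domain_radius(1) gradient_bound_nonneg in \<open>simp add: solution_bound_def\<close>)
    then have "norm load_L2 * norm (w_trunc J (\<lambda>_. 0)) \<le> norm load_L2 * solution_bound"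
      by (intro mult_left_mono) auto
    then show ?thesis using load_le[of "w_trunc J (\<lambda>_. 0)"] by simp
  qed
  finally have main: "(\<Sum>\<nu>\<in>X. (\<Prod>j<J. \<rho> j ^ \<nu> j)\<^sup>2 * (r * (norm (snd (w_trunc J \<nu>)))\<^sup>2)) \<le> norm load_L2 * solution_bound" .
  have "(\<Sum>\<nu>\<in>X. (\<Prod>j<J. \<rho> j ^ \<nu> j)\<^sup>2 * (norm (w_trunc J \<nu>))\<^sup>2) \<le>
      (\<Sum>\<nu>\<in>X. (1 + 2 * domain_radius)\<^sup>2 / r * ((\<Prod>j<J. \<rho> j ^ \<nu> j)\<^sup>2 * (r * (norm (snd (w_trunc J \<nu>)))\<^sup>2)))"
  proof (rule sum_mono)
    fix \<nu> assume "\<nu> \<in> X"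
    then have "w_trunc J \<nu> \<in> H1_0 D" using X mi by (intro w_trunc_in_H1_0) auto
    from power_mono[OF norm_H1_0_le[OF this] norm_ge_zero, of 2]
    have "(norm (w_trunc J \<nu>))\<^sup>2 \<le> (1 + 2 * domain_radius)\<^sup>2 * (norm (snd (w_trunc J \<nu>)))\<^sup>2"
      by (simp add: power_mult_distrib)
    from mult_left_mono[OF this, of "(\<Prod>j<J. \<rho> j ^ \<nu> j)\<^sup>2"]
    show "(\<Prod>j<J. \<rho> j ^ \<nu> j)\<^sup>2 * (norm (w_trunc J \<nu>))\<^sup>2 \<le>
        (1 + 2 * domain_radius)\<^sup>2 / r * ((\<Prod>j<J. \<rho> j ^ \<nu> j)\<^sup>2 * (r * (norm (snd (w_trunc J \<nu>)))\<^sup>2))"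
      using r by (simp add: mult_ac)
  qed
  also have "\<dots> \<le> (1 + 2 * domain_radius)\<^sup>2 / r * (norm load_L2 * solution_bound)"
    unfolding sum_distrib_left[symmetric] using main r by (intro mult_left_mono) auto
  finally show ?thesis by (simp add: coefficient_sum_bound_def)
qed

lemma w_trunc_tendsto:
  assumes \<nu>: "\<nu> \<in> multi_indices"
  shows "(\<lambda>J. w_trunc J \<nu>) \<longlonglongrightarrow> fourier_legendre u \<nu>"
proof (rule LIMSEQ_I)
  fix \<epsilon> :: real assume \<epsilon>: "\<epsilon> > 0"
  define t where "t = \<epsilon> / (lipschitz_bound + 1)"
  have t: "t > 0" "lipschitz_bound * t < \<epsilon>"
    using \<epsilon> lipschitz_bound_nonneg by (auto simp: t_def field_simps)
  obtain J0 where J0: "\<And>j. J0 \<le> j \<Longrightarrow> 2 \<le> t * \<rho> j" using eventually_le_\<rho>[OF t(1)] by blast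
  have "norm (w_trunc J \<nu> - fourier_legendre u \<nu>) < \<epsilon>" if J: "J0 \<le> J" for J
  proof -
    have le: "norm (u_trunc J y - u y) \<le> lipschitz_bound * t" if y: "y \<in> param_domain" for y
      unfolding u_trunc_def
    proof (rule solution_lipschitz)
      fix j
      have "\<bar>y j\<bar> \<le> 1" using y by (auto simp: param_domain_def abs_le_iff dest!: spec[of _ j])
      then show "\<bar>y j - truncate_param J y j\<bar> \<le> t * \<rho> j"
        using J0[of j] J t(1) \<rho>_pos[of j] by (cases "j < J") (auto simp: truncate_param_def)
    qed (use y t truncate_param_in_domain in auto)
    have c: "continuous_on param_domain (\<lambda>y. u_trunc J y - u y)"
      by (intro continuous_intros continuous_on_u_trunc continuous_on_solution)
    have "w_trunc J \<nu> - fourier_legendre u \<nu> = fourier_legendre (\<lambda>y. u_trunc J y - u y) \<nu>"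
      unfolding fourier_legendre_def scaleR_diff_right
      by (intro Bochner_Integration.integral_diff[symmetric] integrable_legendre_scaleR continuous_on_u_trunc continuous_on_solution)
    moreover have "(norm (fourier_legendre (\<lambda>y. u_trunc J y - u y) \<nu>))\<^sup>2 \<le> (lipschitz_bound * t)\<^sup>2"
      using bessel_fourier_legendre[OF c, of "{\<nu>}"] \<nu> mean_square_le[OF c le] by simp
    ultimately have "(norm (w_trunc J \<nu> - fourier_legendre u \<nu>))\<^sup>2 \<le> (lipschitz_bound * t)\<^sup>2"
      by simp
    then have "norm (w_trunc J \<nu> - fourier_legendre u \<nu>) \<le> lipschitz_bound * t"
      by (rule power2_le_imp_le) (use lipschitz_bound_nonneg t(1) in simp)
    then show ?thesis using t(2) by simp
  qed
  then show "\<exists>J0. \<forall>J\<ge>J0. norm (w_trunc J \<nu> - fourier_legendre u \<nu>) < \<epsilon>" by blast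
qed

text \<open>
  The coefficients decay like \<open>\<rho>\<^bsup>-\<nu>\<^esup>\<close> in the square mean.  The sum is finite, so the bounds for
  the truncated problems pass to the limit.
\<close>

lemma weighted_sum_fourier_legendre_le:
  assumes X: "finite X" "X \<subseteq> multi_indices"
  shows "(\<Sum>\<nu>\<in>X. (multi_power \<rho> \<nu> * norm (fourier_legendre u \<nu>))\<^sup>2) \<le> coefficient_sum_bound"
proof -
  obtain J0 N where N: "0 \<le> J0" "X \<subseteq> index_box J0 N"
    by (rule finite_subset_index_box[OF X])
  have box: "index_box J0 N \<subseteq> index_box J N" if "J0 \<le> J" for J
  proof
    fix \<nu> assume \<nu>: "\<nu> \<in> index_box J0 N"
    have "\<nu> j \<le> N" for j using \<nu> by (cases "j < J0") (auto simp: index_box_def)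
    then show "\<nu> \<in> index_box J N" using \<nu> that by (auto simp: index_box_def)
  qed
  have power: "(\<Prod>j<J. \<rho> j ^ \<nu> j) = multi_power \<rho> \<nu>" if "J0 \<le> J" "\<nu> \<in> X" for J \<nu>
  proof -
    have "\<nu> \<in> index_box J N" using that N(2) box by blast
    then have "\<nu> j = 0" if "\<not> j < J" for j using that by (simp add: index_box_def)
    then have "{j. \<nu> j \<noteq> 0} \<subseteq> {..<J}" by (metis (mono_tags, lifting) lessThan_iff mem_Collect_eq subsetI)
    then show ?thesis
      unfolding multi_power_def by (intro prod.mono_neutral_right) auto
  qed
  have "(\<lambda>J. \<Sum>\<nu>\<in>X. (multi_power \<rho> \<nu> * norm (w_trunc J \<nu>))\<^sup>2) \<longlonglongrightarrow>
      (\<Sum>\<nu>\<in>X. (multi_power \<rho> \<nu> * norm (fourier_legendre u \<nu>))\<^sup>2)"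
    using X(2) by (intro tendsto_sum tendsto_power tendsto_mult tendsto_const tendsto_norm w_trunc_tendsto) auto
  moreover have "(\<Sum>\<nu>\<in>X. (multi_power \<rho> \<nu> * norm (w_trunc J \<nu>))\<^sup>2) \<le> coefficient_sum_bound" if J: "J0 \<le> J" for J
  proof -
    have "(\<Sum>\<nu>\<in>X. (multi_power \<rho> \<nu> * norm (w_trunc J \<nu>))\<^sup>2) =
        (\<Sum>\<nu>\<in>X. (\<Prod>j<J. \<rho> j ^ \<nu> j)\<^sup>2 * (norm (w_trunc J \<nu>))\<^sup>2)"
      using power[OF J] by (intro sum.cong refl) (simp add: power_mult_distrib)
    also have "\<dots> \<le> coefficient_sum_bound"
      using N(2) box[OF J] by (intro weighted_sum_w_trunc_le[of X J N]) auto
    finally show ?thesis .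
  qed
  ultimately show ?thesis by (intro LIMSEQ_le_const2) auto
qed

end

section \<open>Convergence rates\<close>

context affine_elliptic
begin

lemma truncated_legendre_eq:
  "truncated_legendre u \<Lambda> y = (\<Sum>\<nu>\<in>\<Lambda>. legendre_multi \<nu> y *\<^sub>R fourier_legendre u \<nu>)"
  by (simp add: truncated_legendre_def legendre_coeff_def fourier_legendre_def)

lemma coefficient_sum_bound_nonneg: "0 \<le> coefficient_sum_bound"
  using weighted_sum_fourier_legendre_le[of "{}"] by simp

lemma multi_power_inverse:
  "multi_power (\<lambda>j. inverse (\<rho> j)) \<nu> > 0"
  "multi_power (\<lambda>j. inverse (\<rho> j)) \<nu> * multi_power \<rho> \<nu> = 1"
proof -
  show "multi_power (\<lambda>j. inverse (\<rho> j)) \<nu> > 0"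
    unfolding multi_power_def using \<rho>_pos by (intro prod_pos) simp
  have "inverse (\<rho> j) ^ \<nu> j * \<rho> j ^ \<nu> j = 1" for j
    using \<rho>_pos[of j] by (simp flip: power_mult_distrib)
  then show "multi_power (\<lambda>j. inverse (\<rho> j)) \<nu> * multi_power \<rho> \<nu> = 1"
    unfolding multi_power_def prod.distrib[symmetric] by simp
qed

context
  fixes q :: real
  assumes q: "q > 0" and summable_q: "summable (\<lambda>j. (inverse (\<rho> j)) powr q)"
begin

text \<open>
  Each discarded coefficient satisfies \<open>\<parallel>w\<^sub>\<nu>\<parallel> = b\<^sup>\<nu> (\<rho>\<^sup>\<nu> \<parallel>w\<^sub>\<nu>\<parallel>)\<close> with \<open>b\<^sup>\<nu> \<le> \<kappa>\<^sub>\<nu>\<close>, which is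
  \<open>O(n\<^bsup>-1/q\<^esup>)\<close>, and the second factors are square summable.
\<close>

lemma mean_square_rate:
  "\<exists>C. \<forall>n\<ge>1. \<forall>\<Lambda>. n_largest (monotone_majorant (\<lambda>\<nu>. multi_power (\<lambda>j. inverse (\<rho> j)) \<nu> * beta_weight \<nu>)) n \<Lambda> \<longrightarrow>
    square_integrable param_measure (\<lambda>y. u y - truncated_legendre u \<Lambda> y) \<and>
    L2_norm param_measure (\<lambda>y. u y - truncated_legendre u \<Lambda> y) \<le> C * real n powr (- (1 / q))"
proof -
  define b where "b \<nu> = multi_power (\<lambda>j. inverse (\<rho> j)) \<nu>" for \<nu>
  define \<kappa> where "\<kappa> \<nu> = b \<nu> * beta_weight \<nu>" for \<nu>
  have b: "b \<nu> > 0" "b \<nu> * multi_power \<rho> \<nu> = 1" for \<nu>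
    unfolding b_def by (rule multi_power_inverse)+
  have \<kappa>: "0 \<le> \<kappa> \<nu> \<and> \<kappa> \<nu> \<le> b \<nu> * (beta_weight \<nu>)\<^sup>2" for \<nu>
    using b(1)[of \<nu>] beta_weight_ge_1[of \<nu>] self_le_power[of "beta_weight \<nu>" 2] by (simp add: \<kappa>_def)
  have "0 < inverse (\<rho> j)" "inverse (\<rho> j) < 1" for j
    using \<rho>_pos[of j] \<rho>_gt_1[of j] by (simp_all add: inverse_less_1_iff)
  note majorant = monotone_majorant_summable[OF this q summable_q \<kappa>[unfolded b_def]]
  note upper = majorant(1)
  from majorant(2) obtain S where
    S: "\<And>X. finite X \<Longrightarrow> X \<subseteq> multi_indices \<Longrightarrow> (\<Sum>\<nu>\<in>X. monotone_majorant \<kappa> \<nu> powr q) \<le> S"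
    by blast
  have nonneg: "0 \<le> monotone_majorant \<kappa> \<nu>" if "\<nu> \<in> multi_indices" for \<nu>
    using upper[OF that] \<kappa>[of \<nu>] by simp
  have "square_integrable param_measure (\<lambda>y. u y - truncated_legendre u \<Lambda> y) \<and>
      L2_norm param_measure (\<lambda>y. u y - truncated_legendre u \<Lambda> y) \<le>
        (sqrt coefficient_sum_bound * S powr (1 / q)) * real n powr (- (1 / q))"
    if n: "1 \<le> n" and \<Lambda>: "n_largest (monotone_majorant \<kappa>) n \<Lambda>" for n \<Lambda>
  proof
    define m where "m = S powr (1 / q) * real n powr (- (1 / q))"
    have c: "continuous_on param_domain (\<lambda>y. u y - truncated_legendre u \<Lambda> y)"
      unfolding truncated_legendre_eq by (intro continuous_intros continuous_on_solution continuous_on_legendre_sum)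
    show "square_integrable param_measure (\<lambda>y. u y - truncated_legendre u \<Lambda> y)"
      unfolding square_integrable_def
      by (intro conjI continuous_imp_measurable_param continuous_imp_integrable_param continuous_intros c)
    have tail: "(\<Sum>\<nu>\<in>X. (norm (fourier_legendre u \<nu>))\<^sup>2) \<le> m\<^sup>2 * coefficient_sum_bound"
      if X: "finite X" "X \<subseteq> multi_indices - \<Lambda>" for X
    proof -
      have "(\<Sum>\<nu>\<in>X. (norm (fourier_legendre u \<nu>))\<^sup>2) \<le>
          (\<Sum>\<nu>\<in>X. m\<^sup>2 * (multi_power \<rho> \<nu> * norm (fourier_legendre u \<nu>))\<^sup>2)"
      proof (rule sum_mono)
        fix \<nu> assume "\<nu> \<in> X"
        then have \<nu>: "\<nu> \<in> multi_indices - \<Lambda>" using X by blast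
        have "b \<nu> \<le> \<kappa> \<nu>" using b(1)[of \<nu>] beta_weight_ge_1[of \<nu>] by (simp add: \<kappa>_def)
        also have "\<dots> \<le> monotone_majorant \<kappa> \<nu>" using \<nu> by (intro upper) simp
        also have "\<dots> \<le> m" unfolding m_def by (rule n_largest_tail_max[OF q nonneg S \<Lambda> n \<nu>])
        finally have "(b \<nu>)\<^sup>2 \<le> m\<^sup>2" using b(1)[of \<nu>] by (intro power_mono) auto
        have "(norm (fourier_legendre u \<nu>))\<^sup>2 = (b \<nu> * multi_power \<rho> \<nu> * norm (fourier_legendre u \<nu>))\<^sup>2"
          by (simp add: b(2))
        also have "\<dots> = (b \<nu>)\<^sup>2 * (multi_power \<rho> \<nu> * norm (fourier_legendre u \<nu>))\<^sup>2"
          by (simp add: power_mult_distrib mult_ac)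
        also have "\<dots> \<le> m\<^sup>2 * (multi_power \<rho> \<nu> * norm (fourier_legendre u \<nu>))\<^sup>2"
          using \<open>(b \<nu>)\<^sup>2 \<le> m\<^sup>2\<close> by (rule mult_right_mono) simp
        finally show "(norm (fourier_legendre u \<nu>))\<^sup>2 \<le> m\<^sup>2 * (multi_power \<rho> \<nu> * norm (fourier_legendre u \<nu>))\<^sup>2" .
      qed
      also have "\<dots> \<le> m\<^sup>2 * coefficient_sum_bound"
        unfolding sum_distrib_left[symmetric]
        using X by (intro mult_left_mono weighted_sum_fourier_legendre_le) auto
      finally show ?thesis .
    qed
    have "(\<integral>y. (norm (u y - truncated_legendre u \<Lambda> y))\<^sup>2 \<partial>param_measure) \<le> m\<^sup>2 * coefficient_sum_bound"
      unfolding truncated_legendre_eq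
      by (rule legendre_truncation_mean_square[OF continuous_on_solution _ _ tail])
        (use \<Lambda> in \<open>auto simp: n_largest_def\<close>)
    then have "L2_norm param_measure (\<lambda>y. u y - truncated_legendre u \<Lambda> y) \<le> sqrt (m\<^sup>2 * coefficient_sum_bound)"
      unfolding L2_norm_def by (rule real_sqrt_le_mono)
    also have "\<dots> = (sqrt coefficient_sum_bound * S powr (1 / q)) * real n powr (- (1 / q))"
      by (simp add: real_sqrt_mult m_def)
    finally show "L2_norm param_measure (\<lambda>y. u y - truncated_legendre u \<Lambda> y) \<le>
        (sqrt coefficient_sum_bound * S powr (1 / q)) * real n powr (- (1 / q))" .
  qed
  then show ?thesis
    unfolding \<kappa>_def b_def by (intro exI[of _ "sqrt coefficient_sum_bound * S powr (1 / q)"] allI impI) blast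
qed

text \<open>
  The sup norm of \<open>L\<^sub>\<nu>\<close> is at most \<open>\<beta>(\<nu>)\<close>.  The discarded terms therefore sum to at most the sum of
  \<open>(\<rho>\<^sup>\<nu> \<parallel>w\<^sub>\<nu>\<parallel>) (b\<^sup>\<nu> \<beta>(\<nu>))\<close>, to which the Cauchy-Schwarz inequality applies.
\<close>

lemma uniform_rate:
  assumes q2: "q < 2"
  shows "\<exists>C. \<forall>n\<ge>1. \<forall>\<Lambda>. n_largest (monotone_majorant (\<lambda>\<nu>. multi_power (\<lambda>j. inverse (\<rho> j)) \<nu> * (beta_weight \<nu>)\<^sup>2)) n \<Lambda> \<longrightarrow>
    param_sup_norm (\<lambda>y. u y - truncated_legendre u \<Lambda> y) \<le> ereal (C * real n powr (- (1 / q - 1 / 2)))"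
proof -
  define b where "b \<nu> = multi_power (\<lambda>j. inverse (\<rho> j)) \<nu>" for \<nu>
  define \<kappa> where "\<kappa> \<nu> = b \<nu> * (beta_weight \<nu>)\<^sup>2" for \<nu>
  have b: "b \<nu> > 0" "b \<nu> * multi_power \<rho> \<nu> = 1" for \<nu>
    unfolding b_def by (rule multi_power_inverse)+
  have \<kappa>: "0 \<le> \<kappa> \<nu> \<and> \<kappa> \<nu> \<le> b \<nu> * (beta_weight \<nu>)\<^sup>2" for \<nu>
    using b(1)[of \<nu>] by (simp add: \<kappa>_def)
  have "0 < inverse (\<rho> j)" "inverse (\<rho> j) < 1" for j
    using \<rho>_pos[of j] \<rho>_gt_1[of j] by (simp_all add: inverse_less_1_iff)
  note majorant = monotone_majorant_summable[OF this q summable_q \<kappa>[unfolded b_def]]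
  note upper = majorant(1)
  from majorant(2) obtain S where
    S: "\<And>X. finite X \<Longrightarrow> X \<subseteq> multi_indices \<Longrightarrow> (\<Sum>\<nu>\<in>X. monotone_majorant \<kappa> \<nu> powr q) \<le> S"
    by blast
  have nonneg: "0 \<le> monotone_majorant \<kappa> \<nu>" if "\<nu> \<in> multi_indices" for \<nu>
    using upper[OF that] \<kappa>[of \<nu>] by simp
  have "param_sup_norm (\<lambda>y. u y - truncated_legendre u \<Lambda> y) \<le>
      ereal ((sqrt coefficient_sum_bound * S powr (1 / q)) * real n powr (- (1 / q - 1 / 2)))"
    if n: "1 \<le> n" and \<Lambda>: "n_largest (monotone_majorant \<kappa>) n \<Lambda>" for n \<Lambda>
  proof -
    define m where "m = S powr (1 / q) * real n powr (- (1 / q - 1 / 2))"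
    have m: "0 \<le> m" by (simp add: m_def)
    have tail: "(\<Sum>\<nu>\<in>X. norm (fourier_legendre u \<nu>) * beta_weight \<nu>) \<le> sqrt coefficient_sum_bound * m"
      if X: "finite X" "X \<subseteq> multi_indices - \<Lambda>" for X
    proof (rule power2_le_imp_le)
      have "(\<Sum>\<nu>\<in>X. norm (fourier_legendre u \<nu>) * beta_weight \<nu>) =
          (\<Sum>\<nu>\<in>X. (multi_power \<rho> \<nu> * norm (fourier_legendre u \<nu>)) * (b \<nu> * beta_weight \<nu>))"
      proof (rule sum.cong[OF refl])
        fix \<nu>
        have "(multi_power \<rho> \<nu> * norm (fourier_legendre u \<nu>)) * (b \<nu> * beta_weight \<nu>) =
            (b \<nu> * multi_power \<rho> \<nu>) * (norm (fourier_legendre u \<nu>) * beta_weight \<nu>)"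
          by (simp only: mult_ac)
        then show "norm (fourier_legendre u \<nu>) * beta_weight \<nu> =
            (multi_power \<rho> \<nu> * norm (fourier_legendre u \<nu>)) * (b \<nu> * beta_weight \<nu>)"
          by (simp add: b(2))
      qed
      then have "(\<Sum>\<nu>\<in>X. norm (fourier_legendre u \<nu>) * beta_weight \<nu>)\<^sup>2 \<le>
          (\<Sum>\<nu>\<in>X. (multi_power \<rho> \<nu> * norm (fourier_legendre u \<nu>))\<^sup>2) * (\<Sum>\<nu>\<in>X. (b \<nu> * beta_weight \<nu>)\<^sup>2)"
        by (simp only: Cauchy_Schwarz_ineq_sum)
      also have "\<dots> \<le> coefficient_sum_bound * m\<^sup>2"
      proof (rule mult_mono)
        show "(\<Sum>\<nu>\<in>X. (multi_power \<rho> \<nu> * norm (fourier_legendre u \<nu>))\<^sup>2) \<le> coefficient_sum_bound"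
          using X by (intro weighted_sum_fourier_legendre_le) auto
        have "(\<Sum>\<nu>\<in>X. (b \<nu> * beta_weight \<nu>)\<^sup>2) \<le> (\<Sum>\<nu>\<in>X. (monotone_majorant \<kappa> \<nu>)\<^sup>2)"
        proof (rule sum_mono)
          fix \<nu> assume "\<nu> \<in> X"
          then have \<nu>: "\<nu> \<in> multi_indices" using X by blast
          have "b \<nu> * beta_weight \<nu> \<le> \<kappa> \<nu>"
            using b(1)[of \<nu>] beta_weight_ge_1[of \<nu>] self_le_power[of "beta_weight \<nu>" 2] by (simp add: \<kappa>_def)
          also have "\<dots> \<le> monotone_majorant \<kappa> \<nu>" by (rule upper[OF \<nu>])
          finally show "(b \<nu> * beta_weight \<nu>)\<^sup>2 \<le> (monotone_majorant \<kappa> \<nu>)\<^sup>2"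
            using b(1)[of \<nu>] beta_weight_ge_1[of \<nu>] by (intro power_mono) auto
        qed
        also have "\<dots> \<le> m\<^sup>2"
          unfolding m_def by (rule n_largest_tail_square_sum[OF q q2 nonneg S \<Lambda> n X])
        finally show "(\<Sum>\<nu>\<in>X. (b \<nu> * beta_weight \<nu>)\<^sup>2) \<le> m\<^sup>2" .
      qed (auto intro: sum_nonneg coefficient_sum_bound_nonneg)
      also have "\<dots> = (sqrt coefficient_sum_bound * m)\<^sup>2"
        using coefficient_sum_bound_nonneg by (simp add: power_mult_distrib)
      finally show "(\<Sum>\<nu>\<in>X. norm (fourier_legendre u \<nu>) * beta_weight \<nu>)\<^sup>2 \<le> (sqrt coefficient_sum_bound * m)\<^sup>2" .
    qed (use m coefficient_sum_bound_nonneg in simp)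
    have "norm (u y - truncated_legendre u \<Lambda> y) \<le> sqrt coefficient_sum_bound * m" if "y \<in> param_domain" for y
      unfolding truncated_legendre_eq
      by (rule legendre_truncation_uniform[OF continuous_on_solution _ _ tail that])
        (use \<Lambda> in \<open>auto simp: n_largest_def\<close>)
    then show ?thesis
      unfolding param_sup_norm_def by (intro SUP_least) (simp add: m_def mult.assoc)
  qed
  then show ?thesis
    unfolding \<kappa>_def b_def by (intro exI[of _ "sqrt coefficient_sum_bound * S powr (1 / q)"] allI impI) blast
qed

end

end

theorem theorem2p5:
  fixes D :: "(real ^ 'n) set"
    and f abar :: "real ^ 'n \<Rightarrow> real"
    and \<psi> :: "nat \<Rightarrow> real ^ 'n \<Rightarrow> real"
    and u :: "(nat \<Rightarrow> real) \<Rightarrow> (real ^ 'n) H1_pair"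
    and \<rho> :: "nat \<Rightarrow> real" and r q :: real
  assumes "CARD('n) \<in> {1, 2, 3}"
    and "bounded_Lipschitz_domain D"
    and "square_integrable (lebesgue_on D) f"
    and "essentially_bounded (lebesgue_on D) abar"
    and "\<And>j. essentially_bounded (lebesgue_on D) (\<psi> j)"
    and "\<And>y. y \<in> param_domain \<Longrightarrow> weak_solution D (affine_coefficient abar \<psi> y) f (u y)"
    and "\<And>j. \<rho> j > 0"
    and "r > 0"
    and "AE x in lebesgue_on D. summable (\<lambda>j. \<rho> j * \<bar>\<psi> j x\<bar>) \<and>
           (\<Sum>j. \<rho> j * \<bar>\<psi> j x\<bar>) \<le> abar x - r"
    and "q > 0" and "summable (\<lambda>j. (inverse (\<rho> j)) powr q)"
    and "\<And>j. \<rho> j > 1"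
  shows
    "(\<exists>C. \<forall>n\<ge>1. \<forall>\<Lambda>. downward_closed \<Lambda> \<and>
        n_largest (monotone_majorant (\<lambda>\<nu>. multi_power (\<lambda>j. inverse (\<rho> j)) \<nu> * beta_weight \<nu>)) n \<Lambda> \<longrightarrow>
        square_integrable param_measure (\<lambda>y. u y - truncated_legendre u \<Lambda> y) \<and>
        L2_norm param_measure (\<lambda>y. u y - truncated_legendre u \<Lambda> y) \<le> C * real n powr (- (1 / q))) \<and>
     (q < 2 \<longrightarrow>
      (\<exists>C. \<forall>n\<ge>1. \<forall>\<Lambda>. downward_closed \<Lambda> \<and>
        n_largest (monotone_majorant (\<lambda>\<nu>. multi_power (\<lambda>j. inverse (\<rho> j)) \<nu> * (beta_weight \<nu>)\<^sup>2)) n \<Lambda> \<longrightarrow>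
        param_sup_norm (\<lambda>y. u y - truncated_legendre u \<Lambda> y) \<le> ereal (C * real n powr (- (1 / q - 1 / 2)))))"
proof -
  have b0: "(\<lambda>j. inverse (\<rho> j)) \<longlonglongrightarrow> 0"
  proof -
    have "(\<lambda>j. (inverse (\<rho> j) powr q) powr (1 / q)) \<longlonglongrightarrow> 0 powr (1 / q)"
      using summable_LIMSEQ_zero[OF assms(11)] assms(10)
      by (intro tendsto_powr') (auto intro!: tendsto_const)
    moreover have "(inverse (\<rho> j) powr q) powr (1 / q) = inverse (\<rho> j)" for j
      using assms(7)[of j] assms(10) by (simp add: powr_powr)
    ultimately show ?thesis by simp
  qed
  have "open D" "bounded D"
    using assms(2) by (simp_all add: bounded_Lipschitz_domain_def)
  then interpret affine_elliptic D f abar \<psi> u \<rho> r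
    by (rule affine_elliptic.intro[OF _ _ assms(3,4,5,6,8,9,12) b0])
  show ?thesis
  proof (intro conjI impI)
    assume "q < 2"
    from uniform_rate[OF assms(10,11) this]
    show "\<exists>C. \<forall>n\<ge>1. \<forall>\<Lambda>. downward_closed \<Lambda> \<and>
        n_largest (monotone_majorant (\<lambda>\<nu>. multi_power (\<lambda>j. inverse (\<rho> j)) \<nu> * (beta_weight \<nu>)\<^sup>2)) n \<Lambda> \<longrightarrow>
        param_sup_norm (\<lambda>y. u y - truncated_legendre u \<Lambda> y) \<le> ereal (C * real n powr (- (1 / q - 1 / 2)))"
      by (rule ex_forward) simp
  qed (rule ex_forward[OF mean_square_rate[OF assms(10,11)]], simp)
qed

end
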